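(* Let $A$ be a commutative Noetherian ring containing a field of characteristic zero. Let $R=A[X_1,\ldots,X_m]$ and let $A_m(A)$ be the $m$-th Weyl algebra over $A$, both with their standard gradings. If $I,J\subseteq R$ are homogeneous ideals and $L$ is a generalized Eulerian $A_m(A)$-module, then $H^i_{I,J}(L)$ is a generalized Eulerian $A_m(A)$-module (for each $i\ge 0$).
   Context: $A_m(A)=A\langle X_1,\ldots,X_m,\partial_1,\ldots,\partial_m\rangle$ is the $m$-th Weyl algebra over $A$ ($m\ge 1$): elements of $A$ are central, the $X_i$ commute with each other, the $\partial_i$ commute with each other, and $\partial_iX_j-X_j\partial_i=\delta_{ij}$. Standard gradings: $\deg z=0$ for $z\in A$, $\deg X_i=1$, $\deg\partial_i=-1$. Modules are left modules. With $\mathcal{E}_m=\sum_{i=1}^m X_i\partial_i$, a graded $A_m(A)$-module $M$ is generalized Eulerian if for each homogeneous $y\in M$ of degree $|y|$ there is a positive integer $a$ (depending on $y$) with $(\mathcal{E}_m-|y|)^a\cdot y=0$. For ideals $I,J$ of a commutative Noetherian ring $B$ and a $B$-module $N$, $\Gamma_{I,J}(N)=\{y\in N\mid I^ny\subseteq Jy\text{ for some }n\ge1\}$; this is a left exact functor and $H^i_{I,J}(-)$ is its $i$-th right derived functor. When $I,J$ are homogeneous ideals of $R$ and $L$ is a graded $R$-module, $\Gamma_{I,J}(L)$ is graded by $\Gamma_{I,J}(L)_u=\{y\in L_u\mid I^ny\subseteq Jy\text{ for some }n\ge 1\}$, and $H^i_{I,J}(L)$ is graded as the $i$-th right derived functor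 of $\Gamma_{I,J}$ on the category of graded $R$-modules (whose underlying module is $H^i_{I,J}(L)$). Structure of $A_m(A)$-module on $H^i_{I,J}(L)$: for a homogeneous $b\in R$ let ${}^*S_{b,J}=\{b^n+j\mid n\ge0,\ j\in J\text{ homogeneous with }\deg j=\deg b^n\}$, a multiplicatively closed set of homogeneous elements, and for a graded module $L$ put ${}^*L_{b,J}=({}^*S_{b,J})^{-1}L$. For homogeneous generators $\mathbf{b}=b_1,\ldots,b_s$ of $I$ let ${}^*\mathbf{C}^\bullet_{\mathbf{b},J}=\bigotimes_{i=1}^s\big(0\to R\to {}^*R_{b_i,J}\to0\big)$. There is a graded isomorphism $H^i_{I,J}(L)\cong H^i({}^*\mathbf{C}^\bullet_{\mathbf{b},J}\otimes_R L)$. A localization of an $A_m(A)$-module at a multiplicatively closed subset of $R$ is an $A_m(A)$-module by the quotient rule $\partial_i(y/s)=\partial_i y/s-(\partial s/\partial X_i)\,y/s^2$, so for an $A_m(A)$-module $L$ the complex ${}^*\mathbf{C}^\bullet_{\mathbf{b},J}\otimes_R L$ is a complex of graded $A_m(A)$-modules, and $H^i_{I,J}(L)$ gets its graded $A_m(A)$-module structure through this isomorphism. *)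

theory Defs
  imports
    "HOL-Algebra.Algebra"
    "HOL-Algebra.Algebraic_Closure_Type"
    "HOL-Library.Poly_Mapping"
begin

section \<open>Graded modules over a graded ring\<close>

text \<open>
  The locale \<^locale>\<open>module\<close> of the library requires a commutative ring of scalars; the Weyl algebra
  is not commutative. Gradings are indexed by the integers and are kept separate from the module
  records, so that the same module can carry several gradings.
\<close>

locale left_module = R?: ring R + M?: abelian_group M
  for R :: "'r ring" (structure) and M :: "('r, 'm) module" (structure) +
  assumes smult_closed:
      "\<lbrakk>a \<in> carrier R; x \<in> carrier M\<rbrakk> \<Longrightarrow> a \<odot>\<^bsub>M\<^esub> x \<in> carrier M"
    and smult_l_distr:
      "\<lbrakk>a \<in> carrier R; b \<in> carrier R; x \<in> carrier M\<rbrakk> \<Longrightarrow>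
        (a \<oplus> b) \<odot>\<^bsub>M\<^esub> x = a \<odot>\<^bsub>M\<^esub> x \<oplus>\<^bsub>M\<^esub> b \<odot>\<^bsub>M\<^esub> x"
    and smult_r_distr:
      "\<lbrakk>a \<in> carrier R; x \<in> carrier M; y \<in> carrier M\<rbrakk> \<Longrightarrow>
        a \<odot>\<^bsub>M\<^esub> (x \<oplus>\<^bsub>M\<^esub> y) = a \<odot>\<^bsub>M\<^esub> x \<oplus>\<^bsub>M\<^esub> a \<odot>\<^bsub>M\<^esub> y"
    and smult_assoc:
      "\<lbrakk>a \<in> carrier R; b \<in> carrier R; x \<in> carrier M\<rbrakk> \<Longrightarrow>
        (a \<otimes> b) \<odot>\<^bsub>M\<^esub> x = a \<odot>\<^bsub>M\<^esub> (b \<odot>\<^bsub>M\<^esub> x)"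
    and smult_one: "x \<in> carrier M \<Longrightarrow> \<one> \<odot>\<^bsub>M\<^esub> x = x"

definition graded_module ::
  "'r ring \<Rightarrow> (int \<Rightarrow> 'r set) \<Rightarrow> ('r, 'm) module \<Rightarrow> (int \<Rightarrow> 'm set) \<Rightarrow> bool" where
  "graded_module R gR M gM \<longleftrightarrow>
     left_module R M \<and>
     (\<forall>u. additive_subgroup (gM u) M) \<and>
     (\<forall>y\<in>carrier M. \<exists>!f. finite {u. f u \<noteq> \<zero>\<^bsub>M\<^esub>} \<and> (\<forall>u. f u \<in> gM u) \<and>
        (\<Oplus>\<^bsub>M\<^esub>u\<in>{u. f u \<noteq> \<zero>\<^bsub>M\<^esub>}. f u) = y) \<and>
     (\<forall>u v. \<forall>r\<in>gR u. \<forall>y\<in>gM v. r \<odot>\<^bsub>M\<^esub> y \<in> gM (u + v))"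

definition graded_hom ::
  "'r ring \<Rightarrow> ('r, 'm) module \<Rightarrow> (int \<Rightarrow> 'm set) \<Rightarrow> ('r, 'k) module \<Rightarrow> (int \<Rightarrow> 'k set) \<Rightarrow>
     ('m \<Rightarrow> 'k) \<Rightarrow> bool" where
  "graded_hom R M gM N gN f \<longleftrightarrow>
     f \<in> carrier M \<rightarrow> carrier N \<and>
     (\<forall>x\<in>carrier M. \<forall>y\<in>carrier M. f (x \<oplus>\<^bsub>M\<^esub> y) = f x \<oplus>\<^bsub>N\<^esub> f y) \<and>
     (\<forall>r\<in>carrier R. \<forall>x\<in>carrier M. f (r \<odot>\<^bsub>M\<^esub> x) = r \<odot>\<^bsub>N\<^esub> f x) \<and>
     (\<forall>u. f ` gM u \<subseteq> gN u)"

definition graded_iso ::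
  "'r ring \<Rightarrow> ('r, 'm) module \<Rightarrow> (int \<Rightarrow> 'm set) \<Rightarrow> ('r, 'k) module \<Rightarrow> (int \<Rightarrow> 'k set) \<Rightarrow>
     ('m \<Rightarrow> 'k) \<Rightarrow> bool" where
  "graded_iso R M gM N gN f \<longleftrightarrow>
     graded_hom R M gM N gN f \<and> bij_betw f (carrier M) (carrier N) \<and> (\<forall>u. f ` gM u = gN u)"

definition homogeneous_ideal :: "'r ring \<Rightarrow> (int \<Rightarrow> 'r set) \<Rightarrow> 'r set \<Rightarrow> bool" where
  "homogeneous_ideal R gR I \<longleftrightarrow> (\<exists>B \<subseteq> (\<Union>u. gR u). I = genideal R B)"

definition restrict_scalars :: "('r \<Rightarrow> 's) \<Rightarrow> ('s, 'm) module \<Rightarrow> ('r, 'm) module" where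
  "restrict_scalars h M =
     \<lparr>carrier = carrier M, monoid.mult = monoid.mult M, one = \<one>\<^bsub>M\<^esub>, ring.zero = \<zero>\<^bsub>M\<^esub>, add = add M,
      module.smult = (\<lambda>r x. h r \<odot>\<^bsub>M\<^esub> x)\<rparr>"


section \<open>Cohomology and graded injective resolutions\<close>

definition cocycles :: "(nat \<Rightarrow> ('r, 'm) module) \<Rightarrow> (nat \<Rightarrow> 'm \<Rightarrow> 'm) \<Rightarrow> nat \<Rightarrow> 'm set" where
  "cocycles C d i = {x \<in> carrier (C i). d i x = \<zero>\<^bsub>C (Suc i)\<^esub>}"

definition coboundaries :: "(nat \<Rightarrow> ('r, 'm) module) \<Rightarrow> (nat \<Rightarrow> 'm \<Rightarrow> 'm) \<Rightarrow> nat \<Rightarrow> 'm set" where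
  "coboundaries C d i = (case i of 0 \<Rightarrow> {\<zero>\<^bsub>C 0\<^esub>} | Suc k \<Rightarrow> d k ` carrier (C k))"

text \<open>As in \<^const>\<open>FactRing\<close>, the elements of the quotient are the cosets. The components
  \<^const>\<open>monoid.mult\<close> and \<^const>\<open>one\<close> of a module record play no role.\<close>

definition cohomology ::
  "(nat \<Rightarrow> ('r, 'm) module) \<Rightarrow> (nat \<Rightarrow> 'm \<Rightarrow> 'm) \<Rightarrow> nat \<Rightarrow> ('r, 'm set) module" where
  "cohomology C d i =
     (let B = coboundaries C d i in
      \<lparr>carrier = (\<lambda>x. B +>\<^bsub>C i\<^esub> x) ` cocycles C d i,
       monoid.mult = (\<lambda>_ _. B), one = B, ring.zero = B,
       add = set_add (C i),
       module.smult = (\<lambda>r K. \<Union>x\<in>K. B +>\<^bsub>C i\<^esub> (r \<odot>\<^bsub>C i\<^esub> x))\<rparr>)"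

definition cohomology_grading ::
  "(nat \<Rightarrow> ('r, 'm) module) \<Rightarrow> (nat \<Rightarrow> int \<Rightarrow> 'm set) \<Rightarrow> (nat \<Rightarrow> 'm \<Rightarrow> 'm) \<Rightarrow> nat \<Rightarrow>
     int \<Rightarrow> 'm set set" where
  "cohomology_grading C gC d i u =
     (\<lambda>x. coboundaries C d i +>\<^bsub>C i\<^esub> x) ` (cocycles C d i \<inter> gC i u)"

text \<open>
  Injectivity in the category of graded modules. A definition cannot quantify over the types of
  the test modules, so these live on the type of the ring. This is no restriction: by the graded
  Baer criterion it suffices to test on the inclusions of homogeneous ideals into shifts of the ring.
\<close>

definition graded_injective ::
  "'r ring \<Rightarrow> (int \<Rightarrow> 'r set) \<Rightarrow> ('r, 'm) module \<Rightarrow> (int \<Rightarrow> 'm set) \<Rightarrow> bool" where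
  "graded_injective R gR E gE \<longleftrightarrow>
     graded_module R gR E gE \<and>
     (\<forall>(M :: ('r, 'r) module) gM (N :: ('r, 'r) module) gN f g.
        graded_module R gR M gM \<and> graded_module R gR N gN \<and>
        graded_hom R M gM N gN f \<and> inj_on f (carrier M) \<and> graded_hom R M gM E gE g \<longrightarrow>
        (\<exists>h. graded_hom R N gN E gE h \<and> (\<forall>x\<in>carrier M. h (f x) = g x)))"

text \<open>\<open>0 \<rightarrow> M \<rightarrow> E 0 \<rightarrow> E 1 \<rightarrow> \<dots>\<close> exact, with augmentation \<open>\<epsilon>\<close> and differentials \<open>d\<close>.\<close>

definition graded_injective_resolution ::
  "'r ring \<Rightarrow> (int \<Rightarrow> 'r set) \<Rightarrow> ('r, 'm) module \<Rightarrow> (int \<Rightarrow> 'm set) \<Rightarrow>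
     (nat \<Rightarrow> ('r, 'e) module) \<Rightarrow> (nat \<Rightarrow> int \<Rightarrow> 'e set) \<Rightarrow> (nat \<Rightarrow> 'e \<Rightarrow> 'e) \<Rightarrow> ('m \<Rightarrow> 'e) \<Rightarrow> bool" where
  "graded_injective_resolution R gR M gM E gE d \<epsilon> \<longleftrightarrow>
     (\<forall>k. graded_injective R gR (E k) (gE k)) \<and>
     graded_hom R M gM (E 0) (gE 0) \<epsilon> \<and> inj_on \<epsilon> (carrier M) \<and>
     (\<forall>k. graded_hom R (E k) (gE k) (E (Suc k)) (gE (Suc k)) (d k)) \<and>
     \<epsilon> ` carrier M = cocycles E d 0 \<and>
     (\<forall>k. d k ` carrier (E k) = cocycles E d (Suc k))"


section \<open>Torsion with respect to a pair of ideals and its derived functors\<close>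

definition ideal_pow :: "'r ring \<Rightarrow> 'r set \<Rightarrow> nat \<Rightarrow> 'r set" where
  "ideal_pow R I n = (ideal_prod R I ^^ n) (carrier R)"

definition Gamma :: "'r ring \<Rightarrow> 'r set \<Rightarrow> 'r set \<Rightarrow> ('r, 'm) module \<Rightarrow> ('r, 'm) module" where
  "Gamma R I J M =
     M\<lparr>carrier := {y \<in> carrier M. \<exists>n\<ge>1. (\<lambda>r. r \<odot>\<^bsub>M\<^esub> y) ` ideal_pow R I n \<subseteq> (\<lambda>r. r \<odot>\<^bsub>M\<^esub> y) ` J}\<rparr>"

definition Gamma_grading ::
  "'r ring \<Rightarrow> 'r set \<Rightarrow> 'r set \<Rightarrow> ('r, 'm) module \<Rightarrow> (int \<Rightarrow> 'm set) \<Rightarrow> int \<Rightarrow> 'm set" where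
  "Gamma_grading R I J M gM u = carrier (Gamma R I J M) \<inter> gM u"

text \<open>The \<open>i\<close>-th right derived functor of \<^const>\<open>Gamma\<close>, computed from a graded injective
  resolution \<open>(E, gE, d)\<close>.\<close>

definition local_cohomology ::
  "'r ring \<Rightarrow> 'r set \<Rightarrow> 'r set \<Rightarrow> (nat \<Rightarrow> ('r, 'e) module) \<Rightarrow> (nat \<Rightarrow> 'e \<Rightarrow> 'e) \<Rightarrow> nat \<Rightarrow>
     ('r, 'e set) module" where
  "local_cohomology R I J E d i = cohomology (\<lambda>k. Gamma R I J (E k)) d i"

definition local_cohomology_grading ::
  "'r ring \<Rightarrow> 'r set \<Rightarrow> 'r set \<Rightarrow> (nat \<Rightarrow> ('r, 'e) module) \<Rightarrow> (nat \<Rightarrow> int \<Rightarrow> 'e set) \<Rightarrow>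
     (nat \<Rightarrow> 'e \<Rightarrow> 'e) \<Rightarrow> nat \<Rightarrow> int \<Rightarrow> 'e set set" where
  "local_cohomology_grading R I J E gE d i =
     cohomology_grading (\<lambda>k. Gamma R I J (E k)) (\<lambda>k. Gamma_grading R I J (E k) (gE k)) d i"


section \<open>The polynomial ring\<close>

text \<open>The ring \<open>A\<close> is a type \<open>'a\<close>; the variables are indexed by a finite type \<open>'n\<close> with \<open>m\<close>
  elements (so \<open>m \<ge> 1\<close>).\<close>

type_synonym ('n, 'a) mpoly = "('n \<Rightarrow>\<^sub>0 nat) \<Rightarrow>\<^sub>0 'a"

abbreviation mpoly_ring :: "('n, 'a::comm_ring_1) mpoly ring" where
  "mpoly_ring \<equiv> ring_of_type_algebra"

definition mpoly_const :: "'a::comm_ring_1 \<Rightarrow> ('n, 'a) mpoly" where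
  "mpoly_const a = Poly_Mapping.single 0 a"

definition mpoly_var :: "'n \<Rightarrow> ('n, 'a::comm_ring_1) mpoly" where
  "mpoly_var i = Poly_Mapping.single (Poly_Mapping.single i 1) 1"

definition poly_grading :: "int \<Rightarrow> ('n::finite, 'a::comm_ring_1) mpoly set" where
  "poly_grading u =
     {p. \<forall>\<alpha>\<in>Poly_Mapping.keys p. (\<Sum>i\<in>UNIV. int (Poly_Mapping.lookup \<alpha> i)) = u}"

definition partial_deriv :: "'n \<Rightarrow> ('n, 'a::comm_ring_1) mpoly \<Rightarrow> ('n, 'a) mpoly" where
  "partial_deriv i p =
     (\<Sum>\<alpha>\<in>Poly_Mapping.keys p. Poly_Mapping.single (\<alpha> - Poly_Mapping.single i 1)
        (of_nat (Poly_Mapping.lookup \<alpha> i) * Poly_Mapping.lookup p \<alpha>))"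


section \<open>The Weyl algebra\<close>

text \<open>The free monoid, written additively so that \<open>'x free_word \<Rightarrow>\<^sub>0 'a\<close> is the free associative
  \<open>'a\<close>-algebra on \<open>'x\<close> (with central coefficients).\<close>

datatype 'x free_word = Free_Word (letters: "'x list")

instantiation free_word :: (type) monoid_add
begin

definition zero_free_word :: "'a free_word" where
  "zero_free_word = Free_Word []"

definition plus_free_word :: "'a free_word \<Rightarrow> 'a free_word \<Rightarrow> 'a free_word" where
  "plus_free_word v w = Free_Word (letters v @ letters w)"

instance
  by standard (simp_all add: zero_free_word_def plus_free_word_def)

end

datatype 'n weyl_gen = X_gen 'n | D_gen 'n

type_synonym ('n, 'a) free_weyl = "'n weyl_gen free_word \<Rightarrow>\<^sub>0 'a"

type_synonym ('n, 'a) weyl = "('n, 'a) free_weyl set"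

definition free_X :: "'n \<Rightarrow> ('n, 'a::comm_ring_1) free_weyl" where
  "free_X i = Poly_Mapping.single (Free_Word [X_gen i]) 1"

definition free_D :: "'n \<Rightarrow> ('n, 'a::comm_ring_1) free_weyl" where
  "free_D i = Poly_Mapping.single (Free_Word [D_gen i]) 1"

definition weyl_relations :: "('n, 'a::comm_ring_1) free_weyl set" where
  "weyl_relations =
     {free_X i * free_X j - free_X j * free_X i | i j. True} \<union>
     {free_D i * free_D j - free_D j * free_D i | i j. True} \<union>
     {free_D i * free_X j - free_X j * free_D i - (if i = j then 1 else 0) | i j. True}"

definition weyl_ideal :: "('n, 'a::comm_ring_1) free_weyl set" where
  "weyl_ideal = genideal ring_of_type_algebra weyl_relations"

definition weyl_algebra :: "('n, 'a::comm_ring_1) weyl ring" where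
  "weyl_algebra = ring_of_type_algebra Quot weyl_ideal"

definition weyl_class :: "('n, 'a::comm_ring_1) free_weyl \<Rightarrow> ('n, 'a) weyl" where
  "weyl_class f = weyl_ideal +>\<^bsub>ring_of_type_algebra\<^esub> f"

fun gen_degree :: "'n weyl_gen \<Rightarrow> int" where
  "gen_degree (X_gen i) = 1"
| "gen_degree (D_gen i) = - 1"

definition weyl_grading :: "int \<Rightarrow> ('n, 'a::comm_ring_1) weyl set" where
  "weyl_grading u =
     weyl_class ` {f. \<forall>w\<in>Poly_Mapping.keys f. sum_list (map gen_degree (letters w)) = u}"

text \<open>The ring homomorphism from \<open>R = A[X]\<close> to the Weyl algebra. The order on the index type only
  fixes the order of the factors of a monomial, which is irrelevant since the \<open>X i\<close> commute.\<close>

definition monomial_word :: "('n::{finite,linorder} \<Rightarrow>\<^sub>0 nat) \<Rightarrow> 'n weyl_gen free_word" where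
  "monomial_word \<alpha> =
     Free_Word (concat (map (\<lambda>i. replicate (Poly_Mapping.lookup \<alpha> i) (X_gen i))
       (sorted_list_of_set UNIV)))"

definition poly_to_weyl ::
  "('n::{finite,linorder}, 'a::comm_ring_1) mpoly \<Rightarrow> ('n, 'a) weyl" where
  "poly_to_weyl p =
     weyl_class (\<Sum>\<alpha>\<in>Poly_Mapping.keys p.
       Poly_Mapping.single (monomial_word \<alpha>) (Poly_Mapping.lookup p \<alpha>))"

abbreviation underlying_module ::
  "(('n::{finite,linorder}, 'a::comm_ring_1) weyl, 'm) module \<Rightarrow> (('n, 'a) mpoly, 'm) module" where
  "underlying_module \<equiv> restrict_scalars poly_to_weyl"

definition euler :: "('n::finite, 'a::comm_ring_1) weyl" where
  "euler = weyl_class (\<Sum>i\<in>UNIV. free_X i * free_D i)"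

definition generalized_eulerian ::
  "(('n::finite, 'a::comm_ring_1) weyl, 'm) module \<Rightarrow> (int \<Rightarrow> 'm set) \<Rightarrow> bool" where
  "generalized_eulerian M gM \<longleftrightarrow>
     graded_module weyl_algebra weyl_grading M gM \<and>
     (\<forall>u. \<forall>y\<in>gM u. \<exists>a::nat. a > 0 \<and>
        ((euler \<ominus>\<^bsub>weyl_algebra\<^esub> add_pow weyl_algebra u \<one>\<^bsub>weyl_algebra\<^esub>)
           [^]\<^bsub>weyl_algebra\<^esub> a) \<odot>\<^bsub>M\<^esub> y = \<zero>\<^bsub>M\<^esub>)"

text \<open>
  The module over the Weyl algebra obtained from a module \<open>N\<close> over the polynomial ring by letting
  \<open>\<partial> i\<close> act as \<open>D i\<close>: words act by composition of their letters, elements of the free algebra act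
  linearly, and a class acts as any of its representatives (which all act in the same way if the
  operators \<open>D i\<close> satisfy the defining relations).
\<close>

fun gen_action ::
  "(('n, 'a::comm_ring_1) mpoly, 'm) module \<Rightarrow> ('n \<Rightarrow> 'm \<Rightarrow> 'm) \<Rightarrow> 'n weyl_gen \<Rightarrow> 'm \<Rightarrow> 'm" where
  "gen_action N D (X_gen i) y = mpoly_var i \<odot>\<^bsub>N\<^esub> y"
| "gen_action N D (D_gen i) y = D i y"

definition free_action ::
  "(('n, 'a::comm_ring_1) mpoly, 'm) module \<Rightarrow> ('n \<Rightarrow> 'm \<Rightarrow> 'm) \<Rightarrow> ('n, 'a) free_weyl \<Rightarrow> 'm \<Rightarrow> 'm"
  where
  "free_action N D f y =
     (\<Oplus>\<^bsub>N\<^esub>w\<in>Poly_Mapping.keys f.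
        mpoly_const (Poly_Mapping.lookup f w) \<odot>\<^bsub>N\<^esub> foldr (gen_action N D) (letters w) y)"

definition weyl_extension ::
  "(('n, 'a::comm_ring_1) mpoly, 'm) module \<Rightarrow> ('n \<Rightarrow> 'm \<Rightarrow> 'm) \<Rightarrow> (('n, 'a) weyl, 'm) module"
  where
  "weyl_extension N D =
     \<lparr>carrier = carrier N, monoid.mult = monoid.mult N, one = \<one>\<^bsub>N\<^esub>, ring.zero = \<zero>\<^bsub>N\<^esub>, add = add N,
      module.smult = (\<lambda>W y. the_elem ((\<lambda>f. free_action N D f y) ` W))\<rparr>"


section \<open>Localization\<close>

text \<open>\<open>fraction S M y s\<close> is \<open>y/s\<close>, as an equivalence class of pairs. Operations on fractions are
  defined on representatives; the union over all representatives is a union of equal sets.\<close>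

definition fraction ::
  "('n, 'a::comm_ring_1) mpoly set \<Rightarrow> (('n, 'a) mpoly, 'm) module \<Rightarrow> 'm \<Rightarrow> ('n, 'a) mpoly \<Rightarrow>
     ('m \<times> ('n, 'a) mpoly) set" where
  "fraction S M y s =
     {(y', s'). y' \<in> carrier M \<and> s' \<in> S \<and> (\<exists>t\<in>S. (t * s') \<odot>\<^bsub>M\<^esub> y = (t * s) \<odot>\<^bsub>M\<^esub> y')}"

definition localization ::
  "('n, 'a::comm_ring_1) mpoly set \<Rightarrow> (('n, 'a) mpoly, 'm) module \<Rightarrow>
     (('n, 'a) mpoly, ('m \<times> ('n, 'a) mpoly) set) module" where
  "localization S M =
     \<lparr>carrier = {fraction S M y s | y s. y \<in> carrier M \<and> s \<in> S},
      monoid.mult = (\<lambda>_ _. fraction S M \<zero>\<^bsub>M\<^esub> 1), one = fraction S M \<zero>\<^bsub>M\<^esub> 1,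
      ring.zero = fraction S M \<zero>\<^bsub>M\<^esub> 1,
      add = (\<lambda>P Q. \<Union>(y, s)\<in>P. \<Union>(y', s')\<in>Q.
               fraction S M (s' \<odot>\<^bsub>M\<^esub> y \<oplus>\<^bsub>M\<^esub> s \<odot>\<^bsub>M\<^esub> y') (s * s')),
      module.smult = (\<lambda>r P. \<Union>(y, s)\<in>P. fraction S M (r \<odot>\<^bsub>M\<^esub> y) s)\<rparr>"

definition localization_grading ::
  "('n::finite, 'a::comm_ring_1) mpoly set \<Rightarrow> (('n, 'a) mpoly, 'm) module \<Rightarrow> (int \<Rightarrow> 'm set) \<Rightarrow>
     int \<Rightarrow> ('m \<times> ('n, 'a) mpoly) set set" where
  "localization_grading S M gM u =
     {fraction S M y s | y s v. s \<in> S \<and> s \<in> poly_grading v \<and> y \<in> gM (u + v)}"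

text \<open>The action of \<open>\<partial> i\<close> on fractions by the quotient rule.\<close>

definition quotient_rule ::
  "('n::{finite,linorder}, 'a::comm_ring_1) mpoly set \<Rightarrow> (('n, 'a) weyl, 'm) module \<Rightarrow> 'n \<Rightarrow>
     ('m \<times> ('n, 'a) mpoly) set \<Rightarrow> ('m \<times> ('n, 'a) mpoly) set" where
  "quotient_rule S L i P =
     (let M = underlying_module L in
      \<Union>(y, s)\<in>P.
        fraction S M (weyl_class (free_D i) \<odot>\<^bsub>L\<^esub> y) s
          \<ominus>\<^bsub>localization S M\<^esub> fraction S M (partial_deriv i s \<odot>\<^bsub>M\<^esub> y) (s * s))"

definition weyl_localization ::
  "('n::{finite,linorder}, 'a::comm_ring_1) mpoly set \<Rightarrow> (('n, 'a) weyl, 'm) module \<Rightarrow>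
     (('n, 'a) weyl, ('m \<times> ('n, 'a) mpoly) set) module" where
  "weyl_localization S L =
     weyl_extension (localization S (underlying_module L)) (quotient_rule S L)"


section \<open>The graded Cech complex of a pair of ideals\<close>

definition star_S ::
  "('n::finite, 'a::comm_ring_1) mpoly \<Rightarrow> ('n, 'a) mpoly set \<Rightarrow> ('n, 'a) mpoly set" where
  "star_S b J =
     {b ^ n + j | n j. j \<in> J \<and> (\<exists>u. b ^ n \<in> poly_grading u \<and> j \<in> poly_grading u)}"

text \<open>
  In cohomological degree \<open>k\<close> the complex \<open>(\<Otimes>i. (0 \<rightarrow> R \<rightarrow> *R_(b i, J) \<rightarrow> 0)) \<otimes> L\<close> is the direct
  sum, over the \<open>k\<close>-element sets \<open>\<sigma>\<close> of indices, of the tensor products of \<open>L\<close> with the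
  \<open>*R_(b i, J)\<close>, \<open>i \<in> \<sigma>\<close>; that is, of the localizations of \<open>L\<close> at the products of elements of
  \<open>star_S (b i) J\<close>, \<open>i \<in> \<sigma>\<close>. Indices count from 0. Cochains are functions of \<open>\<sigma>\<close>.
\<close>

definition cech_S ::
  "('n::finite, 'a::comm_ring_1) mpoly list \<Rightarrow> ('n, 'a) mpoly set \<Rightarrow> nat set \<Rightarrow>
     ('n, 'a) mpoly set" where
  "cech_S b J \<sigma> = {\<Prod>i\<in>\<sigma>. s i | s. \<forall>i\<in>\<sigma>. s i \<in> star_S (b ! i) J}"

definition cech_index :: "'c list \<Rightarrow> nat \<Rightarrow> nat set set" where
  "cech_index b k = {\<sigma>. \<sigma> \<subseteq> {..<length b} \<and> card \<sigma> = k}"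

definition cech_summand ::
  "('n::{finite,linorder}, 'a::comm_ring_1) mpoly list \<Rightarrow> ('n, 'a) mpoly set \<Rightarrow>
     (('n, 'a) weyl, 'm) module \<Rightarrow> nat set \<Rightarrow>
     (('n, 'a) weyl, ('m \<times> ('n, 'a) mpoly) set) module" where
  "cech_summand b J L \<sigma> = weyl_localization (cech_S b J \<sigma>) L"

definition cech_module ::
  "('n::{finite,linorder}, 'a::comm_ring_1) mpoly list \<Rightarrow> ('n, 'a) mpoly set \<Rightarrow>
     (('n, 'a) weyl, 'm) module \<Rightarrow> nat \<Rightarrow>
     (('n, 'a) weyl, nat set \<Rightarrow> ('m \<times> ('n, 'a) mpoly) set) module" where
  "cech_module b J L k =
     (let N = cech_summand b J L; T = cech_index b k; z = (\<lambda>\<sigma>\<in>T. \<zero>\<^bsub>N \<sigma>\<^esub>) in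
      \<lparr>carrier = (\<Pi>\<^sub>E \<sigma>\<in>T. carrier (N \<sigma>)),
       monoid.mult = (\<lambda>_ _. z), one = z, ring.zero = z,
       add = (\<lambda>c c'. \<lambda>\<sigma>\<in>T. c \<sigma> \<oplus>\<^bsub>N \<sigma>\<^esub> c' \<sigma>),
       module.smult = (\<lambda>w c. \<lambda>\<sigma>\<in>T. w \<odot>\<^bsub>N \<sigma>\<^esub> c \<sigma>)\<rparr>)"

definition cech_grading ::
  "('n::{finite,linorder}, 'a::comm_ring_1) mpoly list \<Rightarrow> ('n, 'a) mpoly set \<Rightarrow>
     (('n, 'a) weyl, 'm) module \<Rightarrow> (int \<Rightarrow> 'm set) \<Rightarrow> nat \<Rightarrow> int \<Rightarrow>
     (nat set \<Rightarrow> ('m \<times> ('n, 'a) mpoly) set) set" where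
  "cech_grading b J L gL k u =
     (\<Pi>\<^sub>E \<sigma>\<in>cech_index b k. localization_grading (cech_S b J \<sigma>) (underlying_module L) gL u)"

text \<open>The sign of the component from \<open>\<sigma> - {j}\<close> to \<open>\<sigma>\<close> is the Koszul sign of the tensor product of
  complexes; the map itself is the canonical map \<open>y/s \<mapsto> y/s\<close>.\<close>

definition cech_diff ::
  "('n::{finite,linorder}, 'a::comm_ring_1) mpoly list \<Rightarrow> ('n, 'a) mpoly set \<Rightarrow>
     (('n, 'a) weyl, 'm) module \<Rightarrow> nat \<Rightarrow>
     (nat set \<Rightarrow> ('m \<times> ('n, 'a) mpoly) set) \<Rightarrow> (nat set \<Rightarrow> ('m \<times> ('n, 'a) mpoly) set)" where
  "cech_diff b J L k c =
     (\<lambda>\<sigma>\<in>cech_index b (Suc k).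
        \<Oplus>\<^bsub>cech_summand b J L \<sigma>\<^esub>j\<in>\<sigma>.
          add_pow (cech_summand b J L \<sigma>) ((- 1 :: int) ^ card {i \<in> \<sigma>. i < j})
            (\<Union>(y, s)\<in>c (\<sigma> - {j}). fraction (cech_S b J \<sigma>) (underlying_module L) y s))"

definition cech_cohomology ::
  "('n::{finite,linorder}, 'a::comm_ring_1) mpoly list \<Rightarrow> ('n, 'a) mpoly set \<Rightarrow>
     (('n, 'a) weyl, 'm) module \<Rightarrow> nat \<Rightarrow>
     (('n, 'a) weyl, (nat set \<Rightarrow> ('m \<times> ('n, 'a) mpoly) set) set) module" where
  "cech_cohomology b J L i = cohomology (cech_module b J L) (cech_diff b J L) i"

definition cech_cohomology_grading ::
  "('n::{finite,linorder}, 'a::comm_ring_1) mpoly list \<Rightarrow> ('n, 'a) mpoly set \<Rightarrow>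
     (('n, 'a) weyl, 'm) module \<Rightarrow> (int \<Rightarrow> 'm set) \<Rightarrow> nat \<Rightarrow> int \<Rightarrow>
     (nat set \<Rightarrow> ('m \<times> ('n, 'a) mpoly) set) set set" where
  "cech_cohomology_grading b J L gL i =
     cohomology_grading (cech_module b J L) (cech_grading b J L gL) (cech_diff b J L) i"

text \<open>Transport of the scalar action of \<open>N\<close> to \<open>H\<close> along a bijection \<open>\<phi>\<close> from \<open>H\<close> to \<open>N\<close>. The
  additive group remains that of \<open>H\<close>.\<close>

definition transport_action ::
  "('r, 'h) module \<Rightarrow> ('w, 'k) module \<Rightarrow> ('h \<Rightarrow> 'k) \<Rightarrow> ('w, 'h) module" where
  "transport_action H N \<phi> =
     \<lparr>carrier = carrier H, monoid.mult = monoid.mult H, one = \<one>\<^bsub>H\<^esub>, ring.zero = \<zero>\<^bsub>H\<^esub>, add = add H,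
      module.smult = (\<lambda>w x. inv_into (carrier H) \<phi> (w \<odot>\<^bsub>N\<^esub> \<phi> x))\<rparr>"

end

theory Submission
  imports Defs
begin

text \<open>
  The Cech complex of \<open>L\<close> consists of finite direct sums of localizations of \<open>L\<close> at multiplicative sets
  of homogeneous polynomials. Three closure properties of generalized Eulerian modules therefore give
  the result: closure under such localizations, under finite products, and under passage to the
  cohomology of a complex of graded modules over the Weyl algebra.

  The localization is the essential point. Let \<open>y\<close> be homogeneous, let \<open>s\<close> be a denominator of degree
  \<open>v\<close>, and let \<open>u\<close> be the degree of \<open>y / s\<close>, so that \<open>y\<close> has degree \<open>u + v\<close>. The quotient rule and
  Euler's formula \<open>E s = v s\<close> give \<open>(E - u) (y / s) = (E - (u + v)) y / s\<close>. Iterating, a power of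
  \<open>E - (u + v)\<close> that annihilates \<open>y\<close> yields the same power of \<open>E - u\<close> annihilating \<open>y / s\<close>
  (\<open>euler_shift_fraction\<close>, \<open>weyl_localization_eulerian\<close>). In a finite product the exponents of the
  entries have an upper bound (\<open>product_eulerian\<close>), and in cohomology a class is annihilated with its
  representative (\<open>cohomology_eulerian\<close>).

  Most of the work is to show that the objects are graded modules over the Weyl algebra at all. Such a
  module is treated as a polynomial module with commuting operators \<open>D i\<close> that satisfy the Leibniz rule
  (locale \<open>derivation_module\<close>): such operators define an action of the free algebra that vanishes on
  the ideal of relations (\<open>act_weyl_ideal\<close>). For a localization, the quotient rule is well defined and
  its operators commute because both claims can be checked after multiplication by a denominator,
  which acts injectively (\<open>quotient_term_well_defined\<close>, \<open>quotient_rule_commute\<close>). The Cech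
  differential is a signed sum of canonical maps, which are graded and linear over the Weyl algebra
  (\<open>canonical_map_hom\<close>); its kernels and images are homogeneous submodules, so that the cohomology is
  graded (\<open>cohomology_graded\<close>).

  The structure on the local cohomology is the one transported from the Cech cohomology along a graded
  isomorphism. It remains to see that the local cohomology is closed under addition, which comes from
  the fact that the elements torsion with respect to a pair of ideals are closed under addition
  (\<open>Gamma_add\<close>); then all module axioms carry over (\<open>transport_eulerian\<close>).
\<close>


section \<open>Graded modules\<close>

lemma additive_mapI:
  assumes "abelian_group G" "abelian_group H" "h \<in> carrier G \<rightarrow> carrier H"
    and "\<And>x y. x \<in> carrier G \<Longrightarrow> y \<in> carrier G \<Longrightarrow> h (x \<oplus>\<^bsub>G\<^esub> y) = h x \<oplus>\<^bsub>H\<^esub> h y"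
  shows "abelian_group_hom G H h"
proof -
  interpret G: abelian_group G by fact
  interpret H: abelian_group H by fact
  show ?thesis
    by (intro abelian_group_homI assms group_hom.intro G.a_group H.a_group group_hom_axioms.intro homI)
       (use assms in auto)
qed

context abelian_group_hom
begin

lemma hom_finsum: "f \<in> A \<rightarrow> carrier G \<Longrightarrow> h (finsum G f A) = finsum H (\<lambda>i. h (f i)) A"
  by (induction A rule: infinite_finite_induct) (auto simp: Pi_iff)

lemma hom_add_pow_int: "x \<in> carrier G \<Longrightarrow> h (add_pow G (k::int) x) = add_pow H k (h x)"
  using group_hom.hom_int_pow[OF a_group_hom, of x k] by (simp add: add_pow_def)

end

context left_module
begin

lemma smult_additive: "a \<in> carrier R \<Longrightarrow> abelian_group_hom M M (\<lambda>x. a \<odot>\<^bsub>M\<^esub> x)"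
  by (rule additive_mapI) (auto simp: smult_closed smult_r_distr intro: M.abelian_group_axioms)

lemma scalar_additive: "x \<in> carrier M \<Longrightarrow> abelian_group_hom R M (\<lambda>a. a \<odot>\<^bsub>M\<^esub> x)"
  by (rule additive_mapI)
     (auto simp: smult_closed smult_l_distr intro: M.abelian_group_axioms R.abelian_group_axioms)

lemma smult_zero_right: "a \<in> carrier R \<Longrightarrow> a \<odot>\<^bsub>M\<^esub> \<zero>\<^bsub>M\<^esub> = \<zero>\<^bsub>M\<^esub>"
  using abelian_group_hom.hom_zero[OF smult_additive] .

lemma smult_zero_left: "x \<in> carrier M \<Longrightarrow> \<zero> \<odot>\<^bsub>M\<^esub> x = \<zero>\<^bsub>M\<^esub>"
  using abelian_group_hom.hom_zero[OF scalar_additive] .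

lemma smult_minus_right:
  "a \<in> carrier R \<Longrightarrow> x \<in> carrier M \<Longrightarrow> a \<odot>\<^bsub>M\<^esub> (\<ominus>\<^bsub>M\<^esub> x) = \<ominus>\<^bsub>M\<^esub> (a \<odot>\<^bsub>M\<^esub> x)"
  using abelian_group_hom.hom_a_inv[OF smult_additive] .

end

text \<open>
  A grading is a direct sum decomposition. Its existence part is recorded as membership in the span
  of the homogeneous elements, which admits proofs by induction, and its uniqueness part as
  independence of the components.
\<close>

inductive_set homogeneous_span :: "('r, 'm) module \<Rightarrow> (int \<Rightarrow> 'm set) \<Rightarrow> 'm set"
  for M gM where
    homogeneous: "y \<in> gM u \<Longrightarrow> y \<in> homogeneous_span M gM"
  | sum: "x \<in> homogeneous_span M gM \<Longrightarrow> y \<in> homogeneous_span M gM \<Longrightarrow>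
      x \<oplus>\<^bsub>M\<^esub> y \<in> homogeneous_span M gM"

definition independent_components :: "('r, 'm) module \<Rightarrow> (int \<Rightarrow> 'm set) \<Rightarrow> bool" where
  "independent_components M gM \<longleftrightarrow>
     (\<forall>F f. finite F \<longrightarrow> (\<forall>u\<in>F. f u \<in> gM u) \<longrightarrow> finsum M f F = \<zero>\<^bsub>M\<^esub> \<longrightarrow> (\<forall>u\<in>F. f u = \<zero>\<^bsub>M\<^esub>))"

lemma independent_componentsD:
  assumes "independent_components M gM" "finite F" "\<And>u. u \<in> F \<Longrightarrow> f u \<in> gM u"
    and "finsum M f F = \<zero>\<^bsub>M\<^esub>" "u \<in> F"
  shows "f u = \<zero>\<^bsub>M\<^esub>"
  using assms unfolding independent_components_def by blast

locale subgroup_family = abelian_group M for M :: "('r, 'm) module" (structure) +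
  fixes gM :: "int \<Rightarrow> 'm set"
  assumes component_subgroup: "additive_subgroup (gM u) M"
begin

lemma component_closed: "y \<in> gM u \<Longrightarrow> y \<in> carrier M"
  using additive_subgroup.a_Hcarr[OF component_subgroup] .

lemma component_zero [simp]: "\<zero> \<in> gM u"
  using additive_subgroup.zero_closed[OF component_subgroup] .

lemma component_add: "x \<in> gM u \<Longrightarrow> y \<in> gM u \<Longrightarrow> x \<oplus> y \<in> gM u"
  using additive_subgroup.a_closed[OF component_subgroup] .

lemma component_minus: "x \<in> gM u \<Longrightarrow> \<ominus> x \<in> gM u"
  using additive_subgroup.a_inv_closed[OF component_subgroup] .

lemma component_finsum: "(\<And>i. i \<in> A \<Longrightarrow> f i \<in> gM u) \<Longrightarrow> finsum M f A \<in> gM u"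
proof (induction A rule: infinite_finite_induct)
  case (insert x A)
  then have "finsum M f (insert x A) = f x \<oplus> finsum M f A"
    by (intro add.finprod_insert) (auto intro: component_closed)
  with insert show ?case by (auto intro: component_add)
qed auto

lemma subgroup_family_Int:
  assumes "additive_subgroup H M"
  shows "subgroup_family M (\<lambda>u. H \<inter> gM u)"
  by (intro subgroup_family.intro abelian_group_axioms subgroup_family_axioms.intro
      additive_subgroupI add.subgroups_Inter_pair)
     (use assms component_subgroup in \<open>auto simp: additive_subgroup_def\<close>)

lemma span_closed: "y \<in> homogeneous_span M gM \<Longrightarrow> y \<in> carrier M"
  by (induction rule: homogeneous_span.induct) (auto intro: component_closed)

lemma finsum_extend_zero:
  assumes "finite F" "F0 \<subseteq> F" "\<And>u. f u \<in> gM u" "\<And>u. u \<notin> F0 \<Longrightarrow> f u = \<zero>"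
  shows "finsum M f F0 = finsum M f F"
  using assms by (intro add.finprod_mono_neutral_cong_left) (auto intro: component_closed)

lemma span_decomposition:
  assumes "y \<in> homogeneous_span M gM"
  shows "\<exists>F f. finite F \<and> (\<forall>u. f u \<in> gM u) \<and> (\<forall>u. u \<notin> F \<longrightarrow> f u = \<zero>) \<and> finsum M f F = y"
  using assms
proof (induction rule: homogeneous_span.induct)
  case (homogeneous y u)
  show ?case
    by (rule exI[of _ "{u}"], rule exI[of _ "\<lambda>v. if v = u then y else \<zero>"])
       (use homogeneous component_closed[OF homogeneous] in \<open>auto simp: Pi_def\<close>)
next
  case (sum x y)
  then obtain F f G g where F: "finite F" "\<And>u. f u \<in> gM u" "\<And>u. u \<notin> F \<Longrightarrow> f u = \<zero>" "finsum M f F = x"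
    and G: "finite G" "\<And>u. g u \<in> gM u" "\<And>u. u \<notin> G \<Longrightarrow> g u = \<zero>" "finsum M g G = y"
    by metis
  have "finsum M f (F \<union> G) = x" "finsum M g (F \<union> G) = y"
    using F G finsum_extend_zero[of "F \<union> G" F f] finsum_extend_zero[of "F \<union> G" G g] by auto
  then have "finsum M (\<lambda>u. f u \<oplus> g u) (F \<union> G) = x \<oplus> y"
    using F G by (subst add.finprod_multf) (auto intro: component_closed)
  with F G show ?case
    by (intro exI[of _ "F \<union> G"] exI[of _ "\<lambda>u. f u \<oplus> g u"]) (auto intro: component_add)
qed

lemma decomposition_unique:
  assumes ind: "independent_components M gM"
    and F: "finite F" "\<And>u. f u \<in> gM u" "\<And>u. u \<notin> F \<Longrightarrow> f u = \<zero>"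
    and G: "finite G" "\<And>u. g u \<in> gM u" "\<And>u. u \<notin> G \<Longrightarrow> g u = \<zero>"
    and eq: "finsum M f F = finsum M g G"
  shows "f = g"
proof
  fix u
  have cl: "\<And>u. f u \<in> carrier M" "\<And>u. g u \<in> carrier M"
    using F G component_closed by blast+
  have "abelian_group_hom M M (\<lambda>x. \<ominus> x)"
    by (rule additive_mapI) (auto simp: minus_add intro: abelian_group_axioms)
  then have neg: "finsum M (\<lambda>u. \<ominus> g u) (F \<union> G) = \<ominus> finsum M g (F \<union> G)"
    using cl by (simp add: abelian_group_hom.hom_finsum)
  have "finsum M f (F \<union> G) = finsum M g (F \<union> G)"
    using F G eq finsum_extend_zero[of "F \<union> G" F f] finsum_extend_zero[of "F \<union> G" G g] by auto
  then have "finsum M (\<lambda>u. f u \<oplus> \<ominus> g u) (F \<union> G) = \<zero>"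
    using cl by (subst add.finprod_multf) (auto simp: neg r_neg)
  moreover have "f u \<oplus> \<ominus> g u \<in> gM u" for u
    using F(2) G(2) by (intro component_add component_minus)
  ultimately have "f u \<oplus> \<ominus> g u = \<zero>" if "u \<in> F \<union> G"
    using independent_componentsD[OF ind, of "F \<union> G" "\<lambda>u. f u \<oplus> \<ominus> g u"] F(1) G(1) that by blast
  then have "f u = g u" if "u \<in> F \<union> G"
    using cl that by (metis add.inv_solve_right' l_zero zero_closed)
  then show "f u = g u" using F(3) G(3) by (metis UnCI)
qed

lemma direct_sum_iff:
  "(\<forall>y\<in>carrier M. \<exists>!f. finite {u. f u \<noteq> \<zero>} \<and> (\<forall>u. f u \<in> gM u) \<and>
        (\<Oplus>u\<in>{u. f u \<noteq> \<zero>}. f u) = y) \<longleftrightarrow>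
   carrier M \<subseteq> homogeneous_span M gM \<and> independent_components M gM" (is "?L \<longleftrightarrow> ?R")
proof
  assume L: ?L
  have span: "finsum M f F \<in> homogeneous_span M gM" if "finite F" "\<And>u. f u \<in> gM u" for f F
    using that
  proof (induction F)
    case empty
    then show ?case using homogeneous_span.homogeneous[OF component_zero] by simp
  next
    case (insert u F)
    then have "finsum M f (insert u F) = f u \<oplus> finsum M f F"
      by (intro add.finprod_insert) (auto intro: component_closed)
    with insert show ?case by (auto intro: homogeneous_span.intros)
  qed
  have "independent_components M gM"
    unfolding independent_components_def
  proof (intro allI impI ballI)
    fix F f u
    assume F: "finite F" "\<forall>u\<in>F. f u \<in> gM u" "finsum M f F = \<zero>" "u \<in> F"
    define f' where "f' u = (if u \<in> F then f u else \<zero>)" for u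
    have f': "\<And>u. f' u \<in> gM u" using F by (auto simp: f'_def)
    have sub: "{u. f' u \<noteq> \<zero>} \<subseteq> F" by (auto simp: f'_def)
    have "finsum M f' {u. f' u \<noteq> \<zero>} = finsum M f' F"
      using F(1) sub f' by (intro finsum_extend_zero) auto
    also have "\<dots> = finsum M f F"
      using F(2) by (intro add.finprod_cong') (auto simp: f'_def intro: component_closed)
    finally have sum: "finsum M f' {u. f' u \<noteq> \<zero>} = \<zero>"
      using F by simp
    define P where "P g \<longleftrightarrow> finite {u. g u \<noteq> \<zero>} \<and> (\<forall>u. g u \<in> gM u) \<and>
      finsum M g {u. g u \<noteq> \<zero>} = \<zero>" for g
    have 1: "P f'" "P (\<lambda>_. \<zero>)"
      using sum F f' finite_subset[OF sub] by (auto simp: P_def)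
    have "\<exists>!g. P g" using bspec[OF L zero_closed] unfolding P_def .
    with 1 have "f' = (\<lambda>_. \<zero>)" by blast
    then show "f u = \<zero>" using F(4) by (metis f'_def)
  qed
  moreover have "carrier M \<subseteq> homogeneous_span M gM"
  proof
    fix y assume "y \<in> carrier M"
    with L obtain f where "finite {u. f u \<noteq> \<zero>}" "\<And>u. f u \<in> gM u" "finsum M f {u. f u \<noteq> \<zero>} = y" by metis
    with span show "y \<in> homogeneous_span M gM" by blast
  qed
  ultimately show ?R by blast
next
  assume R: ?R
  show ?L
  proof
    fix y assume "y \<in> carrier M"
    with R span_decomposition obtain F f where F: "finite F" "\<And>u. f u \<in> gM u" "\<And>u. u \<notin> F \<Longrightarrow> f u = \<zero>"
      "finsum M f F = y" by blast
    have sub: "{u. f u \<noteq> \<zero>} \<subseteq> F" using F(3) by auto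
    have f: "finite {u. f u \<noteq> \<zero>} \<and> (\<forall>u. f u \<in> gM u) \<and> finsum M f {u. f u \<noteq> \<zero>} = y"
      using F finite_subset[OF sub] finsum_extend_zero[OF F(1) sub] by auto
    show "\<exists>!f. finite {u. f u \<noteq> \<zero>} \<and> (\<forall>u. f u \<in> gM u) \<and> (\<Oplus>u\<in>{u. f u \<noteq> \<zero>}. f u) = y"
    proof (intro ex1I[of _ f] f)
      fix g assume g: "finite {u. g u \<noteq> \<zero>} \<and> (\<forall>u. g u \<in> gM u) \<and> (\<Oplus>u\<in>{u. g u \<noteq> \<zero>}. g u) = y"
      show "g = f"
        by (rule decomposition_unique[of "{u. g u \<noteq> \<zero>}" g "{u. f u \<noteq> \<zero>}" f]) (use R f g in auto)
    qed
  qed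
qed

end

lemma graded_module_iff:
  "graded_module R gR M gM \<longleftrightarrow>
     left_module R M \<and> (\<forall>u. additive_subgroup (gM u) M) \<and>
     carrier M \<subseteq> homogeneous_span M gM \<and> independent_components M gM \<and>
     (\<forall>u v. \<forall>r\<in>gR u. \<forall>y\<in>gM v. r \<odot>\<^bsub>M\<^esub> y \<in> gM (u + v))"
proof (cases "left_module R M \<and> (\<forall>u. additive_subgroup (gM u) M)")
  case True
  then interpret left_module R M by simp
  interpret subgroup_family M gM
    using True by (intro subgroup_family.intro subgroup_family_axioms.intro M.abelian_group_axioms) blast
  show ?thesis
    unfolding graded_module_def direct_sum_iff by auto
next
  case False
  then show ?thesis unfolding graded_module_def by blast
qed

locale graded = left_module R M + subgroup_family M gM
  for R :: "'r ring" (structure) and gR :: "int \<Rightarrow> 'r set"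
    and M :: "('r, 'm) module" (structure) and gM :: "int \<Rightarrow> 'm set" +
  assumes spanned: "carrier M \<subseteq> homogeneous_span M gM"
    and independent: "independent_components M gM"
    and smult_degree: "r \<in> gR u \<Longrightarrow> y \<in> gM v \<Longrightarrow> r \<odot>\<^bsub>M\<^esub> y \<in> gM (u + v)"

lemma graded_module_iff_graded: "graded_module R gR M gM \<longleftrightarrow> graded R gR M gM"
proof
  assume g: "graded_module R gR M gM"
  then interpret left_module R M by (simp add: graded_module_iff)
  show "graded R gR M gM"
    using g unfolding graded_module_iff
    by (intro graded.intro subgroup_family.intro subgroup_family_axioms.intro graded_axioms.intro
        left_module_axioms M.abelian_group_axioms) blast+
next
  assume "graded R gR M gM"
  then interpret graded R gR M gM .
  show "graded_module R gR M gM"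
    unfolding graded_module_iff
    using left_module_axioms component_subgroup spanned independent smult_degree by blast
qed

lemma gradedI:
  assumes "left_module R M" "\<And>u. additive_subgroup (gM u) M"
    and "carrier M \<subseteq> homogeneous_span M gM" "independent_components M gM"
    and "\<And>r u y v. r \<in> gR u \<Longrightarrow> y \<in> gM v \<Longrightarrow> r \<odot>\<^bsub>M\<^esub> y \<in> gM (u + v)"
  shows "graded R gR M gM"
  using assms unfolding graded_module_iff_graded[symmetric] graded_module_iff by blast

text \<open>
  Clearing denominators shifts all degrees by the same amount; independence survives this, as it
  survives any injective relabelling.
\<close>

lemma (in subgroup_family) independent_reindex:
  assumes ind: "independent_components M gM"
    and F: "finite F" "inj_on h F" "\<And>u. u \<in> F \<Longrightarrow> f u \<in> gM (h u)" "finsum M f F = \<zero>" "u \<in> F"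
  shows "f u = \<zero>"
proof -
  have f: "f (the_inv_into F h (h u)) = f u" if "u \<in> F" for u
    using that F by (simp add: the_inv_into_f_f)
  have cl: "f u \<in> carrier M" if "u \<in> F" for u
    using F(3)[OF that] by (rule component_closed)
  have "finsum M (\<lambda>v. f (the_inv_into F h v)) (h ` F) = finsum M (\<lambda>u. f (the_inv_into F h (h u))) F"
    using F f cl by (intro add.finprod_reindex) auto
  also have "\<dots> = finsum M f F"
    using F f cl by (intro add.finprod_cong') auto
  finally have "f (the_inv_into F h (h u)) = \<zero>"
    using F f by (intro independent_componentsD[OF ind, of "h ` F" "\<lambda>v. f (the_inv_into F h v)"]) auto
  then show ?thesis using F f by simp
qed

lemma span_image:
  assumes "abelian_group_hom M N f" "subgroup_family M gM" "\<And>u. f ` gM u \<subseteq> gN u"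
    and "y \<in> homogeneous_span M gM"
  shows "f y \<in> homogeneous_span N gN"
  using assms(4)
proof (induction rule: homogeneous_span.induct)
  case (homogeneous y u)
  then show ?case using assms(3) by (auto intro: homogeneous_span.homogeneous)
next
  case (sum x y)
  interpret f: abelian_group_hom M N f by fact
  interpret subgroup_family M gM by fact
  show ?case using sum by (auto simp: span_closed intro: homogeneous_span.sum)
qed

lemma graded_hom_iff:
  assumes "graded R gR M gM" "graded R gR N gN"
  shows "graded_hom R M gM N gN f \<longleftrightarrow>
    abelian_group_hom M N f \<and>
    (\<forall>r\<in>carrier R. \<forall>x\<in>carrier M. f (r \<odot>\<^bsub>M\<^esub> x) = r \<odot>\<^bsub>N\<^esub> f x) \<and> (\<forall>u. f ` gM u \<subseteq> gN u)"
proof -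
  interpret M: graded R gR M gM by fact
  interpret N: graded R gR N gN by fact
  have "abelian_group_hom M N f \<longleftrightarrow> f \<in> carrier M \<rightarrow> carrier N \<and>
      (\<forall>x\<in>carrier M. \<forall>y\<in>carrier M. f (x \<oplus>\<^bsub>M\<^esub> y) = f x \<oplus>\<^bsub>N\<^esub> f y)"
  proof
    assume "abelian_group_hom M N f"
    then interpret abelian_group_hom M N f .
    show "f \<in> carrier M \<rightarrow> carrier N \<and> (\<forall>x\<in>carrier M. \<forall>y\<in>carrier M. f (x \<oplus>\<^bsub>M\<^esub> y) = f x \<oplus>\<^bsub>N\<^esub> f y)"
      by auto
  qed (auto intro: additive_mapI M.abelian_group_axioms N.abelian_group_axioms)
  then show ?thesis unfolding graded_hom_def by blast
qed

section \<open>Cohomology of complexes of graded modules\<close>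

text \<open>
  The third condition says that the homogeneous components of an element of \<open>N\<close> lie in \<open>N\<close>; it is
  what makes the quotient by \<open>N\<close> graded.
\<close>

definition homogeneous_submodule ::
  "'r ring \<Rightarrow> ('r, 'm) module \<Rightarrow> (int \<Rightarrow> 'm set) \<Rightarrow> 'm set \<Rightarrow> bool" where
  "homogeneous_submodule R M gM N \<longleftrightarrow>
     additive_subgroup N M \<and> (\<forall>r\<in>carrier R. \<forall>x\<in>N. r \<odot>\<^bsub>M\<^esub> x \<in> N) \<and>
     N \<subseteq> homogeneous_span M (\<lambda>u. N \<inter> gM u)"

lemma (in graded) homogeneous_submodule_zero: "homogeneous_submodule R M gM {\<zero>\<^bsub>M\<^esub>}"
  unfolding homogeneous_submodule_def
  by (auto simp: smult_zero_right intro: additive_subgroupI M.add.triv_subgroup homogeneous_span.homogeneous)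

lemma homogeneous_submodule_image:
  assumes M: "graded R gR M gM" and N: "graded R gR N gN" and f: "graded_hom R M gM N gN f"
  shows "homogeneous_submodule R N gN (f ` carrier M)"
proof -
  interpret M: graded R gR M gM by fact
  interpret N: graded R gR N gN by fact
  interpret f: abelian_group_hom M N f using f graded_hom_iff[OF M N] by blast
  have lin: "f (r \<odot>\<^bsub>M\<^esub> x) = r \<odot>\<^bsub>N\<^esub> f x" if "r \<in> carrier R" "x \<in> carrier M" for r x
    using f that by (auto simp: graded_hom_def)
  have deg: "f y \<in> gN u" if "y \<in> gM u" for u y
    using f that unfolding graded_hom_def by blast
  have "f y \<in> homogeneous_span N (\<lambda>u. f ` carrier M \<inter> gN u)" if "y \<in> carrier M" for y
    using M.spanned that
    by (intro span_image[OF f.is_abelian_group_hom M.subgroup_family_axioms])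
       (auto intro: deg M.component_closed)
  moreover have "additive_subgroup (f ` carrier M) N"
    using group_hom.img_is_subgroup[OF f.a_group_hom] by (auto intro: additive_subgroupI)
  moreover have "r \<odot>\<^bsub>N\<^esub> f x \<in> f ` carrier M" if "r \<in> carrier R" "x \<in> carrier M" for r x
    using lin[OF that] that by (metis M.smult_closed image_eqI)
  ultimately show ?thesis
    unfolding homogeneous_submodule_def by blast
qed

text \<open>
  Applied to the homogeneous components of an element of the kernel, \<open>f\<close> gives a decomposition of
  zero, so every component is itself in the kernel.
\<close>

lemma homogeneous_submodule_kernel:
  assumes M: "graded R gR M gM" and N: "graded R gR N gN" and f: "graded_hom R M gM N gN f"
  shows "homogeneous_submodule R M gM {x \<in> carrier M. f x = \<zero>\<^bsub>N\<^esub>}"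
proof -
  interpret M: graded R gR M gM by fact
  interpret N: graded R gR N gN by fact
  interpret f: abelian_group_hom M N f using f graded_hom_iff[OF M N] by blast
  let ?K = "{x \<in> carrier M. f x = \<zero>\<^bsub>N\<^esub>}"
  have lin: "f (r \<odot>\<^bsub>M\<^esub> x) = r \<odot>\<^bsub>N\<^esub> f x" if "r \<in> carrier R" "x \<in> carrier M" for r x
    using f that by (auto simp: graded_hom_def)
  have deg: "f y \<in> gN u" if "y \<in> gM u" for u y
    using f that unfolding graded_hom_def by blast
  have K: "additive_subgroup ?K M"
    using f.additive_subgroup_a_kernel unfolding a_kernel_def' .
  have "y \<in> homogeneous_span M (\<lambda>u. ?K \<inter> gM u)" if y: "y \<in> ?K" for y
  proof -
    interpret K: subgroup_family M "\<lambda>u. ?K \<inter> gM u" by (rule M.subgroup_family_Int[OF K])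
    obtain F c where c: "finite F" "\<And>u. c u \<in> gM u" "finsum M c F = y"
      using M.span_decomposition[of y] M.spanned y by blast
    have cM: "c u \<in> carrier M" for u using c(2) by (rule M.component_closed)
    have "finsum N (\<lambda>u. f (c u)) F = \<zero>\<^bsub>N\<^esub>"
      using c(3) y cM f.hom_finsum[of c F] by auto
    then have 0: "f (c u) = \<zero>\<^bsub>N\<^esub>" if "u \<in> F" for u
      using independent_componentsD[OF N.independent c(1), of "\<lambda>u. f (c u)"] deg c(2) that by blast
    have "finsum M c F' \<in> homogeneous_span M (\<lambda>u. ?K \<inter> gM u)" if "F' \<subseteq> F" for F'
      using finite_subset[OF that c(1)] that
    proof (induction F')
      case empty
      then show ?case using homogeneous_span.homogeneous[OF K.component_zero] by simp
    next
      case (insert u F')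
      have "c u \<in> ?K \<inter> gM u" using 0 cM c(2) insert by auto
      then show ?case using insert cM by (auto simp: Pi_def intro: homogeneous_span.intros)
    qed
    with c(3) show ?thesis by blast
  qed
  with K show ?thesis
    unfolding homogeneous_submodule_def using lin by (auto simp: M.smult_closed N.smult_zero_right)
qed

text \<open>
  For submodules \<open>B\<close> and \<open>Z\<close> this is \<open>(Z + B) / B\<close>; for coboundaries and cocycles it is the cohomology.
\<close>

definition subquotient :: "('r, 'm) module \<Rightarrow> 'm set \<Rightarrow> 'm set \<Rightarrow> ('r, 'm set) module" where
  "subquotient M B Z =
     \<lparr>carrier = (\<lambda>x. B +>\<^bsub>M\<^esub> x) ` Z, monoid.mult = (\<lambda>_ _. B), one = B, ring.zero = B,
      add = set_add M, module.smult = (\<lambda>r K. \<Union>x\<in>K. B +>\<^bsub>M\<^esub> (r \<odot>\<^bsub>M\<^esub> x))\<rparr>"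

lemma (in left_module) subquotient_smult:
  assumes B: "additive_subgroup B M" "\<And>r x. r \<in> carrier R \<Longrightarrow> x \<in> B \<Longrightarrow> r \<odot>\<^bsub>M\<^esub> x \<in> B"
    and "r \<in> carrier R" "x \<in> carrier M"
  shows "r \<odot>\<^bsub>subquotient M B Z\<^esub> (B +>\<^bsub>M\<^esub> x) = B +>\<^bsub>M\<^esub> (r \<odot>\<^bsub>M\<^esub> x)"
proof -
  interpret B: abelian_subgroup B M
    using B(1) M.abelian_group_axioms by (intro abelian_subgroupI3)
  have "B +>\<^bsub>M\<^esub> (r \<odot>\<^bsub>M\<^esub> z) = B +>\<^bsub>M\<^esub> (r \<odot>\<^bsub>M\<^esub> x)" if z: "z \<in> B +>\<^bsub>M\<^esub> x" for z
  proof -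
    obtain b where b: "b \<in> B" "z = b \<oplus>\<^bsub>M\<^esub> x"
      using z by (auto simp: a_r_coset_def r_coset_def)
    then have "r \<odot>\<^bsub>M\<^esub> z = r \<odot>\<^bsub>M\<^esub> b \<oplus>\<^bsub>M\<^esub> r \<odot>\<^bsub>M\<^esub> x"
      using assms by (simp add: smult_r_distr)
    then have "r \<odot>\<^bsub>M\<^esub> z \<in> B +>\<^bsub>M\<^esub> (r \<odot>\<^bsub>M\<^esub> x)"
      using B(2)[OF assms(3) b(1)] by (auto simp: a_r_coset_def r_coset_def)
    then show ?thesis
      using B.a_repr_independence'[of "r \<odot>\<^bsub>M\<^esub> z" "r \<odot>\<^bsub>M\<^esub> x"] assms smult_closed by simp
  qed
  moreover have "x \<in> B +>\<^bsub>M\<^esub> x" using assms B.a_rcos_self by blast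
  ultimately have "(\<Union>z\<in>B +>\<^bsub>M\<^esub> x. B +>\<^bsub>M\<^esub> (r \<odot>\<^bsub>M\<^esub> z)) = B +>\<^bsub>M\<^esub> (r \<odot>\<^bsub>M\<^esub> x)" by blast
  then show ?thesis by (simp add: subquotient_def)
qed

text \<open>
  Existence of decompositions is inherited from \<open>Z\<close>. Uniqueness uses that \<open>B\<close> is homogeneous: if a
  sum of homogeneous elements lies in \<open>B\<close>, then so does each of them.
\<close>

lemma (in graded) subquotient_graded:
  assumes gR: "\<And>u. gR u \<subseteq> carrier R"
    and B: "homogeneous_submodule R M gM B" and Z: "homogeneous_submodule R M gM Z"
  shows "graded R gR (subquotient M B Z) (\<lambda>u. (\<lambda>x. B +>\<^bsub>M\<^esub> x) ` (Z \<inter> gM u))"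
proof -
  have B_sub: "additive_subgroup B M" and B_smult: "\<And>r x. r \<in> carrier R \<Longrightarrow> x \<in> B \<Longrightarrow> r \<odot>\<^bsub>M\<^esub> x \<in> B"
    and B_span: "B \<subseteq> homogeneous_span M (\<lambda>u. B \<inter> gM u)"
    using B by (auto simp: homogeneous_submodule_def)
  have Z_sub: "additive_subgroup Z M" and Z_smult: "\<And>r x. r \<in> carrier R \<Longrightarrow> x \<in> Z \<Longrightarrow> r \<odot>\<^bsub>M\<^esub> x \<in> Z"
    and Z_span: "Z \<subseteq> homogeneous_span M (\<lambda>u. Z \<inter> gM u)"
    using Z by (auto simp: homogeneous_submodule_def)
  interpret B: abelian_subgroup B M
    using B_sub M.abelian_group_axioms by (intro abelian_subgroupI3)
  interpret Z: additive_subgroup Z M by (rule Z_sub)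
  interpret Zu: subgroup_family M "\<lambda>u. Z \<inter> gM u" by (rule subgroup_family_Int[OF Z_sub])
  interpret Bu: subgroup_family M "\<lambda>u. B \<inter> gM u" by (rule subgroup_family_Int[OF B_sub])
  define Q where "Q = subquotient M B Z"
  define q where "q x = B +>\<^bsub>M\<^esub> x" for x
  have carr: "carrier Q = q ` Z" and zero: "\<zero>\<^bsub>Q\<^esub> = q \<zero>\<^bsub>M\<^esub>"
    by (auto simp: Q_def subquotient_def q_def B.a_rcos_const)
  have zB: "\<zero>\<^bsub>Q\<^esub> = B"
    by (simp add: Q_def subquotient_def)
  have add: "q x \<oplus>\<^bsub>Q\<^esub> q y = q (x \<oplus>\<^bsub>M\<^esub> y)" if "x \<in> carrier M" "y \<in> carrier M" for x y
    using that B.a_rcos_sum by (simp add: Q_def subquotient_def q_def)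
  have smult: "r \<odot>\<^bsub>Q\<^esub> q x = q (r \<odot>\<^bsub>M\<^esub> x)" if "r \<in> carrier R" "x \<in> carrier M" for r x
    using subquotient_smult[OF B_sub B_smult that] by (simp add: Q_def q_def)
  have q_zero_iff: "q x = \<zero>\<^bsub>Q\<^esub> \<longleftrightarrow> x \<in> B" if "x \<in> carrier M" for x
    using B.a_rcos_const B.a_rcos_self[OF that] unfolding q_def zB by blast
  note Zc = Z.a_Hcarr
  have Q_group: "abelian_group Q"
  proof (rule abelian_groupI)
    fix x assume "x \<in> carrier Q"
    then obtain z where z: "z \<in> Z" "x = q z" unfolding carr by blast
    have "q (\<ominus>\<^bsub>M\<^esub> z) \<oplus>\<^bsub>Q\<^esub> x = \<zero>\<^bsub>Q\<^esub>"
      using z by (simp add: add zero M.l_neg)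
    with z show "\<exists>y\<in>carrier Q. y \<oplus>\<^bsub>Q\<^esub> x = \<zero>\<^bsub>Q\<^esub>" unfolding carr by blast
  qed (auto simp: carr zero add M.a_ac intro!: imageI)
  have Q_module: "left_module R Q"
    by (intro left_module.intro left_module_axioms.intro R.ring_axioms Q_group)
       (auto simp: carr smult add smult_closed smult_l_distr smult_r_distr smult_assoc smult_one
         intro!: imageI Z_smult)
  have q_finsum: "finsum Q (\<lambda>u. q (z u)) F = q (finsum M z F)" if "\<And>u. u \<in> F \<Longrightarrow> z u \<in> Z" for z and F :: "int set"
  proof -
    interpret Q: abelian_group Q by (rule Q_group)
    show ?thesis using that
    proof (induction F rule: infinite_finite_induct)
      case (insert u F)
      then have "z \<in> F \<rightarrow> carrier M" "z u \<in> carrier M" "(\<lambda>u. q (z u)) \<in> F \<rightarrow> carrier Q" "q (z u) \<in> carrier Q"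
        by (auto simp: carr)
      with insert show ?case by (simp add: add)
    qed (auto simp: zero)
  qed
  have Q_component: "additive_subgroup (q ` (Z \<inter> gM u)) Q" for u
  proof -
    interpret Q: abelian_group Q by (rule Q_group)
    show ?thesis
    proof (intro additive_subgroupI Q.add.subgroupI; (simp only: partial_object.simps monoid.simps)?)
      show "q ` (Z \<inter> gM u) \<subseteq> carrier Q" by (auto simp: carr)
      show "q ` (Z \<inter> gM u) \<noteq> {}" using Zu.component_zero[of u] by blast
    next
      fix x assume "x \<in> q ` (Z \<inter> gM u)"
      then obtain z where z: "z \<in> Z \<inter> gM u" "x = q z" by blast
      then have "q (\<ominus>\<^bsub>M\<^esub> z) \<oplus>\<^bsub>Q\<^esub> x = \<zero>\<^bsub>Q\<^esub>"
        by (simp add: add zero M.l_neg)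
      then have "\<ominus>\<^bsub>Q\<^esub> x = q (\<ominus>\<^bsub>M\<^esub> z)"
        using z by (intro Q.minus_equality) (auto simp: carr)
      then show "\<ominus>\<^bsub>Q\<^esub> x \<in> q ` (Z \<inter> gM u)"
        using Zu.component_minus z by blast
    next
      fix x y assume "x \<in> q ` (Z \<inter> gM u)" "y \<in> q ` (Z \<inter> gM u)"
      then obtain z w where z: "z \<in> Z \<inter> gM u" "x = q z" and w: "w \<in> Z \<inter> gM u" "y = q w" by blast
      then have "x \<oplus>\<^bsub>Q\<^esub> y = q (z \<oplus>\<^bsub>M\<^esub> w)" by (simp add: add)
      then show "x \<oplus>\<^bsub>Q\<^esub> y \<in> q ` (Z \<inter> gM u)"
        using Zu.component_add z w by blast
    qed
  qed
  have "z \<in> Z \<and> q z \<in> homogeneous_span Q (\<lambda>u. q ` (Z \<inter> gM u))"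
    if "z \<in> homogeneous_span M (\<lambda>u. Z \<inter> gM u)" for z
    using that
  proof (induction rule: homogeneous_span.induct)
    case (sum x y)
    then have "q x \<oplus>\<^bsub>Q\<^esub> q y \<in> homogeneous_span Q (\<lambda>u. q ` (Z \<inter> gM u))"
      by (intro homogeneous_span.sum) auto
    with sum show ?case by (simp add: add)
  qed (auto intro: homogeneous_span.homogeneous)
  then have span: "carrier Q \<subseteq> homogeneous_span Q (\<lambda>u. q ` (Z \<inter> gM u))"
    using Z_span unfolding carr by blast
  have ind: "independent_components Q (\<lambda>u. q ` (Z \<inter> gM u))"
    unfolding independent_components_def
  proof (intro allI impI ballI)
    fix F f u
    assume F: "finite F" "\<forall>u\<in>F. f u \<in> q ` (Z \<inter> gM u)" "finsum Q f F = \<zero>\<^bsub>Q\<^esub>" "u \<in> F"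
    have "\<forall>u\<in>F. \<exists>z. z \<in> Z \<inter> gM u \<and> f u = q z" using F(2) by blast
    then obtain z0 where z0: "\<And>u. u \<in> F \<Longrightarrow> z0 u \<in> Z \<inter> gM u \<and> f u = q (z0 u)" by metis
    define z where "z u = (if u \<in> F then z0 u else \<zero>\<^bsub>M\<^esub>)" for u
    have z: "z u \<in> Z \<inter> gM u" for u using z0 Zu.component_zero by (auto simp: z_def)
    have f: "f u = q (z u)" if "u \<in> F" for u using z0 that by (simp add: z_def)
    interpret Q: abelian_group Q by (rule Q_group)
    have "finsum Q f F = finsum Q (\<lambda>u. q (z u)) F"
      using f z by (intro Q.add.finprod_cong') (auto simp: carr)
    then have "q (finsum M z F) = \<zero>\<^bsub>Q\<^esub>"
      using q_finsum[of F z] z F(3) by (metis IntD1)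
    then have "finsum M z F \<in> B"
      using q_zero_iff M.finsum_closed[of z F] z component_closed by blast
    from Bu.span_decomposition[OF subsetD[OF B_span this]]
    obtain G b where b: "finite G" "\<And>u. b u \<in> B \<inter> gM u" "\<And>u. u \<notin> G \<Longrightarrow> b u = \<zero>\<^bsub>M\<^esub>"
      "finsum M b G = finsum M z F" by blast
    have "z = b"
    proof (rule decomposition_unique[OF independent F(1) _ _ b(1)])
      show "z u = \<zero>\<^bsub>M\<^esub>" if "u \<notin> F" for u using that by (simp add: z_def)
    qed (use b z in \<open>simp_all only: Int_iff\<close>)
    then have "z u \<in> B" using b(2) by auto
    then show "f u = \<zero>\<^bsub>Q\<^esub>"
      using q_zero_iff f[OF F(4)] B.a_Hcarr by simp
  qed
  have "graded R gR Q (\<lambda>u. q ` (Z \<inter> gM u))"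
  proof (intro gradedI Q_module Q_component span ind)
    fix r u y v assume ry: "r \<in> gR u" "y \<in> q ` (Z \<inter> gM v)"
    then obtain z where z: "z \<in> Z" "z \<in> gM v" "y = q z" by blast
    have r: "r \<in> carrier R" using gR ry by blast
    show "r \<odot>\<^bsub>Q\<^esub> y \<in> q ` (Z \<inter> gM (u + v))"
      using smult[OF r Zc] Z_smult[OF r] smult_degree[OF ry(1)] z by auto
  qed
  then show ?thesis by (simp add: Q_def q_def)
qed


lemma cohomology_eq_subquotient:
  "cohomology C d i = subquotient (C i) (coboundaries C d i) (cocycles C d i)"
  by (simp add: cohomology_def subquotient_def Let_def)

lemma cohomology_graded:
  assumes gR: "\<And>u. gR u \<subseteq> carrier R"
    and C: "\<And>k. graded R gR (C k) (gC k)"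
    and d: "\<And>k. graded_hom R (C k) (gC k) (C (Suc k)) (gC (Suc k)) (d k)"
  shows "homogeneous_submodule R (C i) (gC i) (coboundaries C d i)"
    and "homogeneous_submodule R (C i) (gC i) (cocycles C d i)"
    and "graded R gR (cohomology C d i) (cohomology_grading C gC d i)"
proof -
  show B: "homogeneous_submodule R (C i) (gC i) (coboundaries C d i)"
    using graded.homogeneous_submodule_zero[OF C] homogeneous_submodule_image[OF C C d]
    by (auto simp: coboundaries_def split: nat.split)
  show Z: "homogeneous_submodule R (C i) (gC i) (cocycles C d i)"
    using homogeneous_submodule_kernel[OF C C d] by (simp add: cocycles_def)
  show "graded R gR (cohomology C d i) (cohomology_grading C gC d i)"
    using graded.subquotient_graded[OF C gR B Z]
    unfolding cohomology_eq_subquotient cohomology_grading_def[abs_def] .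
qed

section \<open>Finite products of graded modules\<close>

definition product_module :: "'i set \<Rightarrow> ('i \<Rightarrow> ('r, 'm) module) \<Rightarrow> ('r, 'i \<Rightarrow> 'm) module" where
  "product_module T N =
     (let z = (\<lambda>\<sigma>\<in>T. \<zero>\<^bsub>N \<sigma>\<^esub>) in
      \<lparr>carrier = (\<Pi>\<^sub>E \<sigma>\<in>T. carrier (N \<sigma>)),
       monoid.mult = (\<lambda>_ _. z), one = z, ring.zero = z,
       add = (\<lambda>c c'. \<lambda>\<sigma>\<in>T. c \<sigma> \<oplus>\<^bsub>N \<sigma>\<^esub> c' \<sigma>),
       module.smult = (\<lambda>w c. \<lambda>\<sigma>\<in>T. w \<odot>\<^bsub>N \<sigma>\<^esub> c \<sigma>)\<rparr>)"

lemma product_module_simps: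
  "carrier (product_module T N) = (\<Pi>\<^sub>E \<sigma>\<in>T. carrier (N \<sigma>))"
  "\<zero>\<^bsub>product_module T N\<^esub> = (\<lambda>\<sigma>\<in>T. \<zero>\<^bsub>N \<sigma>\<^esub>)"
  "c \<oplus>\<^bsub>product_module T N\<^esub> c' = (\<lambda>\<sigma>\<in>T. c \<sigma> \<oplus>\<^bsub>N \<sigma>\<^esub> c' \<sigma>)"
  "w \<odot>\<^bsub>product_module T N\<^esub> c = (\<lambda>\<sigma>\<in>T. w \<odot>\<^bsub>N \<sigma>\<^esub> c \<sigma>)"
  by (simp_all add: product_module_def Let_def)

locale graded_family =
  fixes R :: "'r ring" and gR :: "int \<Rightarrow> 'r set" and T :: "'i set"
    and N :: "'i \<Rightarrow> ('r, 'm) module" and gN :: "'i \<Rightarrow> int \<Rightarrow> 'm set"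
  assumes ring: "ring R" and finite: "finite T"
    and member: "\<sigma> \<in> T \<Longrightarrow> graded R gR (N \<sigma>) (gN \<sigma>)"
begin

abbreviation P where "P \<equiv> product_module T N"

abbreviation gP where "gP u \<equiv> \<Pi>\<^sub>E \<sigma>\<in>T. gN \<sigma> u"

lemma member_group: "\<sigma> \<in> T \<Longrightarrow> abelian_group (N \<sigma>)"
  using member graded.axioms left_module.axioms by blast

lemma product_group: "abelian_group P"
proof (rule abelian_groupI)
  note [simp] = abelian_groupE(1,2,5)[OF member_group]
  show "\<And>x y. x \<in> carrier P \<Longrightarrow> y \<in> carrier P \<Longrightarrow> x \<oplus>\<^bsub>P\<^esub> y \<in> carrier P"
    "\<zero>\<^bsub>P\<^esub> \<in> carrier P"
    by (auto simp: product_module_simps PiE_iff)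
  show "\<And>x. x \<in> carrier P \<Longrightarrow> \<zero>\<^bsub>P\<^esub> \<oplus>\<^bsub>P\<^esub> x = x"
    by (auto simp: product_module_simps PiE_iff extensional_def intro!: ext)
  show "\<And>x y. x \<in> carrier P \<Longrightarrow> y \<in> carrier P \<Longrightarrow> x \<oplus>\<^bsub>P\<^esub> y = y \<oplus>\<^bsub>P\<^esub> x"
    by (auto simp: product_module_simps abelian_groupE(4)[OF member_group] PiE_iff intro!: restrict_ext)
  show "\<And>x y z. x \<in> carrier P \<Longrightarrow> y \<in> carrier P \<Longrightarrow> z \<in> carrier P \<Longrightarrow>
      x \<oplus>\<^bsub>P\<^esub> y \<oplus>\<^bsub>P\<^esub> z = x \<oplus>\<^bsub>P\<^esub> (y \<oplus>\<^bsub>P\<^esub> z)"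
    by (auto simp: product_module_simps abelian_groupE(3)[OF member_group] PiE_iff intro!: restrict_ext)
  fix x assume x: "x \<in> carrier P"
  define y where "y = (\<lambda>\<sigma>\<in>T. \<ominus>\<^bsub>N \<sigma>\<^esub> x \<sigma>)"
  have xN: "x \<sigma> \<in> carrier (N \<sigma>)" if "\<sigma> \<in> T" for \<sigma>
    using x that by (auto simp: product_module_simps)
  have "y \<in> carrier P"
    using xN by (auto simp: product_module_simps y_def abelian_group.a_inv_closed[OF member_group])
  moreover have "y \<oplus>\<^bsub>P\<^esub> x = \<zero>\<^bsub>P\<^esub>"
    using xN by (auto simp: product_module_simps y_def abelian_group.l_neg[OF member_group] intro!: restrict_ext)
  ultimately show "\<exists>y\<in>carrier P. y \<oplus>\<^bsub>P\<^esub> x = \<zero>\<^bsub>P\<^esub>" by blast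
qed

lemma product_left_module: "left_module R P"
proof (intro left_module.intro left_module_axioms.intro ring product_group)
  note lm = graded.axioms(1)[OF member]
  fix a b x y
  assume *: "a \<in> carrier R" "b \<in> carrier R" "x \<in> carrier P" "y \<in> carrier P"
  show "a \<odot>\<^bsub>P\<^esub> x \<in> carrier P"
    using * left_module.smult_closed[OF lm] unfolding product_module_simps by fastforce
  show "(a \<oplus>\<^bsub>R\<^esub> b) \<odot>\<^bsub>P\<^esub> x = a \<odot>\<^bsub>P\<^esub> x \<oplus>\<^bsub>P\<^esub> b \<odot>\<^bsub>P\<^esub> x"
    using * by (auto simp: product_module_simps left_module.smult_l_distr[OF lm] PiE_iff intro!: restrict_ext)
  show "a \<odot>\<^bsub>P\<^esub> (x \<oplus>\<^bsub>P\<^esub> y) = a \<odot>\<^bsub>P\<^esub> x \<oplus>\<^bsub>P\<^esub> a \<odot>\<^bsub>P\<^esub> y"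
    using * by (auto simp: product_module_simps left_module.smult_r_distr[OF lm] PiE_iff intro!: restrict_ext)
  show "(a \<otimes>\<^bsub>R\<^esub> b) \<odot>\<^bsub>P\<^esub> x = a \<odot>\<^bsub>P\<^esub> (b \<odot>\<^bsub>P\<^esub> x)"
    using * by (auto simp: product_module_simps left_module.smult_assoc[OF lm] PiE_iff intro!: restrict_ext)
next
  fix x assume *: "x \<in> carrier P"
  show "\<one>\<^bsub>R\<^esub> \<odot>\<^bsub>P\<^esub> x = x"
    using * left_module.smult_one[OF graded.axioms(1)[OF member]] by (auto simp: product_module_simps PiE_iff extensional_def intro!: ext)
qed

lemma projection_hom: "\<sigma> \<in> T \<Longrightarrow> abelian_group_hom P (N \<sigma>) (\<lambda>c. c \<sigma>)"
  by (rule additive_mapI[OF product_group member_group]) (auto simp: product_module_simps)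

lemma embedding_hom:
  assumes "\<sigma> \<in> T"
  shows "abelian_group_hom (N \<sigma>) P (\<lambda>x. \<lambda>\<tau>\<in>T. if \<tau> = \<sigma> then x else \<zero>\<^bsub>N \<tau>\<^esub>)"
  using assms
  by (intro additive_mapI[OF member_group product_group])
     (auto simp: product_module_simps abelian_groupE(1,2,5)[OF member_group] intro!: restrict_ext)

text \<open>
  A family is the finite sum of its entries, each placed at its own index with zeros elsewhere, and
  the projections detect the vanishing of homogeneous components.
\<close>

lemma product_graded: "graded R gR P gP"
proof -
  interpret P: left_module R P by (rule product_left_module)
  note sub = graded.axioms(2)[OF member]
  have comp: "additive_subgroup (gP u) P" for u
  proof (intro additive_subgroupI P.add.subgroupI; (simp only: partial_object.simps monoid.simps)?)
    show "gP u \<subseteq> carrier P"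
      using subgroup_family.component_closed[OF sub] by (fastforce simp: product_module_simps)
    have "\<zero>\<^bsub>P\<^esub> \<in> gP u"
      by (auto simp: product_module_simps subgroup_family.component_zero[OF sub])
    then show "gP u \<noteq> {}" by blast
  next
    fix x assume x: "x \<in> gP u"
    then have xP: "x \<in> carrier P"
      using subgroup_family.component_closed[OF sub] by (fastforce simp: product_module_simps)
    have "(\<ominus>\<^bsub>P\<^esub> x) \<sigma> = \<ominus>\<^bsub>N \<sigma>\<^esub> x \<sigma>" if "\<sigma> \<in> T" for \<sigma>
      using abelian_group_hom.hom_a_inv[OF projection_hom[OF that] xP] .
    moreover have "\<ominus>\<^bsub>P\<^esub> x \<in> carrier P" using xP by simp
    ultimately show "\<ominus>\<^bsub>P\<^esub> x \<in> gP u"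
      using x subgroup_family.component_minus[OF sub] unfolding product_module_simps PiE_iff by simp
  next
    fix x y assume "x \<in> gP u" "y \<in> gP u"
    then show "x \<oplus>\<^bsub>P\<^esub> y \<in> gP u"
      unfolding product_module_simps using subgroup_family.component_add[OF sub] PiE_mem by fastforce
  qed
  have span: "c \<in> homogeneous_span P gP" if c: "c \<in> carrier P" for c
  proof -
    define part where "part S = (\<lambda>\<tau>\<in>T. if \<tau> \<in> S then c \<tau> else \<zero>\<^bsub>N \<tau>\<^esub>)" for S
    have cN: "c \<sigma> \<in> carrier (N \<sigma>)" if "\<sigma> \<in> T" for \<sigma>
      using c that by (auto simp: product_module_simps)
    have "part S \<in> homogeneous_span P gP" if "S \<subseteq> T" for S
      using finite_subset[OF that finite] that
    proof (induction S)
      case empty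
      have "part {} \<in> gP 0"
        by (auto simp: part_def subgroup_family.component_zero[OF sub])
      then show ?case by (rule homogeneous_span.homogeneous)
    next
      case (insert \<sigma> S)
      define e where "e = (\<lambda>\<tau>\<in>T. if \<tau> = \<sigma> then c \<sigma> else \<zero>\<^bsub>N \<tau>\<^esub>)"
      have "e \<in> homogeneous_span P gP"
        unfolding e_def
        by (rule span_image[OF embedding_hom sub])
           (use insert cN graded.spanned[OF member] in
             \<open>auto simp: subgroup_family.component_zero[OF sub]\<close>)
      moreover have "part (insert \<sigma> S) = e \<oplus>\<^bsub>P\<^esub> part S"
        using insert cN
        by (auto simp: product_module_simps e_def part_def abelian_groupE(2,5)[OF member_group]
            abelian_monoid.r_zero[OF abelian_group.axioms(1)[OF member_group]] intro!: restrict_ext)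
      ultimately show ?case using insert by (auto intro: homogeneous_span.sum)
    qed
    moreover have "part T = c"
      using c unfolding part_def by (auto simp: product_module_simps intro!: PiE_ext[where k = T])
    ultimately show ?thesis by auto
  qed
  have ind: "independent_components P gP"
    unfolding independent_components_def
  proof (intro allI impI ballI)
    fix F f u
    assume F: "finite F" "\<forall>u\<in>F. f u \<in> gP u" "finsum P f F = \<zero>\<^bsub>P\<^esub>" "u \<in> F"
    have fP: "f \<in> F \<rightarrow> carrier P"
      using F(2) additive_subgroup.a_subset[OF comp] by blast
    have "f u \<sigma> = \<zero>\<^bsub>N \<sigma>\<^esub>" if \<sigma>: "\<sigma> \<in> T" for \<sigma>
    proof (rule independent_componentsD[OF graded.independent[OF member[OF \<sigma>]] F(1)])
      show "f v \<sigma> \<in> gN \<sigma> v" if "v \<in> F" for v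
        using F(2) that \<sigma> by auto
      show "finsum (N \<sigma>) (\<lambda>v. f v \<sigma>) F = \<zero>\<^bsub>N \<sigma>\<^esub>"
        using abelian_group_hom.hom_finsum[OF projection_hom[OF \<sigma>] fP] F(3) \<sigma>
        by (simp add: product_module_simps)
    qed (rule F(4))
    moreover have "f u \<in> carrier P" using fP F(4) by blast
    ultimately show "f u = \<zero>\<^bsub>P\<^esub>"
      unfolding product_module_simps
      by (intro PiE_ext[where k = T]) (auto simp: abelian_groupE(2)[OF member_group])
  qed
  show ?thesis
  proof (intro gradedI product_left_module comp subsetI span ind)
    fix r u y v assume "r \<in> gR u" "y \<in> gP v"
    then show "r \<odot>\<^bsub>P\<^esub> y \<in> gP (u + v)"
      using graded.smult_degree[OF member] by (auto simp: product_module_simps PiE_iff)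
  qed
qed

end

section \<open>Homomorphisms into products\<close>

lemma graded_hom_tuple:
  assumes "\<And>\<sigma>. \<sigma> \<in> T \<Longrightarrow> graded_hom R M gM (N \<sigma>) (gN \<sigma>) (f \<sigma>)"
  shows "graded_hom R M gM (product_module T N) (\<lambda>u. \<Pi>\<^sub>E \<sigma>\<in>T. gN \<sigma> u) (\<lambda>x. \<lambda>\<sigma>\<in>T. f \<sigma> x)"
  unfolding graded_hom_def product_module_simps
proof (intro conjI ballI allI)
  show "(\<lambda>x. \<lambda>\<sigma>\<in>T. f \<sigma> x) \<in> carrier M \<rightarrow> (\<Pi>\<^sub>E \<sigma>\<in>T. carrier (N \<sigma>))"
    using assms unfolding graded_hom_def by fastforce
  show "(\<lambda>x. \<lambda>\<sigma>\<in>T. f \<sigma> x) ` gM u \<subseteq> (\<Pi>\<^sub>E \<sigma>\<in>T. gN \<sigma> u)" for u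
    using assms unfolding graded_hom_def by fastforce
qed (use assms in \<open>auto simp: graded_hom_def intro!: restrict_ext\<close>)

text \<open>The Cech differential is an alternating sum of canonical maps, hence of this form.\<close>

lemma graded_hom_combination:
  assumes M: "graded R gR M gM" and N: "graded R gR N gN"
    and f: "\<And>j. j \<in> A \<Longrightarrow> graded_hom R M gM N gN (f j)"
  shows "graded_hom R M gM N gN (\<lambda>x. \<Oplus>\<^bsub>N\<^esub>j\<in>A. add_pow N (k j :: int) (f j x))"
proof -
  interpret M: graded R gR M gM by fact
  interpret N: graded R gR N gN by fact
  have hom: "abelian_group_hom M N (f j)" if "j \<in> A" for j
    using f[OF that] graded_hom_iff[OF M N] by blast
  have cl [simp]: "f j x \<in> carrier N" if "j \<in> A" "x \<in> carrier M" for j x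
    using abelian_group_hom.hom_closed[OF hom] that .
  have deg_pow: "add_pow N (n::int) y \<in> gN u" if "y \<in> gN u" for n y u
  proof -
    have "subgroup (gN u) (add_monoid N)"
      using N.component_subgroup by (simp add: additive_subgroup_def)
    then show ?thesis
      using group.subgroup_int_pow_closed[OF N.a_group, of "gN u" y n] that by (simp add: add_pow_def)
  qed
  show ?thesis
    unfolding graded_hom_iff[OF M N]
  proof (intro conjI ballI allI)
    show "abelian_group_hom M N (\<lambda>x. \<Oplus>\<^bsub>N\<^esub>j\<in>A. add_pow N (k j) (f j x))"
      by (rule additive_mapI[OF M.abelian_group_axioms N.abelian_group_axioms])
         (auto simp: abelian_group_hom.hom_add[OF hom] N.add.int_pow_distrib Pi_iff simp flip: N.add.finprod_multf
           cong: N.add.finprod_cong)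
  next
    fix r x assume rx: "r \<in> carrier R" "x \<in> carrier M"
    interpret r: abelian_group_hom N N "\<lambda>y. r \<odot>\<^bsub>N\<^esub> y" by (rule N.smult_additive[OF rx(1)])
    have "r \<odot>\<^bsub>N\<^esub> (\<Oplus>\<^bsub>N\<^esub>j\<in>A. add_pow N (k j) (f j x)) = (\<Oplus>\<^bsub>N\<^esub>j\<in>A. r \<odot>\<^bsub>N\<^esub> add_pow N (k j) (f j x))"
      using rx by (intro r.hom_finsum) auto
    also have "\<dots> = (\<Oplus>\<^bsub>N\<^esub>j\<in>A. add_pow N (k j) (f j (r \<odot>\<^bsub>M\<^esub> x)))"
      using rx f M.smult_closed[OF rx]
      by (intro N.add.finprod_cong') (auto simp: r.hom_add_pow_int graded_hom_def)
    finally show "(\<Oplus>\<^bsub>N\<^esub>j\<in>A. add_pow N (k j) (f j (r \<odot>\<^bsub>M\<^esub> x))) =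
      r \<odot>\<^bsub>N\<^esub> (\<Oplus>\<^bsub>N\<^esub>j\<in>A. add_pow N (k j) (f j x))" by simp
  next
    fix u
    have "f j x \<in> gN u" if "j \<in> A" "x \<in> gM u" for j x
      using f[OF that(1)] that unfolding graded_hom_def by blast
    then show "(\<lambda>x. \<Oplus>\<^bsub>N\<^esub>j\<in>A. add_pow N (k j) (f j x)) ` gM u \<subseteq> gN u"
      by (auto intro!: N.component_finsum deg_pow)
  qed
qed

lemma graded_hom_compose:
  assumes "graded_hom R M gM N gN f" "graded_hom R N gN Q gQ g"
  shows "graded_hom R M gM Q gQ (\<lambda>x. g (f x))"
  using assms unfolding graded_hom_def by (auto simp: Pi_iff image_subset_iff)

lemma (in graded_family) graded_hom_projection:
  assumes "\<sigma> \<in> T"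
  shows "graded_hom R P gP (N \<sigma>) (gN \<sigma>) (\<lambda>c. c \<sigma>)"
  using assms unfolding graded_hom_def by (auto simp: product_module_simps)


section \<open>Polynomials and partial derivatives\<close>

lemma type_ring_simps [simp]:
  "carrier ring_of_type_algebra = UNIV"
  "x \<otimes>\<^bsub>ring_of_type_algebra\<^esub> y = x * y" "\<one>\<^bsub>ring_of_type_algebra\<^esub> = 1"
  "x \<oplus>\<^bsub>ring_of_type_algebra\<^esub> y = x + y" "\<zero>\<^bsub>ring_of_type_algebra\<^esub> = 0"
  by (simp_all add: ring_of_type_algebra_def)

lemma ring_of_type_algebra_ring: "ring (ring_of_type_algebra :: 'a::ring_1 ring)"
proof -
  have "\<exists>y. y + x = 0" for x :: 'a by (rule exI[of _ "- x"]) simp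
  then show ?thesis
    by (intro ringI abelian_groupI monoidI) (auto simp: algebra_simps)
qed

lemma poly_mapping_single_sum:
  fixes f :: "'k \<Rightarrow>\<^sub>0 'a::comm_monoid_add"
  shows "(\<Sum>k\<in>Poly_Mapping.keys f. Poly_Mapping.single k (Poly_Mapping.lookup f k)) = f"
  by (rule poly_mapping_eqI)
     (auto simp: lookup_sum lookup_single when_def in_keys_iff)

lemma poly_mapping_additive_induct [case_names single add]:
  fixes f :: "'k \<Rightarrow>\<^sub>0 'a::comm_monoid_add"
  assumes "\<And>k a. P (Poly_Mapping.single k a)" "\<And>f g. P f \<Longrightarrow> P g \<Longrightarrow> P (f + g)"
  shows "P f"
proof -
  have zero: "P 0" using assms(1)[of undefined 0] by simp
  have "P (\<Sum>k\<in>K. Poly_Mapping.single k (Poly_Mapping.lookup f k))" for K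
    by (induction K rule: infinite_finite_induct) (auto simp: zero assms)
  then show ?thesis using poly_mapping_single_sum[of f] by metis
qed

text \<open>Monomials are reached from the constants by induction on their degree.\<close>

lemma mpoly_induct [case_names const var add mult]:
  fixes p :: "('n::finite, 'a::comm_ring_1) mpoly"
  assumes const: "\<And>a. P (mpoly_const a)" and var: "\<And>i. P (mpoly_var i)"
    and add: "\<And>p q. P p \<Longrightarrow> P q \<Longrightarrow> P (p + q)" and mult: "\<And>p q. P p \<Longrightarrow> P q \<Longrightarrow> P (p * q)"
  shows "P p"
proof (induction p rule: poly_mapping_additive_induct)
  case (single \<alpha> a)
  show ?case
  proof (induction "\<Sum>i\<in>UNIV. Poly_Mapping.lookup \<alpha> i" arbitrary: \<alpha> rule: less_induct)
    case less
    show ?case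
    proof (cases "\<alpha> = 0")
      case True
      then show ?thesis using const[of a] by (simp add: mpoly_const_def)
    next
      case False
      then obtain i where i: "Poly_Mapping.lookup \<alpha> i \<noteq> 0"
        by (metis lookup_zero poly_mapping_eqI)
      define \<beta> where "\<beta> = \<alpha> - Poly_Mapping.single i 1"
      have \<alpha>: "\<alpha> = Poly_Mapping.single i 1 + \<beta>"
        using i by (intro poly_mapping_eqI) (auto simp: \<beta>_def lookup_add lookup_minus lookup_single when_def)
      have "(\<Sum>j\<in>UNIV. Poly_Mapping.lookup \<alpha> j) = 1 + (\<Sum>j\<in>UNIV. Poly_Mapping.lookup \<beta> j)"
        by (simp add: \<alpha> lookup_add sum.distrib lookup_single when_def)
      then have "P (Poly_Mapping.single \<beta> a)" using less by simp
      moreover have "Poly_Mapping.single \<alpha> a = mpoly_var i * Poly_Mapping.single \<beta> a"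
        by (simp add: \<alpha> mpoly_var_def mult_single)
      ultimately show ?thesis using var mult by simp
    qed
  qed
qed (rule add)

lemma partial_deriv_single:
  "partial_deriv i (Poly_Mapping.single \<alpha> a) =
     Poly_Mapping.single (\<alpha> - Poly_Mapping.single i 1) (of_nat (Poly_Mapping.lookup \<alpha> i) * a)"
  by (simp add: partial_deriv_def)

lemma partial_deriv_add: "partial_deriv i (p + q) = partial_deriv i p + partial_deriv i q"
  unfolding partial_deriv_def
  by (rule setsum_keys_plus_distrib) (simp_all add: distrib_left single_add)

lemma partial_deriv_mult: "partial_deriv i (p * q) = p * partial_deriv i q + partial_deriv i p * q"
proof (induction p rule: poly_mapping_additive_induct)
  case (single \<alpha> a)
  show ?case
  proof (induction q rule: poly_mapping_additive_induct)
    case (single \<beta> b)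
    have 1: "\<alpha> + (\<beta> - Poly_Mapping.single i 1) = \<alpha> + \<beta> - Poly_Mapping.single i 1"
      if "Poly_Mapping.lookup \<beta> i \<noteq> 0"
      using that by (intro poly_mapping_eqI) (auto simp: lookup_add lookup_minus lookup_single when_def)
    have 2: "\<beta> + (\<alpha> - Poly_Mapping.single i 1) = \<alpha> + \<beta> - Poly_Mapping.single i 1"
      if "Poly_Mapping.lookup \<alpha> i \<noteq> 0"
      using that by (intro poly_mapping_eqI) (auto simp: lookup_add lookup_minus lookup_single when_def)
    show ?case
      by (cases "Poly_Mapping.lookup \<alpha> i = 0"; cases "Poly_Mapping.lookup \<beta> i = 0")
         (simp_all add: mult_single partial_deriv_single lookup_add 1 2 algebra_simps
           del: One_nat_def flip: single_add)
  next
    case (add f g)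
    then show ?case by (simp add: partial_deriv_add algebra_simps)
  qed
next
  case (add f g)
  then show ?case by (simp add: partial_deriv_add algebra_simps)
qed

lemma partial_deriv_const: "partial_deriv i (mpoly_const a) = 0"
  by (simp add: mpoly_const_def partial_deriv_single)

lemma partial_deriv_var: "partial_deriv i (mpoly_var j) = (if i = j then 1 else 0)"
  by (auto simp: mpoly_var_def partial_deriv_single lookup_single when_def)

lemma partial_deriv_zero: "partial_deriv i 0 = 0"
  by (simp add: partial_deriv_def)

lemma partial_deriv_one: "partial_deriv i 1 = 0"
  using partial_deriv_const[of i 1] by (simp add: mpoly_const_def)

lemma partial_deriv_commute:
  fixes p :: "('n::finite, 'a::comm_ring_1) mpoly"
  shows "partial_deriv i (partial_deriv j p) = partial_deriv j (partial_deriv i p)"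
proof (induction p rule: mpoly_induct)
  case (var k)
  then show ?case by (simp add: partial_deriv_var partial_deriv_zero partial_deriv_one)
qed (simp_all add: partial_deriv_const partial_deriv_add partial_deriv_mult partial_deriv_zero algebra_simps)

definition monomial_degree :: "('n::finite \<Rightarrow>\<^sub>0 nat) \<Rightarrow> int" where
  "monomial_degree \<alpha> = (\<Sum>i\<in>UNIV. int (Poly_Mapping.lookup \<alpha> i))"

lemma monomial_degree_add: "monomial_degree (\<alpha> + \<beta>) = monomial_degree \<alpha> + monomial_degree \<beta>"
  by (simp add: monomial_degree_def lookup_add sum.distrib)

lemma monomial_degree_single: "monomial_degree (Poly_Mapping.single i 1) = 1"
  by (simp add: monomial_degree_def lookup_single when_def if_distrib cong: if_cong)

lemma poly_grading_iff: "p \<in> poly_grading u \<longleftrightarrow> (\<forall>\<alpha>\<in>Poly_Mapping.keys p. monomial_degree \<alpha> = u)"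
  by (simp add: poly_grading_def monomial_degree_def)

lemma poly_grading_sum: "(\<And>k. k \<in> K \<Longrightarrow> f k \<in> poly_grading u) \<Longrightarrow> sum f K \<in> poly_grading u"
  using keys_sum[of f K] unfolding poly_grading_iff by blast

lemma poly_grading_add: "p \<in> poly_grading u \<Longrightarrow> q \<in> poly_grading u \<Longrightarrow> p + q \<in> poly_grading u"
  using Poly_Mapping.keys_add[of p q] unfolding poly_grading_iff by blast

lemma poly_grading_mult:
  "p \<in> poly_grading u \<Longrightarrow> q \<in> poly_grading v \<Longrightarrow> p * q \<in> poly_grading (u + v)"
  using keys_mult[of p q] unfolding poly_grading_iff by (fastforce simp: monomial_degree_add)

lemma poly_grading_one: "1 \<in> poly_grading 0"
  by (simp add: poly_grading_def)

lemma poly_grading_zero: "0 \<in> poly_grading u"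
  by (simp add: poly_grading_def)

lemma poly_grading_const: "mpoly_const a \<in> poly_grading 0"
  by (simp add: poly_grading_def mpoly_const_def)

lemma poly_grading_var: "mpoly_var i \<in> poly_grading 1"
  by (simp add: poly_grading_iff mpoly_var_def monomial_degree_single[unfolded One_nat_def])

lemma poly_grading_partial_deriv:
  assumes "p \<in> poly_grading u"
  shows "partial_deriv i p \<in> poly_grading (u - 1)"
  unfolding partial_deriv_def
proof (rule poly_grading_sum)
  fix \<alpha> assume \<alpha>: "\<alpha> \<in> Poly_Mapping.keys p"
  show "Poly_Mapping.single (\<alpha> - Poly_Mapping.single i 1)
          (of_nat (Poly_Mapping.lookup \<alpha> i) * Poly_Mapping.lookup p \<alpha>) \<in> poly_grading (u - 1)"
  proof (cases "Poly_Mapping.lookup \<alpha> i = 0")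
    case True
    then show ?thesis by (simp add: poly_grading_zero)
  next
    case False
    then have "\<alpha> = Poly_Mapping.single i 1 + (\<alpha> - Poly_Mapping.single i 1)"
      by (intro poly_mapping_eqI) (auto simp: lookup_add lookup_minus lookup_single when_def)
    then have "monomial_degree \<alpha> = 1 + monomial_degree (\<alpha> - Poly_Mapping.single i 1)"
      by (metis monomial_degree_add monomial_degree_single)
    with assms \<alpha> show ?thesis by (auto simp: poly_grading_iff)
  qed
qed

text \<open>
  Both sides are additive, and \<open>X i * \<partial> i\<close> multiplies a monomial by its exponent at \<open>i\<close>.
\<close>

lemma euler_formula:
  fixes p :: "('n::finite, 'a::comm_ring_1) mpoly"
  assumes "p \<in> poly_grading u"
  shows "(\<Sum>i\<in>UNIV. mpoly_var i * partial_deriv i p) = of_int u * p"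
proof -
  define E where "E q = (\<Sum>i\<in>UNIV. mpoly_var i * partial_deriv i q)" for q :: "('n, 'a) mpoly"
  have E_add: "E (q + r) = E q + E r" for q r
    by (simp add: E_def partial_deriv_add distrib_left sum.distrib)
  have E_single: "E (Poly_Mapping.single \<alpha> a) = of_int (monomial_degree \<alpha>) * Poly_Mapping.single \<alpha> a" for \<alpha> a
  proof -
    have "mpoly_var i * partial_deriv i (Poly_Mapping.single \<alpha> a) =
        of_int (int (Poly_Mapping.lookup \<alpha> i)) * Poly_Mapping.single \<alpha> a" for i
    proof (cases "Poly_Mapping.lookup \<alpha> i = 0")
      case False
      then have "Poly_Mapping.single i 1 + (\<alpha> - Poly_Mapping.single i 1) = \<alpha>"
        by (intro poly_mapping_eqI) (auto simp: lookup_add lookup_minus lookup_single when_def)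
      then have "mpoly_var i * partial_deriv i (Poly_Mapping.single \<alpha> a) =
          Poly_Mapping.single \<alpha> (of_nat (Poly_Mapping.lookup \<alpha> i) * a)"
        by (simp add: partial_deriv_single mpoly_var_def mult_single)
      also have "\<dots> = Poly_Mapping.single 0 (of_nat (Poly_Mapping.lookup \<alpha> i)) * Poly_Mapping.single \<alpha> a"
        by (simp only: mult_single add_0)
      finally show ?thesis by simp
    qed (simp add: partial_deriv_single)
    then show ?thesis by (simp add: E_def monomial_degree_def sum_distrib_right)
  qed
  have "E (\<Sum>\<alpha>\<in>K. Poly_Mapping.single \<alpha> (Poly_Mapping.lookup p \<alpha>)) =
      of_int u * (\<Sum>\<alpha>\<in>K. Poly_Mapping.single \<alpha> (Poly_Mapping.lookup p \<alpha>))" if "K \<subseteq> Poly_Mapping.keys p" for K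
    using finite_subset[OF that finite_keys] that
  proof (induction K)
    case empty
    then show ?case by (simp add: E_def partial_deriv_zero)
  next
    case (insert \<alpha> K)
    then have "monomial_degree \<alpha> = u" using assms by (simp add: poly_grading_iff)
    with insert show ?case by (simp add: E_add E_single distrib_left)
  qed
  from this[of "Poly_Mapping.keys p"] show ?thesis by (simp add: poly_mapping_single_sum E_def)
qed

section \<open>The Weyl algebra\<close>

lemma weyl_ideal_ideal: "ideal weyl_ideal ring_of_type_algebra"
  unfolding weyl_ideal_def by (rule ring.genideal_ideal[OF ring_of_type_algebra_ring]) simp

interpretation weyl: ring weyl_algebra
  unfolding weyl_algebra_def by (rule ideal.quotient_is_ring[OF weyl_ideal_ideal])

lemma weyl_class_hom: "weyl_class \<in> ring_hom ring_of_type_algebra weyl_algebra"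
  unfolding weyl_class_def[abs_def] weyl_algebra_def by (rule ideal.rcos_ring_hom[OF weyl_ideal_ideal])

lemma weyl_class_add: "weyl_class (f + g) = weyl_class f \<oplus>\<^bsub>weyl_algebra\<^esub> weyl_class g"
  using ring_hom_add[OF weyl_class_hom, of f g] by simp

lemma weyl_class_mult: "weyl_class (f * g) = weyl_class f \<otimes>\<^bsub>weyl_algebra\<^esub> weyl_class g"
  using ring_hom_mult[OF weyl_class_hom, of f g] by simp

lemma weyl_class_one: "weyl_class 1 = \<one>\<^bsub>weyl_algebra\<^esub>"
  using ring_hom_one[OF weyl_class_hom] by simp

lemma carrier_weyl_algebra: "carrier weyl_algebra = range weyl_class"
  by (auto simp: weyl_algebra_def FactRing_def A_RCOSETS_def' weyl_class_def)

lemma weyl_class_closed [simp]: "weyl_class f \<in> carrier weyl_algebra"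
  by (simp add: carrier_weyl_algebra)

lemma weyl_class_zero: "weyl_class 0 = \<zero>\<^bsub>weyl_algebra\<^esub>"
  using weyl_class_add[of 0 0] weyl.add.l_cancel_one' weyl_class_closed by simp

lemma weyl_class_diff: "weyl_class (f - g) = weyl_class f \<ominus>\<^bsub>weyl_algebra\<^esub> weyl_class g"
proof -
  have "weyl_class (- g) = \<ominus>\<^bsub>weyl_algebra\<^esub> weyl_class g"
    using weyl_class_add[of "- g" g] by (intro weyl.minus_equality[symmetric]) (simp_all add: weyl_class_zero)
  then show ?thesis using weyl_class_add[of f "- g"] by (simp add: weyl.minus_eq)
qed

lemma mem_weyl_class: "g \<in> weyl_class f \<longleftrightarrow> g - f \<in> weyl_ideal"
proof
  assume "g \<in> weyl_class f"
  then obtain h where "h \<in> weyl_ideal" "g = h + f" by (auto simp: weyl_class_def a_r_coset_def r_coset_def)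
  then show "g - f \<in> weyl_ideal" by simp
next
  assume "g - f \<in> weyl_ideal"
  then show "g \<in> weyl_class f"
    by (auto simp: weyl_class_def a_r_coset_def r_coset_def intro!: bexI[of _ "g - f"])
qed

lemma weyl_class_eqI: "f - g \<in> weyl_ideal \<Longrightarrow> weyl_class f = weyl_class g"
  using abelian_subgroup.a_repr_independence'[OF abelian_subgroupI3[OF ideal.axioms(1)[OF weyl_ideal_ideal]
      ring.is_abelian_group[OF ring_of_type_algebra_ring]], of f g] mem_weyl_class[of f g]
  by (simp add: weyl_class_def)

lemma weyl_relations_subset: "weyl_relations \<subseteq> weyl_ideal"
  unfolding weyl_ideal_def by (rule ring.genideal_self[OF ring_of_type_algebra_ring]) simp

lemma weyl_X_commute: "weyl_class (free_X i * free_X j) = weyl_class (free_X j * free_X i)"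
proof (rule weyl_class_eqI)
  have "free_X i * free_X j - free_X j * free_X i \<in> weyl_relations"
    by (auto simp: weyl_relations_def)
  then show "free_X i * free_X j - free_X j * free_X i \<in> weyl_ideal"
    using weyl_relations_subset by blast
qed

lemma weyl_D_commute: "weyl_class (free_D i * free_D j) = weyl_class (free_D j * free_D i)"
proof (rule weyl_class_eqI)
  have "free_D i * free_D j - free_D j * free_D i \<in> weyl_relations"
    by (auto simp: weyl_relations_def)
  then show "free_D i * free_D j - free_D j * free_D i \<in> weyl_ideal"
    using weyl_relations_subset by blast
qed

lemma weyl_D_X:
  "weyl_class (free_D i * free_X j) = weyl_class (free_X j * free_D i + (if i = j then 1 else 0))"
proof (rule weyl_class_eqI)
  have "free_D i * free_X j - free_X j * free_D i - (if i = j then 1 else 0) \<in> weyl_relations"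
    by (auto simp: weyl_relations_def)
  then show "free_D i * free_X j - (free_X j * free_D i + (if i = j then 1 else 0)) \<in> weyl_ideal"
    using weyl_relations_subset by (auto simp: diff_diff_eq)
qed


lemma mset_monomial_word:
  fixes \<alpha> :: "'n::{finite,linorder} \<Rightarrow>\<^sub>0 nat"
  shows "count (mset (letters (monomial_word \<alpha>))) g =
     (case g of X_gen i \<Rightarrow> Poly_Mapping.lookup \<alpha> i | D_gen i \<Rightarrow> 0)"
proof -
  have 1: "count (mset (concat (map (\<lambda>i. replicate (Poly_Mapping.lookup \<alpha> i) (X_gen i)) xs))) (X_gen i) =
      (if i \<in> set xs then Poly_Mapping.lookup \<alpha> i else 0)" if "distinct xs" for xs :: "'n list" and i
    using that by (induction xs) (auto simp: count_mset count_list_0_iff)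
  have 2: "count (mset (concat (map (\<lambda>i. replicate (Poly_Mapping.lookup \<alpha> i) (X_gen i)) xs))) (D_gen i) = 0"
    for xs :: "'n list" and i
    by (induction xs) (auto simp: count_mset count_list_0_iff)
  show ?thesis by (cases g) (simp_all add: monomial_word_def 1 2)
qed

text \<open>
  Since the \<open>X i\<close> commute, the first letter of one word can be moved to the front of the other, and
  the remaining letters are treated by induction.
\<close>

lemma weyl_class_permute:
  assumes "mset xs = mset ys" "set xs \<subseteq> range X_gen"
  shows "weyl_class (Poly_Mapping.single (Free_Word xs) (1::'a::comm_ring_1)) =
    weyl_class (Poly_Mapping.single (Free_Word ys) 1)"
proof -
  let ?w = "\<lambda>xs. weyl_class (Poly_Mapping.single (Free_Word xs) (1::'a))"
  have append: "?w (us @ vs) = ?w us \<otimes>\<^bsub>weyl_algebra\<^esub> ?w vs" for us vs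
    by (simp add: mult_single plus_free_word_def flip: weyl_class_mult)
  have move: "?w (us @ [x]) = ?w (x # us)" if "set us \<subseteq> range X_gen" and x_gen: "x \<in> range X_gen" for us x
    using that(1)
  proof (induction us)
    case (Cons y us)
    obtain i j where x: "x = X_gen i" and y: "y = X_gen j" using Cons.prems x_gen by auto
    have "?w ((y # us) @ [x]) = ?w [y] \<otimes>\<^bsub>weyl_algebra\<^esub> ?w (us @ [x])"
      using append[of "[y]" "us @ [x]"] by simp
    also have "\<dots> = ?w [y] \<otimes>\<^bsub>weyl_algebra\<^esub> ?w [x] \<otimes>\<^bsub>weyl_algebra\<^esub> ?w us"
      using Cons append[of "[x]" us] by (simp add: weyl.m_assoc)
    also have "?w [y] \<otimes>\<^bsub>weyl_algebra\<^esub> ?w [x] = ?w [x] \<otimes>\<^bsub>weyl_algebra\<^esub> ?w [y]"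
      using weyl_X_commute[of j i, where 'b = 'a] by (simp add: x y free_X_def weyl_class_mult)
    also have "?w [x] \<otimes>\<^bsub>weyl_algebra\<^esub> ?w [y] \<otimes>\<^bsub>weyl_algebra\<^esub> ?w us = ?w (x # y # us)"
      using append[of "[x]" "[y]"] append[of "[x,y]" us] by simp
    finally show ?case .
  qed simp
  show ?thesis using assms
  proof (induction xs arbitrary: ys)
    case (Cons x xs)
    then have "x \<in> set ys" by (metis list.set_intros(1) mset_eq_setD)
    then obtain us vs where ys: "ys = us @ x # vs" by (meson split_list)
    have sub: "set us \<subseteq> range X_gen" "x \<in> range X_gen"
      using Cons.prems mset_eq_setD[OF Cons.prems(1)] by (auto simp: ys)
    have "?w ys = ?w (us @ [x]) \<otimes>\<^bsub>weyl_algebra\<^esub> ?w vs"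
      using append[of "us @ [x]" vs] by (simp add: ys)
    also have "\<dots> = ?w [x] \<otimes>\<^bsub>weyl_algebra\<^esub> ?w us \<otimes>\<^bsub>weyl_algebra\<^esub> ?w vs"
      using move[OF sub] append[of "[x]" us] by simp
    also have "\<dots> = ?w [x] \<otimes>\<^bsub>weyl_algebra\<^esub> ?w (us @ vs)"
      by (simp add: append weyl.m_assoc)
    also have "?w (us @ vs) = ?w xs"
      using Cons by (intro Cons.IH[symmetric]) (auto simp: ys)
    finally show ?case using append[of "[x]" xs] by simp
  qed simp
qed

definition free_lift :: "('n::{finite,linorder}, 'a::comm_ring_1) mpoly \<Rightarrow> ('n, 'a) free_weyl" where
  "free_lift p = (\<Sum>\<alpha>\<in>Poly_Mapping.keys p.
     Poly_Mapping.single (monomial_word \<alpha>) (Poly_Mapping.lookup p \<alpha>))"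

lemma poly_to_weyl_lift: "poly_to_weyl p = weyl_class (free_lift p)"
  by (simp add: poly_to_weyl_def free_lift_def)

lemma free_lift_add: "free_lift (p + q) = free_lift p + free_lift q"
  unfolding free_lift_def by (rule setsum_keys_plus_distrib) (simp_all add: single_add)

lemma free_lift_single: "free_lift (Poly_Mapping.single \<alpha> a) = Poly_Mapping.single (monomial_word \<alpha>) a"
  by (simp add: free_lift_def)

lemma poly_to_weyl_closed [simp]: "poly_to_weyl p \<in> carrier weyl_algebra"
  by (simp add: poly_to_weyl_lift)

lemma poly_to_weyl_add: "poly_to_weyl (p + q) = poly_to_weyl p \<oplus>\<^bsub>weyl_algebra\<^esub> poly_to_weyl q"
  by (simp add: poly_to_weyl_lift free_lift_add weyl_class_add)

lemma poly_to_weyl_mult: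
  fixes p q :: "('n::{finite,linorder}, 'a::comm_ring_1) mpoly"
  shows "poly_to_weyl (p * q) = poly_to_weyl p \<otimes>\<^bsub>weyl_algebra\<^esub> poly_to_weyl q"
proof (induction p rule: poly_mapping_additive_induct)
  case (single \<alpha> a)
  show ?case
  proof (induction q rule: poly_mapping_additive_induct)
    case (single \<beta> b)
    let ?w = "\<lambda>w. weyl_class (Poly_Mapping.single w (1::'a))"
    have sub: "set (letters (monomial_word (\<alpha> + \<beta>))) \<subseteq> range X_gen"
      by (auto simp: monomial_word_def)
    have "mset (letters (monomial_word (\<alpha> + \<beta>))) =
        mset (letters (monomial_word \<alpha>) @ letters (monomial_word \<beta>))"
      by (rule multiset_eqI) (simp add: mset_monomial_word lookup_add split: weyl_gen.split)
    from weyl_class_permute[OF this sub, where 'a = 'a]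
    have perm: "?w (monomial_word (\<alpha> + \<beta>)) = ?w (monomial_word \<alpha> + monomial_word \<beta>)"
      by (simp add: plus_free_word_def)
    have "poly_to_weyl (Poly_Mapping.single \<alpha> a * Poly_Mapping.single \<beta> b) =
        weyl_class (Poly_Mapping.single 0 (a * b)) \<otimes>\<^bsub>weyl_algebra\<^esub> ?w (monomial_word (\<alpha> + \<beta>))"
      by (simp add: poly_to_weyl_lift mult_single free_lift_single flip: weyl_class_mult)
    also have "\<dots> = weyl_class (Poly_Mapping.single 0 (a * b)) \<otimes>\<^bsub>weyl_algebra\<^esub>
        ?w (monomial_word \<alpha> + monomial_word \<beta>)"
      by (simp only: perm)
    also have "\<dots> = poly_to_weyl (Poly_Mapping.single \<alpha> a) \<otimes>\<^bsub>weyl_algebra\<^esub> poly_to_weyl (Poly_Mapping.single \<beta> b)"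
      by (simp add: poly_to_weyl_lift mult_single free_lift_single flip: weyl_class_mult)
    finally show ?case .
  qed (simp add: distrib_left poly_to_weyl_add weyl.r_distr)
qed (simp add: distrib_right poly_to_weyl_add weyl.l_distr)

lemma poly_to_weyl_const:
  fixes a :: "'a::comm_ring_1"
  shows "poly_to_weyl (mpoly_const a :: ('n::{finite,linorder}, 'a) mpoly) = weyl_class (Poly_Mapping.single 0 a)"
proof -
  have "concat (map (\<lambda>i. replicate (Poly_Mapping.lookup 0 i) (X_gen i)) xs) = []" for xs :: "'n list"
    by (induction xs) auto
  then have "monomial_word (0 :: 'n \<Rightarrow>\<^sub>0 nat) = 0"
    by (simp add: monomial_word_def zero_free_word_def)
  then show ?thesis by (simp add: poly_to_weyl_lift mpoly_const_def free_lift_single)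
qed

lemma poly_to_weyl_one: "poly_to_weyl 1 = \<one>\<^bsub>weyl_algebra\<^esub>"
  using poly_to_weyl_const[of 1] by (simp add: mpoly_const_def weyl_class_one)

lemma poly_to_weyl_zero: "poly_to_weyl 0 = \<zero>\<^bsub>weyl_algebra\<^esub>"
  by (simp add: poly_to_weyl_lift free_lift_def weyl_class_zero)

lemma poly_to_weyl_var: "poly_to_weyl (mpoly_var i) = weyl_class (free_X i)"
proof -
  have "mset (letters (monomial_word (Poly_Mapping.single i 1))) = {#X_gen i#}"
    by (rule multiset_eqI) (auto simp: mset_monomial_word lookup_single when_def split: weyl_gen.split)
  then have "monomial_word (Poly_Mapping.single i 1) = Free_Word [X_gen i]"
    by (cases "monomial_word (Poly_Mapping.single i 1)") simp
  then show ?thesis by (simp add: poly_to_weyl_lift mpoly_var_def free_lift_single free_X_def)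
qed

text \<open>
  The commutator with \<open>\<partial> i\<close> and the partial derivative are both derivations, so it suffices to
  compare them on constants and variables.
\<close>

lemma weyl_leibniz:
  fixes p :: "('n::{finite,linorder}, 'a::comm_ring_1) mpoly"
  shows
  "weyl_class (free_D i) \<otimes>\<^bsub>weyl_algebra\<^esub> poly_to_weyl p =
     poly_to_weyl p \<otimes>\<^bsub>weyl_algebra\<^esub> weyl_class (free_D i) \<oplus>\<^bsub>weyl_algebra\<^esub> poly_to_weyl (partial_deriv i p)"
proof (induction p rule: mpoly_induct)
  case (const a)
  show ?case
    by (simp add: poly_to_weyl_const partial_deriv_const poly_to_weyl_zero free_D_def mult_single
        flip: weyl_class_mult)
next
  case (var j)
  then show ?case
    using weyl_D_X[of i j, where 'b = 'a]
    by (cases "i = j")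
       (simp_all add: poly_to_weyl_var partial_deriv_var poly_to_weyl_zero poly_to_weyl_one weyl_class_one
         weyl_class_mult weyl_class_add)
next
  case (add p q)
  then show ?case
    by (simp add: poly_to_weyl_add partial_deriv_add weyl.l_distr weyl.r_distr weyl.a_ac)
next
  case (mult p q)
  let ?D = "weyl_class (free_D i)"
  have "?D \<otimes>\<^bsub>weyl_algebra\<^esub> poly_to_weyl (p * q) = (?D \<otimes>\<^bsub>weyl_algebra\<^esub> poly_to_weyl p) \<otimes>\<^bsub>weyl_algebra\<^esub> poly_to_weyl q"
    by (simp add: poly_to_weyl_mult weyl.m_assoc)
  also have "\<dots> = poly_to_weyl p \<otimes>\<^bsub>weyl_algebra\<^esub> (?D \<otimes>\<^bsub>weyl_algebra\<^esub> poly_to_weyl q) \<oplus>\<^bsub>weyl_algebra\<^esub>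
      poly_to_weyl (partial_deriv i p) \<otimes>\<^bsub>weyl_algebra\<^esub> poly_to_weyl q"
    by (simp add: mult.IH(1) weyl.l_distr weyl.m_assoc)
  also have "\<dots> = poly_to_weyl (p * q) \<otimes>\<^bsub>weyl_algebra\<^esub> ?D \<oplus>\<^bsub>weyl_algebra\<^esub> poly_to_weyl (partial_deriv i (p * q))"
    by (simp add: mult.IH(2) partial_deriv_mult poly_to_weyl_mult poly_to_weyl_add weyl.r_distr weyl.m_assoc weyl.a_assoc)
  finally show ?case .
qed

section \<open>Modules over the Weyl algebra as polynomial modules with derivations\<close>

lemma abelian_group_cong:
  assumes "abelian_group M" "carrier M = carrier N" "add M = add N" "\<zero>\<^bsub>M\<^esub> = \<zero>\<^bsub>N\<^esub>"
  shows "abelian_group N"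
  using abelian_groupE[OF assms(1)] by (intro abelian_groupI) (simp_all add: assms(2-4))

lemma finsum_cong_group:
  assumes "carrier M = carrier N" "add M = add N" "\<zero>\<^bsub>M\<^esub> = \<zero>\<^bsub>N\<^esub>"
  shows "finsum M f A = finsum N f A"
  by (simp add: finsum_def finprod_def assms)

lemma additive_subgroup_cong:
  assumes "carrier M = carrier N" "add M = add N" "\<zero>\<^bsub>M\<^esub> = \<zero>\<^bsub>N\<^esub>"
  shows "additive_subgroup H M \<longleftrightarrow> additive_subgroup H N"
  by (simp add: additive_subgroup_def subgroup_def m_inv_def assms)

text \<open>
  Spans and independence of components involve the addition only, so that restriction and extension
  of scalars affect no more than the last condition on a grading.
\<close>

lemma graded_change_scalars:
  assumes M: "graded R gR M gM" and N: "left_module S N"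
    and eq: "carrier M = carrier N" "add M = add N" "\<zero>\<^bsub>M\<^esub> = \<zero>\<^bsub>N\<^esub>"
    and deg: "\<And>u v r y. r \<in> gS u \<Longrightarrow> y \<in> gM v \<Longrightarrow> r \<odot>\<^bsub>N\<^esub> y \<in> gM (u + v)"
  shows "graded S gS N gM"
proof -
  interpret M: graded R gR M gM by fact
  interpret N: left_module S N by fact
  have "y \<in> homogeneous_span N gM" if "y \<in> homogeneous_span M gM" for y
    using that
  proof (induction rule: homogeneous_span.induct)
    case (sum x y)
    then show ?case using homogeneous_span.sum[of x N gM y] eq by simp
  qed (rule homogeneous_span.homogeneous)
  moreover have "independent_components N gM"
    using M.independent eq(3) unfolding independent_components_def finsum_cong_group[OF eq] by simp
  moreover have "additive_subgroup (gM u) N" for u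
    using M.component_subgroup additive_subgroup_cong[OF eq] by blast
  ultimately show ?thesis
    using M.spanned eq(1) deg
    by (intro gradedI N) auto
qed

lemma letters_zero: "letters 0 = []"
  by (simp add: zero_free_word_def)

locale poly_module = left_module mpoly_ring N
  for N :: "(('n::{finite,linorder}, 'a::comm_ring_1) mpoly, 'm) module" (structure)
begin

lemma poly_closed [simp]: "y \<in> carrier N \<Longrightarrow> p \<odot> y \<in> carrier N"
  by (simp add: smult_closed)

lemma poly_add_left: "y \<in> carrier N \<Longrightarrow> (p + q) \<odot> y = p \<odot> y \<oplus> q \<odot> y"
  using smult_l_distr[of p q y] by simp

lemma poly_add_right:
  "x \<in> carrier N \<Longrightarrow> y \<in> carrier N \<Longrightarrow> p \<odot> (x \<oplus> y) = p \<odot> x \<oplus> p \<odot> y"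
  by (simp add: smult_r_distr)

lemma poly_mult: "y \<in> carrier N \<Longrightarrow> (p * q) \<odot> y = p \<odot> (q \<odot> y)"
  using smult_assoc[of p q y] by simp

lemma poly_swap: "y \<in> carrier N \<Longrightarrow> p \<odot> (q \<odot> y) = q \<odot> (p \<odot> y)"
  by (simp add: mult.commute flip: poly_mult)

lemma poly_one [simp]: "y \<in> carrier N \<Longrightarrow> 1 \<odot> y = y"
  using smult_one[of y] by simp

lemma poly_zero_left [simp]: "y \<in> carrier N \<Longrightarrow> 0 \<odot> y = \<zero>"
  using smult_zero_left[of y] by simp

lemma poly_zero_right [simp]: "p \<odot> \<zero> = \<zero>"
  by (simp add: smult_zero_right)

lemma poly_minus_left: "y \<in> carrier N \<Longrightarrow> (- p) \<odot> y = \<ominus> (p \<odot> y)"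
  using poly_add_left[of y "- p" p] by (intro M.minus_equality[symmetric]) auto

lemma poly_minus_right: "y \<in> carrier N \<Longrightarrow> p \<odot> (\<ominus> y) = \<ominus> (p \<odot> y)"
  by (simp add: smult_minus_right)

lemma poly_diff_right:
  "x \<in> carrier N \<Longrightarrow> y \<in> carrier N \<Longrightarrow> p \<odot> (x \<ominus> y) = p \<odot> x \<ominus> p \<odot> y"
  by (simp add: M.minus_eq poly_add_right poly_minus_right)

lemma poly_finsum_right:
  "f \<in> A \<rightarrow> carrier N \<Longrightarrow> p \<odot> finsum N f A = (\<Oplus>i\<in>A. p \<odot> f i)"
  using abelian_group_hom.hom_finsum[OF smult_additive, of p f A] by simp

lemma poly_finsum_left:
  assumes "y \<in> carrier N"
  shows "(\<Sum>i\<in>A. f i) \<odot> y = (\<Oplus>i\<in>A. f i \<odot> y)"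
  by (induction A rule: infinite_finite_induct) (use assms in \<open>auto simp: poly_add_left Pi_def\<close>)

end

text \<open>
  A module over the Weyl algebra amounts to a polynomial module with commuting additive operators
  \<open>D i\<close> that satisfy the Leibniz rule. In this form the structure can be verified on fractions by
  calculations with polynomials only.
\<close>

locale derivation_module = poly_module N
  for N :: "(('n::{finite,linorder}, 'a::comm_ring_1) mpoly, 'm) module" (structure) +
  fixes D :: "'n \<Rightarrow> 'm \<Rightarrow> 'm"
  assumes D_closed [simp]: "y \<in> carrier N \<Longrightarrow> D i y \<in> carrier N"
    and D_add: "x \<in> carrier N \<Longrightarrow> y \<in> carrier N \<Longrightarrow> D i (x \<oplus> y) = D i x \<oplus> D i y"
    and D_leibniz: "y \<in> carrier N \<Longrightarrow>
      D i (p \<odot> y) = p \<odot> D i y \<oplus> partial_deriv i p \<odot> y"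
    and D_commute: "y \<in> carrier N \<Longrightarrow> D i (D j y) = D j (D i y)"
begin

abbreviation word_action :: "'n weyl_gen list \<Rightarrow> 'm \<Rightarrow> 'm" where
  "word_action \<equiv> foldr (gen_action N D)"

lemma gen_closed [simp]: "y \<in> carrier N \<Longrightarrow> gen_action N D g y \<in> carrier N"
  by (cases g) auto

lemma word_closed [simp]: "y \<in> carrier N \<Longrightarrow> word_action w y \<in> carrier N"
  by (induction w) auto

lemma word_add:
  "x \<in> carrier N \<Longrightarrow> y \<in> carrier N \<Longrightarrow> word_action w (x \<oplus> y) = word_action w x \<oplus> word_action w y"
proof (induction w)
  case (Cons g w)
  then show ?case by (cases g) (auto simp: poly_add_right D_add)
qed simp

lemma word_const:
  "y \<in> carrier N \<Longrightarrow> word_action w (mpoly_const a \<odot> y) = mpoly_const a \<odot> word_action w y"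
proof (induction w)
  case (Cons g w)
  then show ?case by (cases g) (auto simp: D_leibniz partial_deriv_const poly_swap)
qed simp

abbreviation act :: "('n, 'a) free_weyl \<Rightarrow> 'm \<Rightarrow> 'm" where
  "act \<equiv> free_action N D"

text \<open>
  A common index set makes the actions of different elements of the free algebra comparable.
\<close>

lemma act_superset:
  assumes "y \<in> carrier N" "finite K" "Poly_Mapping.keys f \<subseteq> K"
  shows "act f y = (\<Oplus>w\<in>K. mpoly_const (Poly_Mapping.lookup f w) \<odot> word_action (letters w) y)"
  unfolding free_action_def using assms
  by (intro M.add.finprod_mono_neutral_cong_left) (auto simp: in_keys_iff mpoly_const_def)

lemma act_closed [simp]: "y \<in> carrier N \<Longrightarrow> act f y \<in> carrier N"
  unfolding free_action_def by (intro M.finsum_closed) auto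

lemma act_single: "y \<in> carrier N \<Longrightarrow> act (Poly_Mapping.single w a) y = mpoly_const a \<odot> word_action (letters w) y"
  by (subst act_superset[where K = "{w}"]) auto

lemma act_add_left:
  assumes y: "y \<in> carrier N"
  shows "act (f + g) y = act f y \<oplus> act g y"
proof -
  let ?K = "Poly_Mapping.keys f \<union> Poly_Mapping.keys g"
  have const_add: "mpoly_const (a + b) = mpoly_const a + (mpoly_const b :: ('n, 'a) mpoly)" for a b
    by (simp add: mpoly_const_def single_add)
  have "act (f + g) y = (\<Oplus>w\<in>?K. mpoly_const (Poly_Mapping.lookup f w) \<odot> word_action (letters w) y \<oplus>
      mpoly_const (Poly_Mapping.lookup g w) \<odot> word_action (letters w) y)"
    using y Poly_Mapping.keys_add[of f g]
    by (subst act_superset[where K = ?K]) (auto simp: lookup_add const_add poly_add_left cong: M.finsum_cong)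
  also have "\<dots> = act f y \<oplus> act g y"
    using y by (subst M.add.finprod_multf) (auto simp: act_superset[where K = ?K])
  finally show ?thesis .
qed

lemma act_add_right:
  "x \<in> carrier N \<Longrightarrow> y \<in> carrier N \<Longrightarrow> act f (x \<oplus> y) = act f x \<oplus> act f y"
  unfolding free_action_def
  by (subst M.add.finprod_multf[symmetric]) (auto simp: word_add poly_add_right cong: M.finsum_cong)

lemma act_additive: "abelian_group_hom N N (act f)"
  by (rule additive_mapI[OF M.abelian_group_axioms M.abelian_group_axioms]) (auto simp: act_add_right)

lemma act_mult: "y \<in> carrier N \<Longrightarrow> act (f * g) y = act f (act g y)"
proof (induction f rule: poly_mapping_additive_induct)
  case (single v a)
  then show ?case
  proof (induction g rule: poly_mapping_additive_induct)
    case (single w b)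
    have "mpoly_const (a * b) = mpoly_const a * (mpoly_const b :: ('n, 'a) mpoly)"
      by (simp add: mpoly_const_def mult_single)
    with single show ?case
      by (simp add: mult_single act_single plus_free_word_def poly_mult word_const)
  qed (simp add: distrib_left act_add_left act_add_right)
qed (simp add: distrib_right act_add_left)

lemma act_one: "y \<in> carrier N \<Longrightarrow> act 1 y = y"
  using act_single[of y 0 1] by (simp add: letters_zero mpoly_const_def)

lemma act_zero_left: "y \<in> carrier N \<Longrightarrow> act 0 y = \<zero>"
  by (simp add: free_action_def)

lemma act_minus_left: "y \<in> carrier N \<Longrightarrow> act (- f) y = \<ominus> act f y"
  using act_add_left[of y "- f" f] by (intro M.minus_equality[symmetric]) (auto simp: act_zero_left)

lemma act_diff_left: "y \<in> carrier N \<Longrightarrow> act (f - g) y = act f y \<ominus> act g y"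
  using act_add_left[of y f "- g"] by (simp add: act_minus_left M.minus_eq)

lemma act_X: "y \<in> carrier N \<Longrightarrow> act (free_X i) y = mpoly_var i \<odot> y"
  by (simp add: free_X_def act_single mpoly_const_def)

lemma act_D: "y \<in> carrier N \<Longrightarrow> act (free_D i) y = D i y"
  by (simp add: free_D_def act_single mpoly_const_def)

text \<open>The elements of the free algebra that act by zero form an ideal containing the relations.\<close>

lemma act_weyl_ideal:
  assumes "f \<in> weyl_ideal" "y \<in> carrier N"
  shows "act f y = \<zero>"
proof -
  define K where "K = {f. \<forall>y\<in>carrier N. act f y = \<zero>}"
  have inv: "\<ominus>\<^bsub>ring_of_type_algebra\<^esub> f = - f" for f :: "('n, 'a) free_weyl"
    by (rule abelian_group.minus_equality[OF ring.is_abelian_group[OF ring_of_type_algebra_ring]]) auto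
  have "ideal K ring_of_type_algebra"
  proof (rule idealI[OF ring_of_type_algebra_ring])
    interpret F: ring "ring_of_type_algebra :: ('n, 'a) free_weyl ring"
      by (rule ring_of_type_algebra_ring)
    show "subgroup K (add_monoid ring_of_type_algebra)"
    proof (rule F.add.subgroupI; (simp only: partial_object.simps monoid.simps)?)
      show "K \<noteq> {}" by (auto simp: K_def intro: exI[of _ 0] act_zero_left)
    qed (auto simp: K_def inv act_minus_left act_add_left)
  qed (auto simp: K_def act_mult abelian_group_hom.hom_zero[OF act_additive])
  moreover have "weyl_relations \<subseteq> K"
  proof
    fix f :: "('n, 'a) free_weyl" assume "f \<in> weyl_relations"
    then consider (XX) i j where "f = free_X i * free_X j - free_X j * free_X i"
      | (DD) i j where "f = free_D i * free_D j - free_D j * free_D i"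
      | (DX) i j where "f = free_D i * free_X j - free_X j * free_D i - (if i = j then 1 else 0)"
      unfolding weyl_relations_def by blast
    then show "f \<in> K"
    proof cases
      case XX
      then show ?thesis
        by (auto simp: K_def act_diff_left act_mult act_X poly_swap[of _ "mpoly_var i"] M.minus_eq M.r_neg)
    next
      case DD
      then show ?thesis
        by (auto simp: K_def act_diff_left act_mult act_D D_commute[of _ i] M.minus_eq M.r_neg)
    next
      case DX
      have "act (free_D i * free_X j) y = act (free_X j * free_D i) y \<oplus> act (if i = j then 1 else 0) y"
        if "y \<in> carrier N" for y
        using that by (simp add: act_mult act_D act_X D_leibniz partial_deriv_var act_one act_zero_left)
      then show ?thesis
        unfolding DX K_def by (auto simp: act_diff_left M.minus_eq M.a_ac M.r_neg M.r_neg1)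
    qed
  qed
  ultimately have "weyl_ideal \<subseteq> K"
    unfolding weyl_ideal_def by (rule ring.genideal_minimal[OF ring_of_type_algebra_ring])
  then show ?thesis using assms by (auto simp: K_def)
qed

lemma weyl_extension_simps:
  "carrier (weyl_extension N D) = carrier N" "add (weyl_extension N D) = add N"
  "\<zero>\<^bsub>weyl_extension N D\<^esub> = \<zero>"
  by (simp_all add: weyl_extension_def)

text \<open>
  Any two representatives of a class differ by an element that acts as zero, so the action of the
  class is the action of any of them.
\<close>

lemma weyl_extension_smult:
  assumes y: "y \<in> carrier N"
  shows "weyl_class f \<odot>\<^bsub>weyl_extension N D\<^esub> y = act f y"
proof -
  have "act g y = act f y" if "g \<in> weyl_class f" for g
    using that act_weyl_ideal[of "g - f" y] act_add_left[of y "g - f" f] y by (simp add: mem_weyl_class)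
  moreover have "f \<in> weyl_class f"
    using act_zero_left y ideal.axioms(1)[OF weyl_ideal_ideal] additive_subgroup.zero_closed
    by (fastforce simp: mem_weyl_class)
  ultimately have "(\<lambda>g. act g y) ` weyl_class f = {act f y}" by blast
  then show ?thesis by (simp add: weyl_extension_def)
qed

lemma weyl_extension_module: "left_module weyl_algebra (weyl_extension N D)"
proof (intro left_module.intro left_module_axioms.intro weyl.ring_axioms)
  show "abelian_group (weyl_extension N D)"
    by (rule abelian_group_cong[OF M.abelian_group_axioms]) (simp_all add: weyl_extension_simps)
qed (auto simp: weyl_extension_simps weyl_extension_smult carrier_weyl_algebra act_add_left act_add_right act_mult act_one
    simp flip: weyl_class_add weyl_class_mult weyl_class_one)

lemma weyl_extension_graded:
  assumes N: "graded mpoly_ring poly_grading N gN"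
    and deg: "\<And>i u y. y \<in> gN u \<Longrightarrow> D i y \<in> gN (u - 1)"
  shows "graded weyl_algebra weyl_grading (weyl_extension N D) gN"
proof (rule graded_change_scalars[OF N weyl_extension_module])
  interpret N: graded mpoly_ring poly_grading N gN by fact
  fix u v r y assume r: "(r :: ('n, 'a) weyl) \<in> weyl_grading u" and y: "y \<in> gN v"
  obtain f :: "('n, 'a) free_weyl" where f: "r = weyl_class f" "\<And>w. w \<in> Poly_Mapping.keys f \<Longrightarrow> sum_list (map gen_degree (letters w)) = u"
    using r by (auto simp: weyl_grading_def)
  have gen: "gen_action N D g y \<in> gN (gen_degree g + v)" if "y \<in> gN v" for g y v
  proof (cases g)
    case (X_gen i)
    then show ?thesis using N.smult_degree[OF poly_grading_var that] by simp
  next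
    case (D_gen i)
    then show ?thesis using deg[OF that] by (simp add: algebra_simps)
  qed
  have word: "word_action w y \<in> gN (sum_list (map gen_degree w) + v)" if "y \<in> gN v" for w y v
    using that by (induction w) (auto simp: add.assoc gen)
  have "act f y \<in> gN (u + v)"
    unfolding free_action_def
  proof (rule N.component_finsum)
    fix w assume "w \<in> Poly_Mapping.keys f"
    then show "mpoly_const (Poly_Mapping.lookup f w) \<odot> word_action (letters w) y \<in> gN (u + v)"
      using N.smult_degree[OF poly_grading_const word[OF y]] f(2) by (metis add_0)
  qed
  then show "r \<odot>\<^bsub>weyl_extension N D\<^esub> y \<in> gN (u + v)"
    using N.component_closed[OF y] by (simp add: f weyl_extension_smult)
qed (simp_all add: weyl_extension_simps)

end

text \<open>
  The Weyl algebra is generated by the coefficients, the \<open>X i\<close> and the \<open>\<partial> i\<close>, so linearity over it can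
  be checked on these.
\<close>

lemma free_action_hom:
  assumes "derivation_module N D" "derivation_module N' D'" "abelian_group_hom N N' h"
    and poly: "\<And>p y. y \<in> carrier N \<Longrightarrow> h (p \<odot>\<^bsub>N\<^esub> y) = p \<odot>\<^bsub>N'\<^esub> h y"
    and D: "\<And>i y. y \<in> carrier N \<Longrightarrow> h (D i y) = D' i (h y)"
    and y: "y \<in> carrier N"
  shows "h (free_action N D f y) = free_action N' D' f (h y)"
proof -
  interpret N: derivation_module N D by fact
  interpret N': derivation_module N' D' by fact
  interpret h: abelian_group_hom N N' h by fact
  have word: "h (N.word_action w y) = N'.word_action w (h y)" for w
  proof (induction w)
    case (Cons g w)
    then show ?case using y by (cases g) (auto simp: poly D)
  qed simp
  show ?thesis
    unfolding free_action_def using y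
    by (subst h.hom_finsum) (auto simp: poly word intro!: N'.M.finsum_cong')
qed

section \<open>The polynomial module underlying a module over the Weyl algebra\<close>

lemma restrict_scalars_simps:
  "carrier (restrict_scalars h M) = carrier M" "add (restrict_scalars h M) = add M"
  "\<zero>\<^bsub>restrict_scalars h M\<^esub> = \<zero>\<^bsub>M\<^esub>" "r \<odot>\<^bsub>restrict_scalars h M\<^esub> y = h r \<odot>\<^bsub>M\<^esub> y"
  by (simp_all add: restrict_scalars_def)

locale weyl_module = left_module weyl_algebra L
  for L :: "(('n::{finite,linorder}, 'a::comm_ring_1) weyl, 'l) module"
begin

abbreviation U where "U \<equiv> underlying_module L"

abbreviation DL where "DL \<equiv> \<lambda>i y. weyl_class (free_D i) \<odot>\<^bsub>L\<^esub> y"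

lemma underlying_derivation_module: "derivation_module U DL"
proof (intro derivation_module.intro poly_module.intro left_module.intro left_module_axioms.intro
    ring_of_type_algebra_ring derivation_module_axioms.intro)
  show "abelian_group U"
    by (rule abelian_group_cong[OF M.abelian_group_axioms]) (simp_all add: restrict_scalars_simps)
  show "DL i (p \<odot>\<^bsub>U\<^esub> y) = p \<odot>\<^bsub>U\<^esub> DL i y \<oplus>\<^bsub>U\<^esub> partial_deriv i p \<odot>\<^bsub>U\<^esub> y"
    if "y \<in> carrier U" for y i p
    using that by (simp add: restrict_scalars_simps weyl_leibniz smult_l_distr flip: smult_assoc)
  show "DL i (DL j y) = DL j (DL i y)" if "y \<in> carrier U" for i j y
    using that weyl_D_commute[of i j, where 'b = 'a]
    by (simp add: restrict_scalars_simps weyl_class_mult flip: smult_assoc)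
qed (auto simp: restrict_scalars_simps smult_closed smult_l_distr smult_r_distr smult_assoc smult_one
    poly_to_weyl_add poly_to_weyl_mult poly_to_weyl_one)

sublocale U: derivation_module U DL
  by (rule underlying_derivation_module)

text \<open>
  An action of the Weyl algebra is determined by the polynomials and the \<open>\<partial> i\<close>, so it agrees with
  the one built from them.
\<close>

lemma weyl_class_action:
  assumes "y \<in> carrier L"
  shows "weyl_class f \<odot>\<^bsub>L\<^esub> y = free_action U DL f y"
  using assms
proof (induction f rule: poly_mapping_additive_induct)
  case (single w a)
  have word: "weyl_class (Poly_Mapping.single (Free_Word xs) (1::'a)) \<odot>\<^bsub>L\<^esub> y = U.word_action xs y" for xs
  proof (induction xs)
    case Nil
    have "weyl_class (Poly_Mapping.single (Free_Word []) 1) =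
        (\<one>\<^bsub>weyl_algebra\<^esub> :: ('n, 'a) weyl)"
      using weyl_class_one by (simp flip: zero_free_word_def)
    then show ?case using single smult_one by simp
  next
    case (Cons g xs)
    have "Poly_Mapping.single (Free_Word (g # xs)) (1::'a) =
        Poly_Mapping.single (Free_Word [g]) 1 * Poly_Mapping.single (Free_Word xs) 1"
      by (simp add: mult_single plus_free_word_def)
    then have "weyl_class (Poly_Mapping.single (Free_Word (g # xs)) 1) \<odot>\<^bsub>L\<^esub> y =
        weyl_class (Poly_Mapping.single (Free_Word [g]) 1) \<odot>\<^bsub>L\<^esub> U.word_action xs y"
      using single by (simp add: weyl_class_mult smult_assoc Cons)
    then show ?case
      by (cases g) (simp_all add: restrict_scalars_simps poly_to_weyl_var free_X_def free_D_def)
  qed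
  have "weyl_class (Poly_Mapping.single w a) =
      poly_to_weyl (mpoly_const a) \<otimes>\<^bsub>weyl_algebra\<^esub> weyl_class (Poly_Mapping.single w 1)"
    by (simp add: poly_to_weyl_const mult_single flip: weyl_class_mult)
  then show ?case
    using single word[of "letters w"] by (simp add: U.act_single smult_assoc restrict_scalars_simps)
next
  case (add f g)
  then show ?case
    by (simp add: weyl_class_add smult_l_distr U.act_add_left restrict_scalars_simps)
qed

end

lemma monomial_word_degree: "sum_list (map gen_degree (letters (monomial_word \<alpha>))) = monomial_degree \<alpha>"
proof -
  have "sum_list (map gen_degree (concat (map (\<lambda>i. replicate (Poly_Mapping.lookup \<alpha> i) (X_gen i)) xs))) =
      (\<Sum>i\<leftarrow>xs. int (Poly_Mapping.lookup \<alpha> i))" for xs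
    by (induction xs) (simp_all add: sum_list_replicate)
  then show ?thesis
    by (simp add: monomial_word_def monomial_degree_def sum_list_distinct_conv_sum_set)
qed

lemma poly_to_weyl_grading:
  assumes "p \<in> poly_grading u"
  shows "poly_to_weyl p \<in> weyl_grading u"
proof -
  have "Poly_Mapping.keys (free_lift p) \<subseteq> monomial_word ` Poly_Mapping.keys p"
    unfolding free_lift_def by (rule order_trans[OF keys_sum]) auto
  then have "\<forall>w\<in>Poly_Mapping.keys (free_lift p). sum_list (map gen_degree (letters w)) = u"
    using assms by (auto simp: poly_grading_iff monomial_word_degree)
  then show ?thesis unfolding weyl_grading_def poly_to_weyl_lift by blast
qed

lemma D_weyl_grading: "weyl_class (free_D i) \<in> weyl_grading (- 1)"
  unfolding weyl_grading_def by (rule imageI) (simp add: free_D_def)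

lemma weyl_grading_closed: "weyl_grading u \<subseteq> carrier weyl_algebra"
  by (auto simp: weyl_grading_def)

lemma underlying_graded:
  assumes "graded weyl_algebra weyl_grading L gL"
  shows "graded mpoly_ring poly_grading (underlying_module L) gL"
proof -
  interpret L: graded weyl_algebra weyl_grading L gL by fact
  interpret weyl_module L by (rule weyl_module.intro, rule L.left_module_axioms)
  show ?thesis
    by (rule graded_change_scalars[OF assms U.left_module_axioms])
       (auto simp: restrict_scalars_simps intro: L.smult_degree poly_to_weyl_grading)
qed

section \<open>The Euler operator\<close>

text \<open>
  A representative of \<open>E - u\<close> in the free algebra, where \<open>E\<close> is the Euler operator.
\<close>

definition euler_shift :: "int \<Rightarrow> ('n::finite, 'a::comm_ring_1) free_weyl" where
  "euler_shift u = (\<Sum>i\<in>UNIV. free_X i * free_D i) - of_int u"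

lemma euler_shift_class:
  "((euler :: ('n::finite, 'a::comm_ring_1) weyl) \<ominus>\<^bsub>weyl_algebra\<^esub> add_pow weyl_algebra (u::int) \<one>\<^bsub>weyl_algebra\<^esub>) [^]\<^bsub>weyl_algebra\<^esub> (a::nat) =
     weyl_class (euler_shift u ^ a)"
proof -
  have "abelian_group_hom ring_of_type_algebra weyl_algebra
      (weyl_class :: ('n, 'a) free_weyl \<Rightarrow> _)"
    by (rule additive_mapI[OF ring.is_abelian_group[OF ring_of_type_algebra_ring] weyl.is_abelian_group])
       (auto simp: weyl_class_add)
  from abelian_group_hom.hom_add_pow_int[OF this, of 1 u]
  have 1: "add_pow weyl_algebra u \<one>\<^bsub>weyl_algebra\<^esub> =
      weyl_class (add_pow ring_of_type_algebra u (1 :: ('n, 'a) free_weyl))"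
    by (simp add: weyl_class_one)
  interpret F: ring "ring_of_type_algebra :: ('n, 'a) free_weyl ring" by (rule ring_of_type_algebra_ring)
  have nat: "add_pow ring_of_type_algebra (k::nat) (1 :: ('n, 'a) free_weyl) = of_nat k" for k
    by (induction k) (simp_all add: F.add.nat_pow_Suc)
  have inv: "\<ominus>\<^bsub>ring_of_type_algebra\<^esub> f = - f" for f :: "('n, 'a) free_weyl"
    by (rule F.minus_equality) auto
  have "add_pow ring_of_type_algebra u (1 :: ('n, 'a) free_weyl) = of_int u"
    by (cases "u \<ge> 0") (simp_all add: add_pow_int_ge add_pow_int_lt nat inv)
  with 1 have "(euler :: ('n, 'a) weyl) \<ominus>\<^bsub>weyl_algebra\<^esub> add_pow weyl_algebra u \<one>\<^bsub>weyl_algebra\<^esub> = weyl_class (euler_shift u)"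
    by (simp add: euler_def euler_shift_def weyl_class_diff)
  moreover have "weyl_class f [^]\<^bsub>weyl_algebra\<^esub> a = weyl_class (f ^ a)" for f :: "('n, 'a) free_weyl"
    by (induction a) (simp_all add: weyl_class_one weyl_class_mult power_Suc2 del: power_Suc)
  ultimately show ?thesis by simp
qed

lemma generalized_eulerian_iff:
  "generalized_eulerian M gM \<longleftrightarrow> graded weyl_algebra weyl_grading M gM \<and>
     (\<forall>u. \<forall>y\<in>gM u. \<exists>a>0. weyl_class (euler_shift u ^ a) \<odot>\<^bsub>M\<^esub> y = \<zero>\<^bsub>M\<^esub>)"
  unfolding generalized_eulerian_def graded_module_iff_graded euler_shift_class by blast

lemma (in derivation_module) act_euler_shift:
  assumes "y \<in> carrier N"
  shows "act (euler_shift u) y =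
    (\<Oplus>i\<in>UNIV. mpoly_var i \<odot> D i y) \<ominus> of_int u \<odot> y"
proof -
  have "act (\<Sum>i\<in>A. free_X i * free_D i) y = (\<Oplus>i\<in>A. mpoly_var i \<odot> D i y)" for A
    using assms
    by (induction A rule: infinite_finite_induct) (auto simp: act_zero_left act_add_left act_mult act_X act_D Pi_def)
  moreover have "act (of_int u) y = of_int u \<odot> y"
  proof -
    have "act (Poly_Mapping.single (Free_Word []) (of_int u)) y = mpoly_const (of_int u) \<odot> y"
      using assms by (simp add: act_single)
    then show ?thesis by (simp add: mpoly_const_def flip: zero_free_word_def)
  qed
  ultimately show ?thesis using assms by (simp add: euler_shift_def act_diff_left)
qed

text \<open>
  Annihilation by a power passes to all higher powers; this allows a common exponent for finitely
  many elements.
\<close>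

lemma (in weyl_module) euler_shift_power_mono:
  assumes "weyl_class (f ^ a) \<odot>\<^bsub>L\<^esub> y = \<zero>\<^bsub>L\<^esub>" "a \<le> b" "y \<in> carrier L"
  shows "weyl_class (f ^ b) \<odot>\<^bsub>L\<^esub> y = \<zero>\<^bsub>L\<^esub>"
proof -
  have "f ^ b = f ^ (b - a) * f ^ a" using assms(2) by (simp flip: power_add)
  then show ?thesis using assms by (simp add: weyl_class_mult smult_assoc smult_zero_right)
qed


section \<open>Localization of polynomial modules\<close>

locale localized_module = poly_module N
  for N :: "(('n::{finite,linorder}, 'a::comm_ring_1) mpoly, 'm) module" (structure) +
  fixes S :: "('n, 'a) mpoly set"
  assumes one_mem [simp]: "1 \<in> S" and mult_mem [simp]: "s \<in> S \<Longrightarrow> t \<in> S \<Longrightarrow> s * t \<in> S"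
begin

abbreviation fr where "fr \<equiv> fraction S N"

abbreviation Q where "Q \<equiv> localization S N"

lemma mem_fraction:
  "(z, r) \<in> fr y s \<longleftrightarrow> z \<in> carrier N \<and> r \<in> S \<and> (\<exists>t\<in>S. (t * r) \<odot> y = (t * s) \<odot> z)"
  by (simp add: fraction_def)

text \<open>
  Equality of fractions is transitive: the product of the two witnesses and of the
  middle denominator is a witness.
\<close>

lemma fraction_subset:
  assumes y: "y \<in> carrier N" "s \<in> S" and y': "y' \<in> carrier N" "s' \<in> S" and t0: "t0 \<in> S"
    and eq: "(t0 * s') \<odot> y = (t0 * s) \<odot> y'"
  shows "fr y s \<subseteq> fr y' s'"
proof (rule subrelI)
  fix z r assume "(z, r) \<in> fr y s"
  then obtain t where z: "z \<in> carrier N" "r \<in> S" and t: "t \<in> S" "(t * r) \<odot> y = (t * s) \<odot> z"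
    unfolding mem_fraction by blast
  have "(t * t0 * s * r) \<odot> y' = (t * r) \<odot> ((t0 * s) \<odot> y')"
    using y' by (simp add: ac_simps flip: poly_mult)
  also have "\<dots> = (t0 * s') \<odot> ((t * r) \<odot> y)"
    using y by (simp only: eq[symmetric] poly_swap[of y])
  also have "\<dots> = (t * t0 * s * s') \<odot> z"
    unfolding t(2) using z by (simp add: ac_simps flip: poly_mult)
  finally show "(z, r) \<in> fr y' s'"
    unfolding mem_fraction using z t t0 y by (intro conjI bexI[of _ "t * t0 * s"]) auto
qed

lemma fraction_eq_iff:
  assumes y: "y \<in> carrier N" "s \<in> S" and y': "y' \<in> carrier N" "s' \<in> S"
  shows "fr y s = fr y' s' \<longleftrightarrow> (\<exists>t\<in>S. (t * s') \<odot> y = (t * s) \<odot> y')"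
proof
  assume "fr y s = fr y' s'"
  moreover have "(y', s') \<in> fr y' s'"
    unfolding mem_fraction using y' by (auto intro: bexI[of _ 1])
  ultimately show "\<exists>t\<in>S. (t * s') \<odot> y = (t * s) \<odot> y'"
    using mem_fraction by blast
next
  assume "\<exists>t\<in>S. (t * s') \<odot> y = (t * s) \<odot> y'"
  then obtain t where "t \<in> S" "(t * s') \<odot> y = (t * s) \<odot> y'" by blast
  then show "fr y s = fr y' s'"
    using fraction_subset[OF y y'] fraction_subset[OF y' y] by force
qed

lemma fraction_cancel:
  "y \<in> carrier N \<Longrightarrow> s \<in> S \<Longrightarrow> t \<in> S \<Longrightarrow> fr (t \<odot> y) (t * s) = fr y s"
  by (subst fraction_eq_iff) (auto intro!: bexI[of _ 1] simp: ac_simps simp flip: poly_mult)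

text \<open>
  The operations on fractions are unions over all representatives. This reduces the computation of
  such a union to the independence of its members from the representative.
\<close>

lemma UN_fraction:
  assumes y: "y \<in> carrier N" "s \<in> S"
    and F: "\<And>z r. z \<in> carrier N \<Longrightarrow> r \<in> S \<Longrightarrow> fr z r = fr y s \<Longrightarrow> F z r = F y s"
  shows "(\<Union>(z, r)\<in>fr y s. F z r) = F y s"
proof -
  have "F z r = F y s" if "(z, r) \<in> fr y s" for z r
  proof -
    have zr: "z \<in> carrier N" "r \<in> S" using that by (auto simp: mem_fraction)
    moreover have "fr z r = fr y s"
      using that fraction_eq_iff[OF y zr] by (simp add: mem_fraction)
    ultimately show ?thesis by (rule F)
  qed
  moreover have "(y, s) \<in> fr y s"
    unfolding mem_fraction using y by (auto intro: bexI[of _ 1])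
  ultimately show ?thesis by fast
qed

lemma carrier_localization: "carrier Q = {fr y s | y s. y \<in> carrier N \<and> s \<in> S}"
  by (simp add: localization_def)

lemma localizationE:
  assumes "P \<in> carrier Q"
  obtains y s where "y \<in> carrier N" "s \<in> S" "P = fr y s"
  using assms unfolding carrier_localization by blast

lemma fraction_closed [simp]: "y \<in> carrier N \<Longrightarrow> s \<in> S \<Longrightarrow> fr y s \<in> carrier Q"
  unfolding carrier_localization by blast

lemma localization_zero: "\<zero>\<^bsub>Q\<^esub> = fr \<zero> 1"
  by (simp add: localization_def)

lemma fraction_zero [simp]: "s \<in> S \<Longrightarrow> fr \<zero> s = \<zero>\<^bsub>Q\<^esub>"
  unfolding localization_zero by (subst fraction_eq_iff) (auto intro!: bexI[of _ 1])

lemma localization_smult: 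
  assumes "y \<in> carrier N" "s \<in> S"
  shows "p \<odot>\<^bsub>Q\<^esub> fr y s = fr (p \<odot> y) s"
proof -
  have "fr (p \<odot> z) r = fr (p \<odot> y) s" if zr: "z \<in> carrier N" "r \<in> S" "fr z r = fr y s" for z r
  proof -
    obtain t where t: "t \<in> S" "(t * s) \<odot> z = (t * r) \<odot> y"
      using zr assms fraction_eq_iff by blast
    have "(t * s) \<odot> (p \<odot> z) = p \<odot> ((t * s) \<odot> z)"
      using zr(1) by (rule poly_swap)
    also have "\<dots> = (t * r) \<odot> (p \<odot> y)"
      unfolding t(2) using assms(1) by (rule poly_swap)
    finally show ?thesis
      using zr assms t(1) by (subst fraction_eq_iff) auto
  qed
  then have "(\<Union>(z, r)\<in>fr y s. fr (p \<odot> z) r) = fr (p \<odot> y) s"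
    by (rule UN_fraction[OF assms])
  moreover have "p \<odot>\<^bsub>Q\<^esub> fr y s = (\<Union>(z, r)\<in>fr y s. fr (p \<odot> z) r)"
    by (simp only: localization_def module.simps)
  ultimately show ?thesis by (rule trans[rotated])
qed

lemma localization_add:
  assumes y: "y \<in> carrier N" "s \<in> S" and y': "y' \<in> carrier N" "s' \<in> S"
  shows "fr y s \<oplus>\<^bsub>Q\<^esub> fr y' s' = fr (s' \<odot> y \<oplus> s \<odot> y') (s * s')"
proof -
  let ?F = "\<lambda>z r z' r'. fr (r' \<odot> z \<oplus> r \<odot> z') (r * r')"
  have wd: "?F z r z' r' = ?F x q x' q'"
    if z: "z \<in> carrier N" "r \<in> S" "z' \<in> carrier N" "r' \<in> S"
      and x: "x \<in> carrier N" "q \<in> S" "x' \<in> carrier N" "q' \<in> S"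
      and eq: "fr z r = fr x q" "fr z' r' = fr x' q'" for z r z' r' x q x' q'
  proof -
    obtain t where t: "t \<in> S" "(t * q) \<odot> z = (t * r) \<odot> x"
      using z x eq fraction_eq_iff by blast
    obtain t' where t': "t' \<in> S" "(t' * q') \<odot> z' = (t' * r') \<odot> x'"
      using z x eq fraction_eq_iff by blast
    have 1: "(t * t' * (q * q') * r') \<odot> z = (t * t' * (r * r') * q') \<odot> x"
    proof -
      have "(t * t' * (q * q') * r') \<odot> z = (t' * q' * r') \<odot> ((t * q) \<odot> z)"
        using z by (simp add: ac_simps flip: poly_mult)
      also have "\<dots> = (t * t' * (r * r') * q') \<odot> x"
        unfolding t(2) using x by (simp add: ac_simps flip: poly_mult)
      finally show ?thesis .
    qed
    have 2: "(t * t' * (q * q') * r) \<odot> z' = (t * t' * (r * r') * q) \<odot> x'"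
    proof -
      have "(t * t' * (q * q') * r) \<odot> z' = (t * q * r) \<odot> ((t' * q') \<odot> z')"
        using z by (simp add: ac_simps flip: poly_mult)
      also have "\<dots> = (t * t' * (r * r') * q) \<odot> x'"
        unfolding t'(2) using x by (simp add: ac_simps flip: poly_mult)
      finally show ?thesis .
    qed
    have "(t * t' * (q * q')) \<odot> (r' \<odot> z \<oplus> r \<odot> z') =
        (t * t' * (r * r')) \<odot> (q' \<odot> x \<oplus> q \<odot> x')"
      using z x 1 2 by (simp add: poly_add_right flip: poly_mult)
    then show ?thesis
      using z x t(1) t'(1) by (subst fraction_eq_iff) (auto intro!: bexI[of _ "t * t'"])
  qed
  have inner: "(\<Union>(z', r')\<in>fr y' s'. ?F z r z' r') = ?F z r y' s'" if "z \<in> carrier N" "r \<in> S" for z r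
    by (rule UN_fraction[OF y']) (use that y' in \<open>intro wd; simp\<close>)
  have "fr y s \<oplus>\<^bsub>Q\<^esub> fr y' s' = (\<Union>(z, r)\<in>fr y s. \<Union>(z', r')\<in>fr y' s'. ?F z r z' r')"
    by (simp only: localization_def ring.simps)
  also have "\<dots> = (\<Union>(z', r')\<in>fr y' s'. ?F y s z' r')"
    by (rule UN_fraction[OF y]) (simp only: inner y, rule wd, use y y' in auto)
  also have "\<dots> = ?F y s y' s'" by (rule inner[OF y])
  finally show ?thesis .
qed

lemma localization_add_same:
  assumes "y \<in> carrier N" "y' \<in> carrier N" "s \<in> S"
  shows "fr y s \<oplus>\<^bsub>Q\<^esub> fr y' s = fr (y \<oplus> y') s"
  using assms by (simp add: localization_add fraction_cancel flip: poly_add_right)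

lemma common_denominator:
  assumes "P \<in> carrier Q" "P' \<in> carrier Q"
  obtains y y' s where "y \<in> carrier N" "y' \<in> carrier N" "s \<in> S" "P = fr y s" "P' = fr y' s"
proof -
  obtain y s where y: "y \<in> carrier N" "s \<in> S" "P = fr y s" using assms(1) by (rule localizationE)
  obtain y' s' where y': "y' \<in> carrier N" "s' \<in> S" "P' = fr y' s'" using assms(2) by (rule localizationE)
  have "P = fr (s' \<odot> y) (s * s')" "P' = fr (s \<odot> y') (s * s')"
    using y y' fraction_cancel[of y s s'] fraction_cancel[of y' s' s] by (simp_all add: mult.commute)
  with y y' show ?thesis by (intro that[of "s' \<odot> y" "s \<odot> y'" "s * s'"]) auto
qed

lemma localization_group: "abelian_group Q"
proof (rule abelian_groupI)
  have assoc: "fr a d \<oplus>\<^bsub>Q\<^esub> fr b d \<oplus>\<^bsub>Q\<^esub> fr c d = fr a d \<oplus>\<^bsub>Q\<^esub> (fr b d \<oplus>\<^bsub>Q\<^esub> fr c d)"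
    if "a \<in> carrier N" "b \<in> carrier N" "c \<in> carrier N" "d \<in> S" for a b c d
    using that by (simp add: localization_add_same M.a_assoc)
  fix P P' assume PP: "P \<in> carrier Q" "P' \<in> carrier Q"
  then obtain y y' s where *: "y \<in> carrier N" "y' \<in> carrier N" "s \<in> S" "P = fr y s" "P' = fr y' s"
    by (rule common_denominator)
  then show "P \<oplus>\<^bsub>Q\<^esub> P' \<in> carrier Q" "P \<oplus>\<^bsub>Q\<^esub> P' = P' \<oplus>\<^bsub>Q\<^esub> P"
    by (simp_all add: localization_add_same M.a_comm)
  fix P'' assume "P'' \<in> carrier Q"
  then obtain y'' s'' where **: "y'' \<in> carrier N" "s'' \<in> S" "P'' = fr y'' s''"
    by (rule localizationE)
  have eqs: "P = fr (s'' \<odot> y) (s'' * s)" "P' = fr (s'' \<odot> y') (s'' * s)" "P'' = fr (s \<odot> y'') (s'' * s)"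
    using * ** fraction_cancel[of y'' s'' s] by (simp_all add: fraction_cancel mult.commute)
  show "P \<oplus>\<^bsub>Q\<^esub> P' \<oplus>\<^bsub>Q\<^esub> P'' = P \<oplus>\<^bsub>Q\<^esub> (P' \<oplus>\<^bsub>Q\<^esub> P'')"
    unfolding eqs by (intro assoc mult_mem poly_closed; fact)
next
  show "\<zero>\<^bsub>Q\<^esub> \<in> carrier Q" using fraction_closed[of "\<zero>" 1] by simp
next
  fix P assume "P \<in> carrier Q"
  then obtain y s where y: "y \<in> carrier N" "s \<in> S" "P = fr y s" by (rule localizationE)
  show "\<zero>\<^bsub>Q\<^esub> \<oplus>\<^bsub>Q\<^esub> P = P"
    using y localization_add_same[of "\<zero>" y s] by simp
  have "fr (\<ominus> y) s \<oplus>\<^bsub>Q\<^esub> P = \<zero>\<^bsub>Q\<^esub>"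
    using y by (simp add: localization_add_same M.l_neg)
  then show "\<exists>P'\<in>carrier Q. P' \<oplus>\<^bsub>Q\<^esub> P = \<zero>\<^bsub>Q\<^esub>" using y by auto
qed

lemma localization_left_module: "left_module mpoly_ring Q"
proof (intro left_module.intro left_module_axioms.intro ring_of_type_algebra_ring localization_group)
  fix p q P assume "P \<in> carrier Q"
  then obtain y s where y: "y \<in> carrier N" "s \<in> S" "P = fr y s" by (rule localizationE)
  show "p \<odot>\<^bsub>Q\<^esub> P \<in> carrier Q" "(p \<oplus>\<^bsub>mpoly_ring\<^esub> q) \<odot>\<^bsub>Q\<^esub> P = p \<odot>\<^bsub>Q\<^esub> P \<oplus>\<^bsub>Q\<^esub> q \<odot>\<^bsub>Q\<^esub> P"
    "(p \<otimes>\<^bsub>mpoly_ring\<^esub> q) \<odot>\<^bsub>Q\<^esub> P = p \<odot>\<^bsub>Q\<^esub> (q \<odot>\<^bsub>Q\<^esub> P)" "\<one>\<^bsub>mpoly_ring\<^esub> \<odot>\<^bsub>Q\<^esub> P = P"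
    using y by (simp_all add: localization_smult localization_add_same poly_add_left poly_mult)
  fix P' assume "P' \<in> carrier Q"
  with \<open>P \<in> carrier Q\<close> obtain y y' s
    where "y \<in> carrier N" "y' \<in> carrier N" "s \<in> S" "P = fr y s" "P' = fr y' s"
    by (rule common_denominator)
  then show "p \<odot>\<^bsub>Q\<^esub> (P \<oplus>\<^bsub>Q\<^esub> P') = p \<odot>\<^bsub>Q\<^esub> P \<oplus>\<^bsub>Q\<^esub> p \<odot>\<^bsub>Q\<^esub> P'"
    by (simp add: localization_smult localization_add_same poly_add_right)
qed

sublocale Q: poly_module Q
  by (intro poly_module.intro localization_left_module)

lemma fraction_hom: "s \<in> S \<Longrightarrow> abelian_group_hom N Q (\<lambda>y. fr y s)"
  by (rule additive_mapI[OF M.abelian_group_axioms localization_group])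
     (auto simp: localization_add_same)

lemma fraction_minus: "y \<in> carrier N \<Longrightarrow> s \<in> S \<Longrightarrow> \<ominus>\<^bsub>Q\<^esub> fr y s = fr (\<ominus> y) s"
  using abelian_group_hom.hom_a_inv[OF fraction_hom] by simp

lemma fraction_diff:
  "y \<in> carrier N \<Longrightarrow> y' \<in> carrier N \<Longrightarrow> s \<in> S \<Longrightarrow> fr (y \<ominus> y') s = fr y s \<ominus>\<^bsub>Q\<^esub> fr y' s"
  by (simp add: M.minus_eq Q.M.minus_eq fraction_minus localization_add_same)

lemma fraction_eq_zero_iff:
  assumes "y \<in> carrier N" "s \<in> S"
  shows "fr y s = \<zero>\<^bsub>Q\<^esub> \<longleftrightarrow> (\<exists>t\<in>S. t \<odot> y = \<zero>)"
  unfolding localization_zero using assms by (subst fraction_eq_iff) auto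

text \<open>
  Identities between fractions may therefore be checked after multiplication by an element of \<open>S\<close>;
  this is how the properties of the quotient rule are derived.
\<close>

lemma smult_injective:
  assumes "s \<in> S" "P \<in> carrier Q" "P' \<in> carrier Q" "s \<odot>\<^bsub>Q\<^esub> P = s \<odot>\<^bsub>Q\<^esub> P'"
  shows "P = P'"
proof -
  obtain y y' r where y: "y \<in> carrier N" "y' \<in> carrier N" "r \<in> S" "P = fr y r" "P' = fr y' r"
    using assms(2,3) by (rule common_denominator)
  have "s \<odot>\<^bsub>Q\<^esub> fr z r = fr z r'" if "z \<in> carrier N" "r = s * r'" "r' \<in> S" for z r'
    using that assms(1) by (simp add: localization_smult fraction_cancel)
  obtain t where "t \<in> S" "(t * r) \<odot> (s \<odot> y) = (t * r) \<odot> (s \<odot> y')"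
    using assms y by (auto simp: localization_smult fraction_eq_iff)
  then show ?thesis
    using y assms(1)
    by (subst y(4), subst y(5), subst fraction_eq_iff)
       (auto intro!: bexI[of _ "t * s"] simp: ac_simps simp flip: poly_mult)
qed

end

locale homogeneous_localization = localized_module N S + N: graded mpoly_ring poly_grading N gN
  for N :: "(('n::{finite,linorder}, 'a::comm_ring_1) mpoly, 'm) module" (structure)
    and S :: "('n, 'a) mpoly set" and gN +
  assumes homogeneous_mem: "s \<in> S \<Longrightarrow> \<exists>v. s \<in> poly_grading v"
begin

abbreviation gQ where "gQ \<equiv> localization_grading S N gN"

lemma fraction_degree:
  "s \<in> S \<Longrightarrow> s \<in> poly_grading v \<Longrightarrow> y \<in> gN (u + v) \<Longrightarrow> fr y s \<in> gQ u"
  unfolding localization_grading_def by blast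

lemma localization_gradingE:
  assumes "P \<in> gQ u"
  obtains y s v where "s \<in> S" "s \<in> poly_grading v" "y \<in> gN (u + v)" "y \<in> carrier N" "P = fr y s"
  using assms N.component_closed unfolding localization_grading_def by blast

lemma smult_shift: "s \<in> poly_grading a \<Longrightarrow> y \<in> gN b \<Longrightarrow> c = a + b \<Longrightarrow> s \<odot> y \<in> gN c"
  using N.smult_degree by blast

text \<open>
  The common denominator is a product of homogeneous elements of \<open>S\<close>, so the numerators are again
  homogeneous, with all degrees shifted by the same amount.
\<close>

lemma homogeneous_common_denominator:
  assumes "finite F" "\<And>u. u \<in> F \<Longrightarrow> f u \<in> gQ u"
  shows "\<exists>s v z. s \<in> S \<and> s \<in> poly_grading v \<and> (\<forall>u\<in>F. z u \<in> gN (u + v) \<and> f u = fr (z u) s)"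
  using assms
proof (induction F)
  case empty
  show ?case using one_mem poly_grading_one by blast
next
  case (insert u0 F)
  then have "\<exists>s v z. s \<in> S \<and> s \<in> poly_grading v \<and> (\<forall>u\<in>F. z u \<in> gN (u + v) \<and> f u = fr (z u) s)"
    by simp
  then obtain s v z where s: "s \<in> S" "s \<in> poly_grading v"
    and z: "\<And>u. u \<in> F \<Longrightarrow> z u \<in> gN (u + v) \<and> f u = fr (z u) s"
    by blast
  have "f u0 \<in> gQ u0" using insert.prems by simp
  then obtain y s' v' where y: "s' \<in> S" "s' \<in> poly_grading v'" "y \<in> gN (u0 + v')" "y \<in> carrier N" "f u0 = fr y s'"
    by (rule localization_gradingE)
  let ?z = "\<lambda>u. if u = u0 then s \<odot> y else s' \<odot> z u"
  have "?z u \<in> gN (u + (v + v')) \<and> f u = fr (?z u) (s * s')" if "u \<in> insert u0 F" for u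
  proof (cases "u = u0")
    case True
    then show ?thesis using s y by (auto simp: fraction_cancel intro: smult_shift)
  next
    case False
    with that z have u: "z u \<in> gN (u + v)" "f u = fr (z u) s" by auto
    then have "f u = fr (s' \<odot> z u) (s * s')"
      using fraction_cancel[of "z u" s s'] s y N.component_closed[OF u(1)] by (simp add: mult.commute)
    with u False y show ?thesis by (auto intro: smult_shift)
  qed
  moreover have "s * s' \<in> S" "s * s' \<in> poly_grading (v + v')"
    using s y by (auto intro: poly_grading_mult)
  ultimately show ?case
    by (intro exI[of _ "s * s'"] exI[of _ "v + v'"] exI[of _ ?z] conjI ballI) blast+
qed

text \<open>
  If a sum of homogeneous fractions with common denominator vanishes, then a homogeneous element of
  \<open>S\<close> annihilates the sum of the numerators. These have different degrees, so it annihilates each of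
  them, and every fraction is zero.
\<close>

lemma localization_graded: "graded mpoly_ring poly_grading Q gQ"
proof (intro gradedI localization_left_module)
  show "additive_subgroup (gQ u) Q" for u
  proof (intro additive_subgroupI Q.M.add.subgroupI; (simp only: partial_object.simps monoid.simps)?)
    show "gQ u \<subseteq> carrier Q" by (auto elim!: localization_gradingE)
    show "gQ u \<noteq> {}" using fraction_degree[OF one_mem poly_grading_one, of "\<zero>" u] by auto
  next
    fix P assume "P \<in> gQ u"
    then show "\<ominus>\<^bsub>Q\<^esub> P \<in> gQ u"
      by (elim localization_gradingE) (auto simp: fraction_minus intro: fraction_degree N.component_minus)
  next
    fix P P' assume "P \<in> gQ u" "P' \<in> gQ u"
    then obtain y s v y' s' v' where *: "s \<in> S" "s \<in> poly_grading v" "y \<in> gN (u + v)" "y \<in> carrier N" "P = fr y s"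
      "s' \<in> S" "s' \<in> poly_grading v'" "y' \<in> gN (u + v')" "y' \<in> carrier N" "P' = fr y' s'"
      by (elim localization_gradingE) blast
    then have "s' \<odot> y \<oplus> s \<odot> y' \<in> gN (u + (v + v'))"
      by (intro N.component_add) (auto intro: smult_shift)
    moreover have "s * s' \<in> poly_grading (v + v')" using * by (auto intro: poly_grading_mult)
    ultimately show "P \<oplus>\<^bsub>Q\<^esub> P' \<in> gQ u"
      using * fraction_degree[of "s * s'"] by (simp add: localization_add)
  qed
next
  show "carrier Q \<subseteq> homogeneous_span Q gQ"
  proof
    fix P assume "P \<in> carrier Q"
    then obtain y s where y: "y \<in> carrier N" "s \<in> S" "P = fr y s" by (rule localizationE)
    obtain v where v: "s \<in> poly_grading v" using homogeneous_mem y by blast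
    have "fr z s \<in> homogeneous_span Q gQ" if "z \<in> homogeneous_span N gN" for z
      using that
    proof (induction rule: homogeneous_span.induct)
      case (homogeneous z w)
      then have "fr z s \<in> gQ (w - v)" using y v by (auto intro: fraction_degree)
      then show ?case by (rule homogeneous_span.homogeneous)
    next
      case (sum x z)
      then show ?case
        using homogeneous_span.sum[of "fr x s" Q gQ "fr z s"] y N.span_closed
        by (simp add: localization_add_same)
    qed
    then show "P \<in> homogeneous_span Q gQ" using y N.spanned by blast
  qed
next
  show "independent_components Q gQ"
    unfolding independent_components_def
  proof (intro allI impI ballI)
    fix F f u assume F: "finite F" "\<forall>u\<in>F. f u \<in> gQ u" "finsum Q f F = \<zero>\<^bsub>Q\<^esub>" "u \<in> F"
    then obtain s v z where s: "s \<in> S" "s \<in> poly_grading v"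
      and z: "\<And>u. u \<in> F \<Longrightarrow> z u \<in> gN (u + v)" "\<And>u. u \<in> F \<Longrightarrow> f u = fr (z u) s"
      using homogeneous_common_denominator[of F f] by blast
    have zN: "z \<in> F \<rightarrow> carrier N" using z(1) N.component_closed by blast
    have "finsum Q f F = finsum Q (\<lambda>u. fr (z u) s) F"
      using z(2) N.component_closed[OF z(1)] s(1) by (intro Q.M.finsum_cong') auto
    also have "\<dots> = fr (finsum N z F) s"
      using abelian_group_hom.hom_finsum[OF fraction_hom[OF s(1)] zN] by simp
    finally obtain t where t: "t \<in> S" "t \<odot> finsum N z F = \<zero>"
      using F(3) fraction_eq_zero_iff[of "finsum N z F" s] s zN by auto
    obtain w where w: "t \<in> poly_grading w" using homogeneous_mem t by blast
    have "t \<odot> z u = \<zero>"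
      by (rule N.independent_reindex[OF N.independent F(1), of "\<lambda>u. w + (u + v)"])
         (use t zN z(1) w F(4) in \<open>auto simp: inj_on_def poly_finsum_right intro: smult_shift\<close>)
    moreover have "z u \<in> carrier N" using zN F(4) by blast
    ultimately show "f u = \<zero>\<^bsub>Q\<^esub>"
      using z(2)[OF F(4)] s(1) t(1) fraction_eq_zero_iff by metis
  qed
next
  fix r :: "('n, 'a) mpoly" and a P b assume r: "r \<in> poly_grading a" and "P \<in> gQ b"
  then obtain y s v where y: "s \<in> S" "s \<in> poly_grading v" "y \<in> gN (b + v)" "y \<in> carrier N" "P = fr y s"
    by (elim localization_gradingE)
  then show "r \<odot>\<^bsub>Q\<^esub> P \<in> gQ (a + b)"
    using r by (auto simp: localization_smult intro!: fraction_degree intro: smult_shift)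
qed

end

section \<open>Localization of modules over the Weyl algebra\<close>

locale localized_weyl_module = weyl_module L + localized_module "underlying_module L" S
  for L :: "(('n::{finite,linorder}, 'a::comm_ring_1) weyl, 'l) module"
    and S :: "('n, 'a) mpoly set"
begin

abbreviation DQ where "DQ \<equiv> quotient_rule S L"

definition quotient_term :: "'n \<Rightarrow> 'l \<Rightarrow> ('n, 'a) mpoly \<Rightarrow> ('l \<times> ('n, 'a) mpoly) set" where
  "quotient_term i y s = fr (DL i y) s \<ominus>\<^bsub>Q\<^esub> fr (partial_deriv i s \<odot>\<^bsub>U\<^esub> y) (s * s)"

lemma quotient_term_closed [simp]: "y \<in> carrier U \<Longrightarrow> s \<in> S \<Longrightarrow> quotient_term i y s \<in> carrier Q"
  by (simp add: quotient_term_def)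

lemma smult_quotient_term:
  assumes y: "y \<in> carrier U" "s \<in> S"
  shows "s \<odot>\<^bsub>Q\<^esub> quotient_term i y s = fr (DL i y) 1 \<ominus>\<^bsub>Q\<^esub> partial_deriv i s \<odot>\<^bsub>Q\<^esub> fr y s"
proof -
  have "s \<odot>\<^bsub>Q\<^esub> fr (DL i y) s = fr (DL i y) 1"
    using y fraction_cancel[of "DL i y" 1 s] by (simp add: localization_smult)
  moreover have "s \<odot>\<^bsub>Q\<^esub> fr (partial_deriv i s \<odot>\<^bsub>U\<^esub> y) (s * s) = partial_deriv i s \<odot>\<^bsub>Q\<^esub> fr y s"
    using y by (simp add: localization_smult fraction_cancel)
  ultimately show ?thesis
    using y by (simp add: quotient_term_def Q.poly_diff_right)
qed

text \<open>
  Applying the Leibniz rule to the product of \<open>u * s\<close> with the fraction \<open>y / s\<close> forces this value. The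
  right-hand side depends only on \<open>u y\<close>, on \<open>u * s\<close> and on the fraction.
\<close>

lemma scaled_quotient_term:
  assumes y: "y \<in> carrier U" "s \<in> S"
  shows "(u * s) \<odot>\<^bsub>Q\<^esub> quotient_term i y s =
    fr (DL i (u \<odot>\<^bsub>U\<^esub> y)) 1 \<ominus>\<^bsub>Q\<^esub> partial_deriv i (u * s) \<odot>\<^bsub>Q\<^esub> fr y s"
proof -
  define A where "A = u \<odot>\<^bsub>Q\<^esub> fr (DL i y) 1"
  define B where "B = (u * partial_deriv i s) \<odot>\<^bsub>Q\<^esub> fr y s"
  define C where "C = (partial_deriv i u * s) \<odot>\<^bsub>Q\<^esub> fr y s"
  have cl: "A \<in> carrier Q" "B \<in> carrier Q" "C \<in> carrier Q"
    using y by (simp_all add: A_def B_def C_def)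
  have "(u * s) \<odot>\<^bsub>Q\<^esub> quotient_term i y s = A \<ominus>\<^bsub>Q\<^esub> B"
    using y by (simp add: Q.poly_mult smult_quotient_term Q.poly_diff_right A_def B_def)
  moreover have "partial_deriv i (u * s) \<odot>\<^bsub>Q\<^esub> fr y s = B \<oplus>\<^bsub>Q\<^esub> C"
    using y by (simp add: partial_deriv_mult Q.poly_add_left B_def C_def)
  moreover have "fr (DL i (u \<odot>\<^bsub>U\<^esub> y)) 1 = A \<oplus>\<^bsub>Q\<^esub> C"
  proof -
    have "C = fr (partial_deriv i u \<odot>\<^bsub>U\<^esub> y) 1"
      using y fraction_cancel[of "partial_deriv i u \<odot>\<^bsub>U\<^esub> y" 1 s]
      by (simp add: C_def localization_smult U.poly_mult U.poly_swap[of y _ s])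
    then show ?thesis
      using y by (simp add: A_def U.D_leibniz localization_smult localization_add_same)
  qed
  ultimately show ?thesis
    using cl by (simp add: Q.M.minus_eq Q.M.minus_add Q.M.a_ac Q.M.r_neg Q.M.r_neg1 Q.M.r_neg2)
qed

text \<open>
  Two representatives \<open>y / s\<close> and \<open>y' / s'\<close> of a fraction have, after multiplication by suitable
  elements of \<open>S\<close>, the same numerator and the same denominator. The preceding formula then shows
  that their quotient terms agree up to a factor from \<open>S\<close>, and such factors can be cancelled.
\<close>

lemma quotient_term_well_defined:
  assumes y: "y \<in> carrier U" "s \<in> S" and z: "z \<in> carrier U" "r \<in> S" and eq: "fr z r = fr y s"
  shows "quotient_term i z r = quotient_term i y s"
proof -
  obtain t where t: "t \<in> S" "(t * s) \<odot>\<^bsub>U\<^esub> z = (t * r) \<odot>\<^bsub>U\<^esub> y"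
    using fraction_eq_iff[OF z y] eq by blast
  have den: "t * s * r = t * r * s" by (simp add: ac_simps)
  have "(t * s * r) \<odot>\<^bsub>Q\<^esub> quotient_term i z r =
      fr (DL i ((t * s) \<odot>\<^bsub>U\<^esub> z)) 1 \<ominus>\<^bsub>Q\<^esub> partial_deriv i (t * s * r) \<odot>\<^bsub>Q\<^esub> fr z r"
    by (rule scaled_quotient_term[OF z])
  also have "\<dots> = fr (DL i ((t * r) \<odot>\<^bsub>U\<^esub> y)) 1 \<ominus>\<^bsub>Q\<^esub> partial_deriv i (t * r * s) \<odot>\<^bsub>Q\<^esub> fr y s"
    by (simp only: t(2) eq den)
  also have "\<dots> = (t * r * s) \<odot>\<^bsub>Q\<^esub> quotient_term i y s"
    by (rule scaled_quotient_term[OF y, symmetric])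
  finally show ?thesis
    unfolding den
    by (rule smult_injective[rotated 3]) (use t(1) y z in \<open>simp_all\<close>)
qed

lemma quotient_rule_fraction:
  assumes y: "y \<in> carrier U" "s \<in> S"
  shows "DQ i (fr y s) = quotient_term i y s"
proof -
  have "DQ i (fr y s) = (\<Union>(z, r)\<in>fr y s. quotient_term i z r)"
    by (simp only: quotient_rule_def Let_def quotient_term_def)
  also have "\<dots> = quotient_term i y s"
    by (rule UN_fraction[OF y]) (rule quotient_term_well_defined[OF y])
  finally show ?thesis .
qed

lemma quotient_rule_closed [simp]: "P \<in> carrier Q \<Longrightarrow> DQ i P \<in> carrier Q"
  by (elim localizationE) (simp add: quotient_rule_fraction)

lemma quotient_rule_add:
  assumes "P \<in> carrier Q" "P' \<in> carrier Q"
  shows "DQ i (P \<oplus>\<^bsub>Q\<^esub> P') = DQ i P \<oplus>\<^bsub>Q\<^esub> DQ i P'"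
proof -
  obtain y y' s where y: "y \<in> carrier U" "y' \<in> carrier U" "s \<in> S" and P: "P = fr y s" "P' = fr y' s"
    using assms by (rule common_denominator)
  have "DQ i (P \<oplus>\<^bsub>Q\<^esub> P') = (fr (DL i y) s \<oplus>\<^bsub>Q\<^esub> fr (DL i y') s) \<ominus>\<^bsub>Q\<^esub>
      (fr (partial_deriv i s \<odot>\<^bsub>U\<^esub> y) (s * s) \<oplus>\<^bsub>Q\<^esub> fr (partial_deriv i s \<odot>\<^bsub>U\<^esub> y') (s * s))"
    using y by (simp add: P localization_add_same quotient_rule_fraction quotient_term_def U.D_add U.poly_add_right)
  also have "\<dots> = DQ i P \<oplus>\<^bsub>Q\<^esub> DQ i P'"
    using y by (simp add: P quotient_rule_fraction quotient_term_def Q.M.minus_eq Q.M.minus_add Q.M.a_ac)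
  finally show ?thesis .
qed

lemma quotient_rule_leibniz:
  assumes "P \<in> carrier Q"
  shows "DQ i (p \<odot>\<^bsub>Q\<^esub> P) = p \<odot>\<^bsub>Q\<^esub> DQ i P \<oplus>\<^bsub>Q\<^esub> partial_deriv i p \<odot>\<^bsub>Q\<^esub> P"
proof -
  obtain y s where y: "y \<in> carrier U" "s \<in> S" and P: "P = fr y s"
    using assms by (rule localizationE)
  have "fr (DL i (p \<odot>\<^bsub>U\<^esub> y)) s = p \<odot>\<^bsub>Q\<^esub> fr (DL i y) s \<oplus>\<^bsub>Q\<^esub> partial_deriv i p \<odot>\<^bsub>Q\<^esub> P"
    using y by (simp add: P U.D_leibniz localization_smult localization_add_same)
  moreover have "fr (partial_deriv i s \<odot>\<^bsub>U\<^esub> (p \<odot>\<^bsub>U\<^esub> y)) (s * s) = p \<odot>\<^bsub>Q\<^esub> fr (partial_deriv i s \<odot>\<^bsub>U\<^esub> y) (s * s)"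
    using y by (simp add: localization_smult U.poly_swap[of y _ p])
  ultimately have "quotient_term i (p \<odot>\<^bsub>U\<^esub> y) s = p \<odot>\<^bsub>Q\<^esub> quotient_term i y s \<oplus>\<^bsub>Q\<^esub> partial_deriv i p \<odot>\<^bsub>Q\<^esub> P"
    using y assms by (simp add: quotient_term_def Q.poly_add_right Q.poly_minus_right Q.M.minus_eq Q.M.a_ac)
  then show ?thesis
    using y by (simp add: P localization_smult quotient_rule_fraction)
qed

lemma quotient_rule_denominator_one: "y \<in> carrier U \<Longrightarrow> DQ i (fr y 1) = fr (DL i y) 1"
  by (simp add: quotient_rule_fraction quotient_term_def partial_deriv_one Q.M.minus_eq)

text \<open>
  The commutator of two derivations is linear over the polynomials. It vanishes on \<open>s \<cdot> (y / s)\<close>, which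
  has denominator \<open>1\<close>, and \<open>s\<close> acts injectively.
\<close>

lemma quotient_rule_commute:
  assumes "P \<in> carrier Q"
  shows "DQ i (DQ j P) = DQ j (DQ i P)"
proof -
  obtain y s where y: "y \<in> carrier U" "s \<in> S" and P: "P = fr y s"
    using assms by (rule localizationE)
  have sP: "s \<odot>\<^bsub>Q\<^esub> P = fr y 1"
    using y fraction_cancel[of y 1 s] by (simp add: P localization_smult)
  define rest where "rest i j = partial_deriv i s \<odot>\<^bsub>Q\<^esub> DQ j P \<oplus>\<^bsub>Q\<^esub> (partial_deriv j s \<odot>\<^bsub>Q\<^esub> DQ i P \<oplus>\<^bsub>Q\<^esub>
    partial_deriv i (partial_deriv j s) \<odot>\<^bsub>Q\<^esub> P)" for i j
  have rest: "rest i j \<in> carrier Q" "rest i j = rest j i" for i j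
    using assms by (simp_all add: rest_def Q.M.a_ac partial_deriv_commute[of i j])
  have expand: "DQ i (DQ j (s \<odot>\<^bsub>Q\<^esub> P)) = s \<odot>\<^bsub>Q\<^esub> DQ i (DQ j P) \<oplus>\<^bsub>Q\<^esub> rest i j" for i j
    using assms by (simp add: quotient_rule_leibniz quotient_rule_add rest_def Q.M.a_ac)
  have "DQ i (DQ j (s \<odot>\<^bsub>Q\<^esub> P)) = DQ j (DQ i (s \<odot>\<^bsub>Q\<^esub> P))"
    using y U.D_commute[of y i j] by (simp add: sP quotient_rule_denominator_one)
  then have "s \<odot>\<^bsub>Q\<^esub> DQ i (DQ j P) \<oplus>\<^bsub>Q\<^esub> rest i j = s \<odot>\<^bsub>Q\<^esub> DQ j (DQ i P) \<oplus>\<^bsub>Q\<^esub> rest i j"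
    unfolding expand using rest(2)[of j i] by simp
  then have "s \<odot>\<^bsub>Q\<^esub> DQ i (DQ j P) = s \<odot>\<^bsub>Q\<^esub> DQ j (DQ i P)"
    using assms rest(1) by simp
  then show ?thesis
    using smult_injective[OF y(2)] assms by simp
qed

sublocale DQ: derivation_module Q DQ
  by (intro derivation_module.intro Q.poly_module_axioms derivation_module_axioms.intro
      quotient_rule_closed quotient_rule_add quotient_rule_leibniz quotient_rule_commute)

text \<open>
  The quotient rule gives \<open>E (y / s) = E y / s - (E s) y / s\<^sup>2\<close>, and \<open>E s = v s\<close> by Euler's formula for
  the homogeneous polynomial \<open>s\<close>. Hence \<open>E - u\<close> acts on \<open>y / s\<close> as \<open>E - (u + v)\<close> acts on \<open>y\<close>.
\<close>

lemma euler_shift_fraction: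
  assumes y: "y \<in> carrier U" and s: "s \<in> S" "s \<in> poly_grading v"
  shows "DQ.act (euler_shift u) (fr y s) = fr (U.act (euler_shift (u + v)) y) s"
proof -
  interpret frs: abelian_group_hom U Q "\<lambda>y. fr y s" by (rule fraction_hom[OF s(1)])
  interpret frss: abelian_group_hom U Q "\<lambda>y. fr y (s * s)" by (rule fraction_hom) (simp add: s)
  define Ey where "Ey = (\<Oplus>\<^bsub>U\<^esub>i\<in>UNIV. mpoly_var i \<odot>\<^bsub>U\<^esub> DL i y)"
  have Ey: "Ey \<in> carrier U" unfolding Ey_def using y by (intro U.M.finsum_closed) auto
  have neg: "abelian_group_hom Q Q (\<lambda>x. \<ominus>\<^bsub>Q\<^esub> x)"
    by (rule additive_mapI[OF localization_group localization_group]) (auto simp: Q.M.minus_add)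
  have summand: "mpoly_var i \<odot>\<^bsub>Q\<^esub> DQ i (fr y s) =
      fr (mpoly_var i \<odot>\<^bsub>U\<^esub> DL i y) s \<oplus>\<^bsub>Q\<^esub> \<ominus>\<^bsub>Q\<^esub> fr ((mpoly_var i * partial_deriv i s) \<odot>\<^bsub>U\<^esub> y) (s * s)" for i
    using y s by (simp add: quotient_rule_fraction quotient_term_def Q.poly_add_right
        Q.poly_minus_right localization_smult U.poly_mult Q.M.minus_eq)
  have "(\<Oplus>\<^bsub>Q\<^esub>i\<in>UNIV. mpoly_var i \<odot>\<^bsub>Q\<^esub> DQ i (fr y s)) =
      (\<Oplus>\<^bsub>Q\<^esub>i\<in>UNIV. fr (mpoly_var i \<odot>\<^bsub>U\<^esub> DL i y) s) \<ominus>\<^bsub>Q\<^esub>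
      (\<Oplus>\<^bsub>Q\<^esub>i\<in>UNIV. fr ((mpoly_var i * partial_deriv i s) \<odot>\<^bsub>U\<^esub> y) (s * s))"
    unfolding summand using y s
    by (subst Q.M.add.finprod_multf) (auto simp: Q.M.minus_eq abelian_group_hom.hom_finsum[OF neg])
  also have "(\<Oplus>\<^bsub>Q\<^esub>i\<in>UNIV. fr (mpoly_var i \<odot>\<^bsub>U\<^esub> DL i y) s) = fr Ey s"
    unfolding Ey_def using y by (subst frs.hom_finsum) auto
  also have "(\<Oplus>\<^bsub>Q\<^esub>i\<in>UNIV. fr ((mpoly_var i * partial_deriv i s) \<odot>\<^bsub>U\<^esub> y) (s * s)) =
      fr (\<Oplus>\<^bsub>U\<^esub>i\<in>UNIV. (mpoly_var i * partial_deriv i s) \<odot>\<^bsub>U\<^esub> y) (s * s)"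
    using y by (subst frss.hom_finsum) auto
  also have "(\<Oplus>\<^bsub>U\<^esub>i\<in>UNIV. (mpoly_var i * partial_deriv i s) \<odot>\<^bsub>U\<^esub> y) = (of_int v * s) \<odot>\<^bsub>U\<^esub> y"
    by (simp only: euler_formula[OF s(2)] flip: U.poly_finsum_left[OF y])
  also have "fr ((of_int v * s) \<odot>\<^bsub>U\<^esub> y) (s * s) = fr (of_int v \<odot>\<^bsub>U\<^esub> y) s"
    using y s fraction_cancel[of "of_int v \<odot>\<^bsub>U\<^esub> y" s s] by (simp add: U.poly_mult U.poly_swap[of y _ s])
  finally have "DQ.act (euler_shift u) (fr y s) =
      fr Ey s \<ominus>\<^bsub>Q\<^esub> fr (of_int v \<odot>\<^bsub>U\<^esub> y) s \<ominus>\<^bsub>Q\<^esub> fr (of_int u \<odot>\<^bsub>U\<^esub> y) s"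
    using y s by (simp add: DQ.act_euler_shift localization_smult)
  also have "\<dots> = fr (Ey \<ominus>\<^bsub>U\<^esub> of_int v \<odot>\<^bsub>U\<^esub> y \<ominus>\<^bsub>U\<^esub> of_int u \<odot>\<^bsub>U\<^esub> y) s"
    using y s Ey by (simp add: fraction_diff)
  also have "Ey \<ominus>\<^bsub>U\<^esub> of_int v \<odot>\<^bsub>U\<^esub> y \<ominus>\<^bsub>U\<^esub> of_int u \<odot>\<^bsub>U\<^esub> y = U.act (euler_shift (u + v)) y"
    using y Ey by (simp add: U.act_euler_shift Ey_def[symmetric] U.poly_add_left U.M.minus_eq U.M.minus_add U.M.a_ac)
  finally show ?thesis .
qed

lemma euler_shift_power_fraction:
  assumes "y \<in> carrier U" and s: "s \<in> S" "s \<in> poly_grading v"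
  shows "DQ.act (euler_shift u ^ a) (fr y s) = fr (U.act (euler_shift (u + v) ^ a) y) s"
proof (induction a)
  case 0
  then show ?case using assms by (simp add: DQ.act_one U.act_one)
next
  case (Suc a)
  then show ?case
    using assms by (simp add: DQ.act_mult U.act_mult euler_shift_fraction)
qed

end

text \<open>
  By Euler's formula for homogeneous polynomials the operator \<open>E - u\<close> sends a fraction \<open>y / s\<close> of
  degree \<open>u\<close> to \<open>(E - \<bar>y\<bar>) y / s\<close>, so a power that annihilates \<open>y\<close> annihilates \<open>y / s\<close>.
\<close>

lemma weyl_localization_eulerian:
  fixes L :: "(('n::{finite,linorder}, 'a::comm_ring_1) weyl, 'l) module"
  assumes L: "generalized_eulerian L gL"
    and S: "1 \<in> S" "\<And>s t. s \<in> S \<Longrightarrow> t \<in> S \<Longrightarrow> s * t \<in> S" "\<And>s. s \<in> S \<Longrightarrow> \<exists>v. s \<in> poly_grading v"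
  shows "generalized_eulerian (weyl_localization S L) (localization_grading S (underlying_module L) gL)"
proof -
  interpret L: graded weyl_algebra weyl_grading L gL
    using L by (simp add: generalized_eulerian_iff)
  interpret localized_weyl_module L S
    by (intro localized_weyl_module.intro weyl_module.intro L.left_module_axioms localized_module.intro
        localized_module_axioms.intro S poly_module.intro)
       (use weyl_module.underlying_derivation_module[OF weyl_module.intro[OF L.left_module_axioms]]
         in \<open>simp_all add: derivation_module_def poly_module_def\<close>)
  interpret homogeneous_localization U S gL
    by (intro homogeneous_localization.intro localized_module_axioms underlying_graded
        L.graded_axioms homogeneous_localization_axioms.intro S)
  have deg: "DQ i P \<in> gQ (u - 1)" if P: "P \<in> gQ u" for i P u
  proof -
    obtain y s v where y: "s \<in> S" "s \<in> poly_grading v" "y \<in> gL (u + v)" "y \<in> carrier U" "P = fr y s"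
      using P by (rule localization_gradingE)
    interpret gQ: graded mpoly_ring poly_grading Q gQ by (rule localization_graded)
    have "DL i y \<in> gL ((u - 1) + v)"
      using L.smult_degree[OF D_weyl_grading y(3), of i] by (simp add: algebra_simps)
    then have 1: "fr (DL i y) s \<in> gQ (u - 1)" using y by (intro fraction_degree)
    have "partial_deriv i s \<odot>\<^bsub>U\<^esub> y \<in> gL ((u - 1) + (v + v))"
      using y by (intro smult_shift[of _ "v - 1" _ "u + v"] poly_grading_partial_deriv) auto
    then have 2: "fr (partial_deriv i s \<odot>\<^bsub>U\<^esub> y) (s * s) \<in> gQ (u - 1)"
      using y by (intro fraction_degree[of _ "v + v"] poly_grading_mult) auto
    show ?thesis
      using y 1 2 by (auto simp: quotient_rule_fraction quotient_term_def Q.M.minus_eq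
          intro: gQ.component_add gQ.component_minus)
  qed
  have "\<exists>a>0. weyl_class (euler_shift u ^ a) \<odot>\<^bsub>weyl_localization S L\<^esub> P = \<zero>\<^bsub>weyl_localization S L\<^esub>"
    if P: "P \<in> gQ u" for u P
  proof -
    obtain y s v where y: "s \<in> S" "s \<in> poly_grading v" "y \<in> gL (u + v)" "y \<in> carrier U" "P = fr y s"
      using P by (rule localization_gradingE)
    obtain a where a: "a > 0" "weyl_class (euler_shift (u + v) ^ a) \<odot>\<^bsub>L\<^esub> y = \<zero>\<^bsub>L\<^esub>"
      using L y(3) unfolding generalized_eulerian_iff by blast
    have "U.act (euler_shift (u + v) ^ a) y = \<zero>\<^bsub>U\<^esub>"
      using a y weyl_class_action[of y "euler_shift (u + v) ^ a"] by (simp add: restrict_scalars_simps)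
    then have "DQ.act (euler_shift u ^ a) P = \<zero>\<^bsub>Q\<^esub>"
      using y by (simp add: euler_shift_power_fraction)
    then show ?thesis
      using a y unfolding weyl_localization_def
      by (auto simp: DQ.weyl_extension_smult DQ.weyl_extension_simps)
  qed
  moreover have "graded weyl_algebra weyl_grading (weyl_localization S L) gQ"
    unfolding weyl_localization_def by (rule DQ.weyl_extension_graded[OF localization_graded deg])
  ultimately show ?thesis unfolding generalized_eulerian_iff by blast
qed


section \<open>The canonical maps between localizations\<close>

lemma (in localized_weyl_module) weyl_localization_simps:
  "carrier (weyl_localization S L) = carrier Q" "add (weyl_localization S L) = add Q"
  "\<zero>\<^bsub>weyl_localization S L\<^esub> = \<zero>\<^bsub>Q\<^esub>"
  "P \<in> carrier Q \<Longrightarrow> weyl_class f \<odot>\<^bsub>weyl_localization S L\<^esub> P = DQ.act f P"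
  by (simp_all add: weyl_localization_def DQ.weyl_extension_simps DQ.weyl_extension_smult)

definition homogeneous_multiplicative :: "('n::finite, 'a::comm_ring_1) mpoly set \<Rightarrow> bool" where
  "homogeneous_multiplicative S \<longleftrightarrow>
     1 \<in> S \<and> (\<forall>s\<in>S. \<forall>t\<in>S. s * t \<in> S) \<and> (\<forall>s\<in>S. \<exists>v. s \<in> poly_grading v)"

lemma localized_weyl_moduleI:
  fixes L :: "(('n::{finite,linorder}, 'a::comm_ring_1) weyl, 'l) module"
  assumes "left_module weyl_algebra L" "homogeneous_multiplicative S"
  shows "localized_weyl_module L S"
proof -
  interpret weyl_module L using assms(1) by (rule weyl_module.intro)
  show ?thesis
    using assms(2) unfolding homogeneous_multiplicative_def
    by (intro localized_weyl_module.intro weyl_module_axioms localized_module.intro U.poly_module_axioms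
        localized_module_axioms.intro) auto
qed

text \<open>
  The canonical map respects the quotient rule because it sends the quotient term of \<open>y / s\<close> over \<open>S\<close> to
  the one over \<open>S'\<close>; linearity over the Weyl algebra follows.
\<close>

lemma canonical_map_hom:
  fixes L :: "(('n::{finite,linorder}, 'a::comm_ring_1) weyl, 'l) module"
  assumes L: "graded weyl_algebra weyl_grading L gL"
    and S: "homogeneous_multiplicative S" "homogeneous_multiplicative S'" "S \<subseteq> S'"
  defines "N \<equiv> underlying_module L"
  shows "graded_hom weyl_algebra (weyl_localization S L) (localization_grading S N gL)
    (weyl_localization S' L) (localization_grading S' N gL) (\<lambda>P. \<Union>(y, s)\<in>P. fraction S' N y s)"
proof -
  interpret L: graded weyl_algebra weyl_grading L gL by fact
  interpret A: localized_weyl_module L S using L.left_module_axioms S(1) by (rule localized_weyl_moduleI)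
  interpret B: localized_weyl_module L S' using L.left_module_axioms S(2) by (rule localized_weyl_moduleI)
  define h where "h P = (\<Union>(y, s)\<in>P. fraction S' N y s)" for P
  have h: "h (A.fr y s) = B.fr y s" if y: "y \<in> carrier A.U" "s \<in> S" for y s
  proof -
    have "(\<Union>(z, r)\<in>A.fr y s. B.fr z r) = B.fr y s"
    proof (rule A.UN_fraction[OF y])
      fix z r assume z: "z \<in> carrier A.U" "r \<in> S" "A.fr z r = A.fr y s"
      then obtain t where "t \<in> S" "(t * s) \<odot>\<^bsub>A.U\<^esub> z = (t * r) \<odot>\<^bsub>A.U\<^esub> y"
        using A.fraction_eq_iff[of z r y s] y by blast
      then show "B.fr z r = B.fr y s"
        using B.fraction_eq_iff[of z r y s] y z S(3) by blast
    qed
    then show ?thesis by (simp only: h_def N_def)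
  qed
  have S': "s \<in> S'" if "s \<in> S" for s using that S(3) by blast
  have hom: "abelian_group_hom A.Q B.Q h"
  proof (rule additive_mapI[OF A.localization_group B.localization_group])
    show "h \<in> carrier A.Q \<rightarrow> carrier B.Q"
      by (auto elim!: A.localizationE simp: h S')
    fix P P' assume "P \<in> carrier A.Q" "P' \<in> carrier A.Q"
    then obtain y y' s where y: "y \<in> carrier A.U" "y' \<in> carrier A.U" "s \<in> S" "P = A.fr y s" "P' = A.fr y' s"
      by (rule A.common_denominator)
    then show "h (P \<oplus>\<^bsub>A.Q\<^esub> P') = h P \<oplus>\<^bsub>B.Q\<^esub> h P'"
      by (simp add: A.localization_add_same B.localization_add_same h S')
  qed
  then interpret h: abelian_group_hom A.Q B.Q h .
  have poly: "h (p \<odot>\<^bsub>A.Q\<^esub> P) = p \<odot>\<^bsub>B.Q\<^esub> h P" if "P \<in> carrier A.Q" for p P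
    using that by (elim A.localizationE) (simp add: A.localization_smult B.localization_smult h S')
  have D: "h (A.DQ i P) = B.DQ i (h P)" if "P \<in> carrier A.Q" for i P
  proof -
    obtain y s where y: "y \<in> carrier A.U" "s \<in> S" "P = A.fr y s"
      using \<open>P \<in> carrier A.Q\<close> by (rule A.localizationE)
    have 1: "A.fr (A.DL i y) s \<in> carrier A.Q" "A.fr (partial_deriv i s \<odot>\<^bsub>A.U\<^esub> y) (s * s) \<in> carrier A.Q"
      using y by simp_all
    have "h (A.quotient_term i y s) = h (A.fr (A.DL i y) s) \<ominus>\<^bsub>B.Q\<^esub> h (A.fr (partial_deriv i s \<odot>\<^bsub>A.U\<^esub> y) (s * s))"
      unfolding A.quotient_term_def A.Q.M.minus_eq B.Q.M.minus_eq using 1 by simp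
    also have "\<dots> = B.quotient_term i y s"
      using y by (simp add: h B.quotient_term_def)
    finally show ?thesis
      using y by (simp add: A.quotient_rule_fraction B.quotient_rule_fraction h S')
  qed
  have act: "h (A.DQ.act f P) = B.DQ.act f (h P)" if "P \<in> carrier A.Q" for f P
    by (rule free_action_hom[where h = h and D = A.DQ and D' = B.DQ,
          OF A.DQ.derivation_module_axioms B.DQ.derivation_module_axioms hom])
       (rule poly D that; assumption?)+
  have "graded_hom weyl_algebra (weyl_localization S L) (localization_grading S N gL)
    (weyl_localization S' L) (localization_grading S' N gL) h"
    unfolding graded_hom_def
  proof (intro conjI ballI allI)
    show "h ` localization_grading S N gL u \<subseteq> localization_grading S' N gL u" for u
    proof (rule image_subsetI)
      fix P assume "P \<in> localization_grading S N gL u"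
      then obtain y s v where P: "P = A.fr y s" "s \<in> S" "s \<in> poly_grading v" "y \<in> gL (u + v)"
        unfolding localization_grading_def N_def by blast
      then have "h P = B.fr y s"
        using h L.component_closed by (simp add: restrict_scalars_simps)
      then show "h P \<in> localization_grading S' N gL u"
        unfolding localization_grading_def N_def using P S' by blast
    qed
    fix r :: "('n, 'a) weyl" and P assume "r \<in> carrier weyl_algebra" "P \<in> carrier (weyl_localization S L)"
    then show "h (r \<odot>\<^bsub>weyl_localization S L\<^esub> P) = r \<odot>\<^bsub>weyl_localization S' L\<^esub> h P"
      by (auto simp: A.weyl_localization_simps B.weyl_localization_simps carrier_weyl_algebra act)
  qed (auto simp: A.weyl_localization_simps B.weyl_localization_simps)
  then show ?thesis unfolding h_def[abs_def] .
qed

section \<open>The multiplicative sets of the Cech complex\<close>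

lemma homogeneous_ideal_ideal:
  fixes J :: "('n::finite, 'a::comm_ring_1) mpoly set"
  assumes "homogeneous_ideal mpoly_ring poly_grading J"
  shows "ideal J mpoly_ring"
  using assms ring.genideal_ideal[OF ring_of_type_algebra_ring] unfolding homogeneous_ideal_def by auto

lemma type_ideal:
  assumes "ideal J (ring_of_type_algebra :: 'a::comm_ring_1 ring)"
  shows "0 \<in> J" "x \<in> J \<Longrightarrow> y \<in> J \<Longrightarrow> x + y \<in> J" "x \<in> J \<Longrightarrow> r * x \<in> J" "x \<in> J \<Longrightarrow> x * r \<in> J"
    "x \<in> J \<Longrightarrow> - x \<in> J"
proof -
  note sub = ideal.axioms(1)[OF assms]
  show "0 \<in> J" using additive_subgroup.zero_closed[OF sub] by simp
  show "x \<in> J \<Longrightarrow> y \<in> J \<Longrightarrow> x + y \<in> J" using additive_subgroup.a_closed[OF sub, of x y] by simp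
  show mult: "x \<in> J \<Longrightarrow> r * x \<in> J" for r using ideal.I_l_closed[OF assms, of x r] by simp
  show "x \<in> J \<Longrightarrow> x * r \<in> J" using mult[of r] by (simp add: mult.commute)
  show "x \<in> J \<Longrightarrow> - x \<in> J" using mult[of "- 1"] by simp
qed

lemma star_S_multiplicative:
  fixes b :: "('n::finite, 'a::comm_ring_1) mpoly"
  assumes b: "b \<in> poly_grading u" and J: "ideal J mpoly_ring"
  shows "homogeneous_multiplicative (star_S b J)"
  unfolding homogeneous_multiplicative_def
proof (intro conjI ballI)
  note J = type_ideal[OF J]
  show "1 \<in> star_S b J"
  proof -
    have "b ^ 0 \<in> poly_grading 0" using poly_grading_one by simp
    then have "b ^ 0 + 0 \<in> star_S b J"
      unfolding star_S_def using J(1) poly_grading_zero by blast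
    then show ?thesis by simp
  qed
  fix s assume "s \<in> star_S b J"
  then obtain n j v where s: "s = b ^ n + j" "j \<in> J" "b ^ n \<in> poly_grading v" "j \<in> poly_grading v"
    by (auto simp: star_S_def)
  then show "\<exists>v. s \<in> poly_grading v" using poly_grading_add by blast
  fix t assume "t \<in> star_S b J"
  then obtain n' j' v' where t: "t = b ^ n' + j'" "j' \<in> J" "b ^ n' \<in> poly_grading v'" "j' \<in> poly_grading v'"
    by (auto simp: star_S_def)
  have "s * t = b ^ (n + n') + (b ^ n * j' + j * b ^ n' + j * j')"
    by (simp add: s t algebra_simps power_add)
  moreover have "b ^ n * j' + j * b ^ n' + j * j' \<in> J"
    by (rule J(2)[OF J(2)[OF J(3)[OF t(2)] J(4)[OF s(2)]] J(4)[OF s(2)]])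
  moreover have "b ^ (n + n') \<in> poly_grading (v + v')"
    unfolding power_add using s(3) t(3) by (rule poly_grading_mult)
  moreover have "b ^ n * j' + j * b ^ n' + j * j' \<in> poly_grading (v + v')"
    using s t by (intro poly_grading_add poly_grading_mult)
  ultimately show "s * t \<in> star_S b J" unfolding star_S_def by blast
qed

lemma cech_S_multiplicative:
  assumes S: "\<And>i. i \<in> \<sigma> \<Longrightarrow> homogeneous_multiplicative (star_S (b ! i) J)" and "finite \<sigma>"
  shows "homogeneous_multiplicative (cech_S b J \<sigma>)"
  unfolding homogeneous_multiplicative_def
proof (intro conjI ballI)
  note S = S[unfolded homogeneous_multiplicative_def]
  show "1 \<in> cech_S b J \<sigma>"
    using S unfolding cech_S_def by (auto intro!: exI[of _ "\<lambda>_. 1"])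
  fix p assume "p \<in> cech_S b J \<sigma>"
  then obtain s where s: "p = (\<Prod>i\<in>\<sigma>. s i)" "\<And>i. i \<in> \<sigma> \<Longrightarrow> s i \<in> star_S (b ! i) J"
    by (auto simp: cech_S_def)
  have "\<exists>v. (\<Prod>i\<in>\<tau>. s i) \<in> poly_grading v" if "\<tau> \<subseteq> \<sigma>" for \<tau>
    using finite_subset[OF that \<open>finite \<sigma>\<close>] that
  proof (induction \<tau>)
    case empty
    then show ?case using poly_grading_one by auto
  next
    case (insert i \<tau>)
    then obtain v w where "s i \<in> poly_grading w" "(\<Prod>i\<in>\<tau>. s i) \<in> poly_grading v"
      using S s(2) by (meson insert_subset)
    then have "s i * (\<Prod>i\<in>\<tau>. s i) \<in> poly_grading (w + v)" by (rule poly_grading_mult)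
    then show ?case using insert by auto
  qed
  then show "\<exists>v. p \<in> poly_grading v" using s(1) by blast
  fix q assume "q \<in> cech_S b J \<sigma>"
  then obtain t where t: "q = (\<Prod>i\<in>\<sigma>. t i)" "\<And>i. i \<in> \<sigma> \<Longrightarrow> t i \<in> star_S (b ! i) J"
    by (auto simp: cech_S_def)
  have "p * q = (\<Prod>i\<in>\<sigma>. s i * t i)" by (simp add: s t prod.distrib)
  moreover have "\<forall>i\<in>\<sigma>. s i * t i \<in> star_S (b ! i) J" using S s(2) t(2) by blast
  ultimately show "p * q \<in> cech_S b J \<sigma>" unfolding cech_S_def by blast
qed

text \<open>The missing factors are chosen to be \<open>1\<close>.\<close>

lemma cech_S_mono:
  assumes S: "\<And>i. i \<in> \<sigma> \<Longrightarrow> homogeneous_multiplicative (star_S (b ! i) J)" and "finite \<sigma>" "\<tau> \<subseteq> \<sigma>"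
  shows "cech_S b J \<tau> \<subseteq> cech_S b J \<sigma>"
proof
  fix p assume "p \<in> cech_S b J \<tau>"
  then obtain s where s: "p = (\<Prod>i\<in>\<tau>. s i)" "\<And>i. i \<in> \<tau> \<Longrightarrow> s i \<in> star_S (b ! i) J"
    by (auto simp: cech_S_def)
  define t where "t i = (if i \<in> \<tau> then s i else 1)" for i
  have "p = (\<Prod>i\<in>\<sigma>. t i)"
    unfolding s(1) t_def using assms(2,3) by (intro prod.mono_neutral_cong_left) auto
  moreover have "\<forall>i\<in>\<sigma>. t i \<in> star_S (b ! i) J"
    using S s(2) by (auto simp: t_def homogeneous_multiplicative_def)
  ultimately show "p \<in> cech_S b J \<sigma>" unfolding cech_S_def by blast
qed

section \<open>The Cech complex is generalized Eulerian\<close>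

text \<open>A finite family of exponents has a common upper bound.\<close>

lemma product_eulerian:
  fixes N :: "'i \<Rightarrow> (('n::{finite,linorder}, 'a::comm_ring_1) weyl, 'm) module"
  assumes T: "finite T" and N: "\<And>\<sigma>. \<sigma> \<in> T \<Longrightarrow> generalized_eulerian (N \<sigma>) (gN \<sigma>)"
  shows "generalized_eulerian (product_module T N) (\<lambda>u. \<Pi>\<^sub>E \<sigma>\<in>T. gN \<sigma> u)"
proof -
  interpret graded_family weyl_algebra weyl_grading T N gN
    by (rule graded_family.intro[OF weyl.ring_axioms T]) (use N in \<open>simp add: generalized_eulerian_iff\<close>)
  have "\<exists>a>0. weyl_class (euler_shift u ^ a) \<odot>\<^bsub>P\<^esub> c = \<zero>\<^bsub>P\<^esub>" if c: "c \<in> gP u" for u c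
  proof -
    have "\<forall>\<sigma>\<in>T. \<exists>a>0. weyl_class (euler_shift u ^ a) \<odot>\<^bsub>N \<sigma>\<^esub> c \<sigma> = \<zero>\<^bsub>N \<sigma>\<^esub>"
      using N c unfolding generalized_eulerian_iff by blast
    then obtain a where a: "\<And>\<sigma>. \<sigma> \<in> T \<Longrightarrow> weyl_class (euler_shift u ^ a \<sigma>) \<odot>\<^bsub>N \<sigma>\<^esub> c \<sigma> = \<zero>\<^bsub>N \<sigma>\<^esub>"
      by metis
    define A where "A = Suc (\<Sum>\<sigma>\<in>T. a \<sigma>)"
    have "weyl_class (euler_shift u ^ A) \<odot>\<^bsub>N \<sigma>\<^esub> c \<sigma> = \<zero>\<^bsub>N \<sigma>\<^esub>" if \<sigma>: "\<sigma> \<in> T" for \<sigma>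
    proof -
      interpret N: graded weyl_algebra weyl_grading "N \<sigma>" "gN \<sigma>" by (rule member[OF \<sigma>])
      have "a \<sigma> \<le> A" using member_le_sum[of \<sigma> T a] T \<sigma> by (simp add: A_def)
      then show ?thesis
        using weyl_module.euler_shift_power_mono[OF weyl_module.intro[OF N.left_module_axioms] a[OF \<sigma>]]
          c \<sigma> N.component_closed by blast
    qed
    then have "weyl_class (euler_shift u ^ A) \<odot>\<^bsub>P\<^esub> c = \<zero>\<^bsub>P\<^esub>"
      by (auto simp: product_module_simps intro!: restrict_ext)
    then show ?thesis by (auto simp: A_def)
  qed
  then show ?thesis using product_graded unfolding generalized_eulerian_iff by blast
qed

text \<open>
  A homogeneous class has a homogeneous cocycle as representative, and a power of \<open>E - u\<close> annihilates it.
\<close>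

lemma cohomology_eulerian:
  assumes C: "\<And>k. generalized_eulerian (C k) (gC k)"
    and d: "\<And>k. graded_hom weyl_algebra (C k) (gC k) (C (Suc k)) (gC (Suc k)) (d k)"
  shows "generalized_eulerian (cohomology C d i) (cohomology_grading C gC d i)"
proof -
  have gr: "graded weyl_algebra weyl_grading (C k) (gC k)" for k
    using C unfolding generalized_eulerian_iff by blast
  interpret C: graded weyl_algebra weyl_grading "C i" "gC i" by (rule gr)
  note coh = cohomology_graded[where C = C and gC = gC and d = d and i = i, OF weyl_grading_closed gr d]
  let ?B = "coboundaries C d i"
  have B: "additive_subgroup ?B (C i)" "\<And>r x. r \<in> carrier weyl_algebra \<Longrightarrow> x \<in> ?B \<Longrightarrow> r \<odot>\<^bsub>C i\<^esub> x \<in> ?B"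
    using coh(1) unfolding homogeneous_submodule_def by blast+
  have "\<exists>a>0. weyl_class (euler_shift u ^ a) \<odot>\<^bsub>cohomology C d i\<^esub> y = \<zero>\<^bsub>cohomology C d i\<^esub>"
    if y: "y \<in> cohomology_grading C gC d i u" for u y
  proof -
    obtain z where z: "z \<in> gC i u" "y = ?B +>\<^bsub>C i\<^esub> z"
      using y by (auto simp: cohomology_grading_def)
    obtain a where a: "a > 0" "weyl_class (euler_shift u ^ a) \<odot>\<^bsub>C i\<^esub> z = \<zero>\<^bsub>C i\<^esub>"
      using C z(1) unfolding generalized_eulerian_iff by blast
    have "weyl_class (euler_shift u ^ a) \<odot>\<^bsub>cohomology C d i\<^esub> y = ?B +>\<^bsub>C i\<^esub> \<zero>\<^bsub>C i\<^esub>"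
      unfolding z(2) cohomology_eq_subquotient
      using C.subquotient_smult[OF B weyl_class_closed C.component_closed[OF z(1)]] a(2) by simp
    also have "\<dots> = \<zero>\<^bsub>cohomology C d i\<^esub>"
      using additive_subgroup.a_subset[OF B(1)] by (simp add: cohomology_def Let_def)
    finally show ?thesis using a(1) by blast
  qed
  then show ?thesis using coh(3) unfolding generalized_eulerian_iff by blast
qed

lemma cech_module_product: "cech_module b J L k = product_module (cech_index b k) (cech_summand b J L)"
  by (simp add: cech_module_def product_module_def Let_def)

lemma cech_cohomology_eulerian:
  fixes L :: "(('n::{finite,linorder}, 'a::comm_ring_1) weyl, 'l) module"
  assumes L: "generalized_eulerian L gL" and J: "ideal J mpoly_ring"
    and b: "set b \<subseteq> (\<Union>u. poly_grading u)"
  shows "generalized_eulerian (cech_cohomology b J L i) (cech_cohomology_grading b J L gL i)"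
proof -
  have star: "homogeneous_multiplicative (star_S (b ! j) J)" if "j < length b" for j
    using b nth_mem[OF that] star_S_multiplicative[OF _ J] by blast
  have index: "finite \<sigma>" "\<And>j. j \<in> \<sigma> \<Longrightarrow> j < length b" if "\<sigma> \<in> cech_index b k" for \<sigma> k
    using that finite_subset by (auto simp: cech_index_def)
  have hm: "homogeneous_multiplicative (cech_S b J \<sigma>)" if "\<sigma> \<in> cech_index b k" for \<sigma> k
    using index[OF that] star by (intro cech_S_multiplicative) auto
  have fin: "finite (cech_index b k)" for k
    by (rule finite_subset[of _ "Pow {..<length b}"]) (auto simp: cech_index_def)
  have lm: "graded weyl_algebra weyl_grading L gL"
    using L by (simp add: generalized_eulerian_iff)
  let ?g = "\<lambda>\<sigma>. localization_grading (cech_S b J \<sigma>) (underlying_module L) gL"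
  have summand: "generalized_eulerian (cech_summand b J L \<sigma>) (?g \<sigma>)" if "\<sigma> \<in> cech_index b k" for \<sigma> k
    unfolding cech_summand_def
    using hm[OF that] L unfolding homogeneous_multiplicative_def by (intro weyl_localization_eulerian) auto
  have grading: "cech_grading b J L gL k = (\<lambda>u. \<Pi>\<^sub>E \<sigma>\<in>cech_index b k. ?g \<sigma> u)" for k
    by (simp add: cech_grading_def fun_eq_iff)
  have C: "generalized_eulerian (cech_module b J L k) (cech_grading b J L gL k)" for k
    unfolding cech_module_product grading using fin summand by (rule product_eulerian)
  have d: "graded_hom weyl_algebra (cech_module b J L k) (cech_grading b J L gL k)
      (cech_module b J L (Suc k)) (cech_grading b J L gL (Suc k)) (cech_diff b J L k)" for k
  proof -
    interpret F: graded_family weyl_algebra weyl_grading "cech_index b k" "cech_summand b J L" ?g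
      by (rule graded_family.intro[OF weyl.ring_axioms fin])
         (use summand in \<open>simp add: generalized_eulerian_iff\<close>)
    show ?thesis
      unfolding cech_module_product grading cech_diff_def[abs_def]
    proof (rule graded_hom_tuple, rule graded_hom_combination)
      fix \<sigma> assume \<sigma>: "\<sigma> \<in> cech_index b (Suc k)"
      show "graded weyl_algebra weyl_grading F.P F.gP" by (rule F.product_graded)
      show "graded weyl_algebra weyl_grading (cech_summand b J L \<sigma>) (?g \<sigma>)"
        using summand[OF \<sigma>] by (simp add: generalized_eulerian_iff)
      fix j assume j: "j \<in> \<sigma>"
      have \<tau>: "\<sigma> - {j} \<in> cech_index b k"
        using \<sigma> j index(1)[OF \<sigma>] by (auto simp: cech_index_def)
      have "cech_S b J (\<sigma> - {j}) \<subseteq> cech_S b J \<sigma>"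
        using index[OF \<sigma>] star by (intro cech_S_mono) auto
      then have "graded_hom weyl_algebra (cech_summand b J L (\<sigma> - {j})) (?g (\<sigma> - {j}))
          (cech_summand b J L \<sigma>) (?g \<sigma>) (\<lambda>P. \<Union>(y, s)\<in>P. fraction (cech_S b J \<sigma>) (underlying_module L) y s)"
        unfolding cech_summand_def by (rule canonical_map_hom[OF lm hm[OF \<tau>] hm[OF \<sigma>]])
      then show "graded_hom weyl_algebra F.P F.gP (cech_summand b J L \<sigma>) (?g \<sigma>)
          (\<lambda>c. \<Union>(y, s)\<in>c (\<sigma> - {j}). fraction (cech_S b J \<sigma>) (underlying_module L) y s)"
        by (rule graded_hom_compose[OF F.graded_hom_projection[OF \<tau>]])
    qed
  qed
  show ?thesis
    unfolding cech_cohomology_def cech_cohomology_grading_def[abs_def]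
    by (rule cohomology_eulerian[where C = "cech_module b J L" and gC = "cech_grading b J L gL"
          and d = "cech_diff b J L", OF C d])
qed

section \<open>Torsion with respect to a pair of ideals\<close>

lemma ideal_pow_ideal:
  assumes "ring R" "ideal I R"
  shows "ideal (ideal_pow R I n) R"
  unfolding ideal_pow_def
  by (induction n) (auto intro: ring.oneideal[OF assms(1)] ring.ideal_prod_is_ideal[OF assms(1,2)])

lemma ideal_pow_add_subset:
  assumes "ring R" "ideal I R"
  shows "ideal_pow R I (n + m) \<subseteq> ideal_prod R (ideal_pow R I n) (ideal_pow R I m)"
proof (induction n)
  case 0
  interpret ring R by fact
  have "x \<in> ideal_prod R (carrier R) (ideal_pow R I m)" if "x \<in> ideal_pow R I m" for x
    using ideal_prod.prod[OF one_closed that, of R] ideal.Icarr[OF ideal_pow_ideal[OF assms] that] by simp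
  then show ?case by (auto simp: ideal_pow_def)
next
  case (Suc n)
  have "ideal_prod R I A \<subseteq> ideal_prod R I B" if "A \<subseteq> B" for A B
  proof
    fix x assume "x \<in> ideal_prod R I A"
    then show "x \<in> ideal_prod R I B"
      by induction (use that in \<open>auto intro: ideal_prod.intros\<close>)
  qed
  from this[OF Suc] show ?case
    using ring.ideal_prod_assoc[OF assms(1,2) ideal_pow_ideal[OF assms, of n] ideal_pow_ideal[OF assms, of m]]
    by (simp add: ideal_pow_def)
qed

text \<open>
  The condition \<open>I\<^sup>n y \<subseteq> J y\<close> says that \<open>I\<^sup>n \<subseteq> Ann y + J\<close>. If moreover \<open>I\<^sup>m \<subseteq> Ann y' + J\<close>, then
  \<open>I\<^bsup>n + m\<^esup> \<subseteq> (Ann y + J) (Ann y' + J) \<subseteq> (Ann y \<inter> Ann y') + J\<close>.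
\<close>

lemma (in poly_module) Gamma_add:
  assumes I: "ideal I mpoly_ring" and J: "ideal J mpoly_ring"
    and y: "y \<in> carrier (Gamma mpoly_ring I J N)" "y' \<in> carrier (Gamma mpoly_ring I J N)"
  shows "y \<oplus> y' \<in> carrier (Gamma mpoly_ring I J N)"
proof -
  note J = type_ideal[OF J]
  have carr: "y \<in> carrier N" "y' \<in> carrier N" using y by (auto simp: Gamma_def)
  obtain n where n: "n \<ge> 1" "\<And>r. r \<in> ideal_pow mpoly_ring I n \<Longrightarrow> \<exists>j\<in>J. r \<odot> y = j \<odot> y"
    using y(1) by (fastforce simp: Gamma_def image_subset_iff image_iff)
  obtain m where m: "\<And>r. r \<in> ideal_pow mpoly_ring I m \<Longrightarrow> \<exists>j\<in>J. r \<odot> y' = j \<odot> y'"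
    using y(2) by (fastforce simp: Gamma_def image_subset_iff image_iff)
  have "\<exists>j\<in>J. r \<odot> y = j \<odot> y \<and> r \<odot> y' = j \<odot> y'"
    if "r \<in> ideal_prod mpoly_ring (ideal_pow mpoly_ring I n) (ideal_pow mpoly_ring I m)" for r
    using that
  proof (induction rule: ideal_prod.induct)
    case (prod a c)
    obtain j where j: "j \<in> J" "a \<odot> y = j \<odot> y" using n(2)[OF prod(1)] by blast
    obtain j' where j': "j' \<in> J" "c \<odot> y' = j' \<odot> y'" using m[OF prod(2)] by blast
    \<comment> \<open>\<open>(a - j) (c - j')\<close> annihilates both elements.\<close>
    let ?k = "a * j' + j * c + - (j * j')"
    have zero: "(a - j) \<odot> y = \<zero>" "(c - j') \<odot> y' = \<zero>"
      using poly_add_left[OF carr(1), of a "- j"] poly_add_left[OF carr(2), of c "- j'"] j(2) j'(2) carr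
      by (simp_all add: poly_minus_left M.r_neg)
    have 1: "(a * c) \<odot> y = ?k \<odot> y"
      using poly_add_left[OF carr(1), of "(c - j') * (a - j)" ?k] poly_mult[OF carr(1), of "c - j'" "a - j"] carr zero
      by (simp add: algebra_simps)
    have 2: "(a * c) \<odot> y' = ?k \<odot> y'"
      using poly_add_left[OF carr(2), of "(a - j) * (c - j')" ?k] poly_mult[OF carr(2), of "a - j" "c - j'"] carr zero
      by (simp add: algebra_simps)
    have "?k \<in> J"
      by (rule J(2)[OF J(2)[OF J(3)[OF j'(1)] J(4)[OF j(1)]] J(5)[OF J(3)[OF j'(1)]]])
    with 1 2 show ?case by auto
  next
    case (sum r r')
    then obtain j j' where "j \<in> J" "j' \<in> J" "r \<odot> y = j \<odot> y" "r \<odot> y' = j \<odot> y'"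
      "r' \<odot> y = j' \<odot> y" "r' \<odot> y' = j' \<odot> y'" by blast
    then show ?case
      using carr by (intro bexI[of _ "j + j'"]) (simp_all add: poly_add_left J(2))
  qed
  then have "\<exists>j\<in>J. r \<odot> (y \<oplus> y') = j \<odot> (y \<oplus> y')" if "r \<in> ideal_pow mpoly_ring I (n + m)" for r
    using subsetD[OF ideal_pow_add_subset[OF ring_of_type_algebra_ring I] that] carr
    by (fastforce simp: poly_add_right)
  then show ?thesis
    using carr n(1) unfolding Gamma_def by (auto simp: image_subset_iff image_iff intro!: exI[of _ "n + m"])
qed

lemma (in poly_module) Gamma_zero:
  assumes "ideal J mpoly_ring"
  shows "\<zero> \<in> carrier (Gamma mpoly_ring I J N)"
  using type_ideal(1)[OF assms] by (auto simp: Gamma_def image_iff intro!: exI[of _ 1])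

lemma Gamma_simps:
  "add (Gamma R I J N) = add N" "\<zero>\<^bsub>Gamma R I J N\<^esub> = \<zero>\<^bsub>N\<^esub>"
  by (simp_all add: Gamma_def)

text \<open>
  The addition of cosets is well behaved as soon as the coboundaries are closed under addition, and
  the further properties of a group will be transported from the Cech cohomology.
\<close>

lemma local_cohomology_closed:
  fixes E :: "nat \<Rightarrow> (('n::{finite,linorder}, 'a::comm_ring_1) mpoly, 'e) module"
    and gE :: "nat \<Rightarrow> int \<Rightarrow> 'e set" and d :: "nat \<Rightarrow> 'e \<Rightarrow> 'e" and i :: nat
  assumes I: "ideal I mpoly_ring" and J: "ideal J mpoly_ring"
    and E: "\<And>k. left_module mpoly_ring (E k)" and d: "\<And>k. abelian_group_hom (E k) (E (Suc k)) (d k)"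
  defines "H \<equiv> local_cohomology mpoly_ring I J E d i"
  shows "\<zero>\<^bsub>H\<^esub> \<in> carrier H" "\<zero>\<^bsub>H\<^esub> \<oplus>\<^bsub>H\<^esub> \<zero>\<^bsub>H\<^esub> = \<zero>\<^bsub>H\<^esub>"
    "\<And>x y. x \<in> carrier H \<Longrightarrow> y \<in> carrier H \<Longrightarrow> x \<oplus>\<^bsub>H\<^esub> y \<in> carrier H"
    "local_cohomology_grading mpoly_ring I J E gE d i u \<subseteq> carrier H"
proof -
  let ?C = "\<lambda>k. Gamma mpoly_ring I J (E k)"
  define B where "B = coboundaries ?C d i"
  define Z where "Z = cocycles ?C d i"
  interpret Ei: poly_module "E i" by (rule poly_module.intro[OF E])
  have B: "B \<subseteq> carrier (E i)" "\<zero>\<^bsub>E i\<^esub> \<in> B" "\<And>x y. x \<in> B \<Longrightarrow> y \<in> B \<Longrightarrow> x \<oplus>\<^bsub>E i\<^esub> y \<in> B"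
  proof -
    have "B \<subseteq> carrier (E i) \<and> \<zero>\<^bsub>E i\<^esub> \<in> B \<and> (\<forall>x\<in>B. \<forall>y\<in>B. x \<oplus>\<^bsub>E i\<^esub> y \<in> B)"
    proof (cases i)
      case 0
      then have "B = {\<zero>\<^bsub>E i\<^esub>}" by (simp add: B_def coboundaries_def Gamma_simps)
      then show ?thesis by simp
    next
      case (Suc k)
      then have B_eq: "B = d k ` carrier (?C k)" by (simp add: B_def coboundaries_def)
      interpret Ek: poly_module "E k" by (rule poly_module.intro[OF E])
      interpret d: abelian_group_hom "E k" "E (Suc k)" "d k" by (rule d)
      have sub: "x \<in> carrier (E k)" if "x \<in> carrier (?C k)" for x
        using that by (simp add: Gamma_def)
      have zero: "\<zero>\<^bsub>E i\<^esub> = d k \<zero>\<^bsub>E k\<^esub>" using Suc d.hom_zero by simp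
      have add: "d k x \<oplus>\<^bsub>E i\<^esub> d k y = d k (x \<oplus>\<^bsub>E k\<^esub> y)" if "x \<in> carrier (?C k)" "y \<in> carrier (?C k)" for x y
        using sub that d.hom_add Suc by simp
      have closed: "d k x \<in> carrier (E i)" if "x \<in> carrier (?C k)" for x
        using sub that d.hom_closed Suc by simp
      show ?thesis
      proof (intro conjI ballI)
        show "B \<subseteq> carrier (E i)" unfolding B_eq using closed by blast
        show "\<zero>\<^bsub>E i\<^esub> \<in> B" unfolding B_eq zero by (rule imageI[OF Ek.Gamma_zero[OF J]])
        fix x y assume "x \<in> B" "y \<in> B"
        then obtain x' y' where x': "x' \<in> carrier (?C k)" "x = d k x'" and y': "y' \<in> carrier (?C k)" "y = d k y'"
          unfolding B_eq by blast
        show "x \<oplus>\<^bsub>E i\<^esub> y \<in> B"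
          unfolding x'(2) y'(2) add[OF x'(1) y'(1)] B_eq by (rule imageI[OF Ek.Gamma_add[OF I J x'(1) y'(1)]])
      qed
    qed
    then show "B \<subseteq> carrier (E i)" "\<zero>\<^bsub>E i\<^esub> \<in> B" "\<And>x y. x \<in> B \<Longrightarrow> y \<in> B \<Longrightarrow> x \<oplus>\<^bsub>E i\<^esub> y \<in> B" by blast+
  qed
  interpret di: abelian_group_hom "E i" "E (Suc i)" "d i" by (rule d)
  have Z: "Z \<subseteq> carrier (E i)" "\<zero>\<^bsub>E i\<^esub> \<in> Z" "\<And>x y. x \<in> Z \<Longrightarrow> y \<in> Z \<Longrightarrow> x \<oplus>\<^bsub>E i\<^esub> y \<in> Z"
  proof -
    have Z_eq: "Z = {x \<in> carrier (?C i). d i x = \<zero>\<^bsub>E (Suc i)\<^esub>}"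
      by (simp add: Z_def cocycles_def Gamma_simps)
    show Zc: "Z \<subseteq> carrier (E i)" unfolding Z_eq by (auto simp: Gamma_def)
    show "\<zero>\<^bsub>E i\<^esub> \<in> Z" unfolding Z_eq using Ei.Gamma_zero[OF J] by simp
    fix x y assume "x \<in> Z" "y \<in> Z"
    moreover from this have "x \<in> carrier (E i)" "y \<in> carrier (E i)" using Zc by blast+
    ultimately show "x \<oplus>\<^bsub>E i\<^esub> y \<in> Z" unfolding Z_eq using Ei.Gamma_add[OF I J] by simp
  qed
  define q where "q x = B +>\<^bsub>?C i\<^esub> x" for x
  have q: "q x = (\<lambda>b. b \<oplus>\<^bsub>E i\<^esub> x) ` B" for x
    by (auto simp: q_def a_r_coset_def r_coset_def Gamma_simps)
  have H: "carrier H = q ` Z" "\<zero>\<^bsub>H\<^esub> = B" "x \<oplus>\<^bsub>H\<^esub> y = {a \<oplus>\<^bsub>E i\<^esub> b | a b. a \<in> x \<and> b \<in> y}" for x y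
    by (auto simp: H_def local_cohomology_def cohomology_def Let_def B_def Z_def q_def set_add_def set_mult_def Gamma_simps)
  have q0: "q \<zero>\<^bsub>E i\<^esub> = B" unfolding q using B(1) by (force simp: subset_iff)
  have add: "q x \<oplus>\<^bsub>H\<^esub> q y = q (x \<oplus>\<^bsub>E i\<^esub> y)" if x: "x \<in> Z" "y \<in> Z" for x y
  proof -
    have xy: "x \<in> carrier (E i)" "y \<in> carrier (E i)" using x Z(1) by blast+
    have swap: "(a \<oplus>\<^bsub>E i\<^esub> x) \<oplus>\<^bsub>E i\<^esub> (b \<oplus>\<^bsub>E i\<^esub> y) = (a \<oplus>\<^bsub>E i\<^esub> b) \<oplus>\<^bsub>E i\<^esub> (x \<oplus>\<^bsub>E i\<^esub> y)" if "a \<in> B" "b \<in> B" for a b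
      using that xy B(1) by (simp add: Ei.M.a_ac subset_iff)
    show ?thesis
    proof (intro equalityI subsetI)
      fix t assume "t \<in> q x \<oplus>\<^bsub>H\<^esub> q y"
      then obtain a b where "a \<in> B" "b \<in> B" "t = (a \<oplus>\<^bsub>E i\<^esub> x) \<oplus>\<^bsub>E i\<^esub> (b \<oplus>\<^bsub>E i\<^esub> y)"
        unfolding H(3) q by blast
      then show "t \<in> q (x \<oplus>\<^bsub>E i\<^esub> y)" unfolding q using swap B(3) by auto
    next
      fix t assume "t \<in> q (x \<oplus>\<^bsub>E i\<^esub> y)"
      then obtain a where a: "a \<in> B" "t = a \<oplus>\<^bsub>E i\<^esub> (x \<oplus>\<^bsub>E i\<^esub> y)" unfolding q by blast
      then have "t = (a \<oplus>\<^bsub>E i\<^esub> x) \<oplus>\<^bsub>E i\<^esub> (\<zero>\<^bsub>E i\<^esub> \<oplus>\<^bsub>E i\<^esub> y)"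
        using swap[OF a(1) B(2)] B(1) xy by (simp add: subset_iff)
      then show "t \<in> q x \<oplus>\<^bsub>H\<^esub> q y" unfolding H(3) q using a(1) B(2) by blast
    qed
  qed
  show "\<zero>\<^bsub>H\<^esub> \<in> carrier H" using q0 Z(2) H(1,2) by (metis imageI)
  show "\<zero>\<^bsub>H\<^esub> \<oplus>\<^bsub>H\<^esub> \<zero>\<^bsub>H\<^esub> = \<zero>\<^bsub>H\<^esub>"
    using add[OF Z(2) Z(2)] q0 H(2) by simp
  show "x \<oplus>\<^bsub>H\<^esub> y \<in> carrier H" if "x \<in> carrier H" "y \<in> carrier H" for x y
    using that add Z(3) unfolding H(1) by auto
  show "local_cohomology_grading mpoly_ring I J E gE d i u \<subseteq> carrier H"
    unfolding H(1) local_cohomology_grading_def cohomology_grading_def Z_def B_def q_def by blast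
qed

section \<open>Transport of structure\<close>

text \<open>
  Since \<open>\<phi>\<close> is an additive bijection onto a group, the addition of \<open>H\<close> is that of a group once it stays
  inside the carrier and \<open>\<phi>\<close> maps zero to zero; the latter holds because zero is idempotent.
\<close>

lemma transport_eulerian:
  fixes H :: "('r, 'h) module" and N :: "(('n::{finite,linorder}, 'a::comm_ring_1) weyl, 'k) module"
  assumes N: "generalized_eulerian N gN"
    and H: "\<zero>\<^bsub>H\<^esub> \<in> carrier H" "\<zero>\<^bsub>H\<^esub> \<oplus>\<^bsub>H\<^esub> \<zero>\<^bsub>H\<^esub> = \<zero>\<^bsub>H\<^esub>"
      "\<And>x y. x \<in> carrier H \<Longrightarrow> y \<in> carrier H \<Longrightarrow> x \<oplus>\<^bsub>H\<^esub> y \<in> carrier H"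
    and gH: "\<And>u. gH u \<subseteq> carrier H"
    and bij: "bij_betw \<phi> (carrier H) (carrier N)"
    and add: "\<And>x y. x \<in> carrier H \<Longrightarrow> y \<in> carrier H \<Longrightarrow> \<phi> (x \<oplus>\<^bsub>H\<^esub> y) = \<phi> x \<oplus>\<^bsub>N\<^esub> \<phi> y"
    and deg: "\<And>u. \<phi> ` gH u = gN u"
  shows "generalized_eulerian (transport_action H N \<phi>) gH"
proof -
  interpret N: graded weyl_algebra weyl_grading N gN using N by (simp add: generalized_eulerian_iff)
  define T where "T = transport_action H N \<phi>"
  define \<psi> where "\<psi> = inv_into (carrier H) \<phi>"
  have T: "carrier T = carrier H" "\<zero>\<^bsub>T\<^esub> = \<zero>\<^bsub>H\<^esub>" "x \<oplus>\<^bsub>T\<^esub> y = x \<oplus>\<^bsub>H\<^esub> y" "w \<odot>\<^bsub>T\<^esub> x = \<psi> (w \<odot>\<^bsub>N\<^esub> \<phi> x)" for x y w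
    by (simp_all add: T_def transport_action_def \<psi>_def)
  have \<phi>_closed [simp]: "\<phi> x \<in> carrier N" if "x \<in> carrier H" for x using bij_betwE[OF bij] that by blast
  have \<psi>_closed [simp]: "\<psi> y \<in> carrier H" if "y \<in> carrier N" for y
    using bij that unfolding \<psi>_def by (metis bij_betw_def inv_into_into)
  have \<psi>\<phi> [simp]: "\<psi> (\<phi> x) = x" if "x \<in> carrier H" for x
    using bij that unfolding \<psi>_def by (simp add: bij_betw_inv_into_left)
  have \<phi>\<psi> [simp]: "\<phi> (\<psi> y) = y" if "y \<in> carrier N" for y
    using bij that unfolding \<psi>_def by (simp add: bij_betw_inv_into_right)
  have inj: "x = y" if "x \<in> carrier H" "y \<in> carrier H" "\<phi> x = \<phi> y" for x y
    using that \<psi>\<phi> by metis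
  have "\<phi> \<zero>\<^bsub>H\<^esub> \<oplus>\<^bsub>N\<^esub> \<phi> \<zero>\<^bsub>H\<^esub> = \<phi> \<zero>\<^bsub>H\<^esub>" using add[OF H(1,1)] H(2) by simp
  then have \<phi>0: "\<phi> \<zero>\<^bsub>H\<^esub> = \<zero>\<^bsub>N\<^esub>" using H(1) by simp
  have T_group: "abelian_group T"
  proof (rule abelian_groupI)
    fix x assume x: "x \<in> carrier T"
    have "\<psi> (\<ominus>\<^bsub>N\<^esub> \<phi> x) \<oplus>\<^bsub>T\<^esub> x = \<zero>\<^bsub>T\<^esub>"
      using x H by (intro inj) (simp_all add: T add \<phi>0 N.M.l_neg)
    then show "\<exists>y\<in>carrier T. y \<oplus>\<^bsub>T\<^esub> x = \<zero>\<^bsub>T\<^esub>" using x by (auto simp: T)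
    show "\<zero>\<^bsub>T\<^esub> \<oplus>\<^bsub>T\<^esub> x = x" using x H by (intro inj) (simp_all add: T add \<phi>0)
  next
    fix x y z assume "x \<in> carrier T" "y \<in> carrier T" "z \<in> carrier T"
    then show "x \<oplus>\<^bsub>T\<^esub> y \<oplus>\<^bsub>T\<^esub> z = x \<oplus>\<^bsub>T\<^esub> (y \<oplus>\<^bsub>T\<^esub> z)"
      using H by (intro inj) (simp_all add: T add N.M.a_assoc)
  next
    fix x y assume "x \<in> carrier T" "y \<in> carrier T"
    then show "x \<oplus>\<^bsub>T\<^esub> y = y \<oplus>\<^bsub>T\<^esub> x"
      using H by (intro inj) (simp_all add: T add N.M.a_comm)
  qed (use H in \<open>simp_all add: T\<close>)
  interpret \<phi>: abelian_group_hom T N \<phi>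
    by (rule additive_mapI[OF T_group N.abelian_group_axioms]) (auto simp: T add)
  interpret \<psi>: abelian_group_hom N T \<psi>
    by (rule additive_mapI[OF N.abelian_group_axioms T_group])
       (auto simp: T add H(3) intro: inj)
  have \<psi>0: "\<psi> \<zero>\<^bsub>N\<^esub> = \<zero>\<^bsub>T\<^esub>" by (rule \<psi>.hom_zero)
  have T_module: "left_module weyl_algebra T"
  proof (intro left_module.intro left_module_axioms.intro weyl.ring_axioms T_group)
    fix a b :: "('n, 'a) weyl" and x y
    assume *: "a \<in> carrier weyl_algebra" "b \<in> carrier weyl_algebra" "x \<in> carrier T" "y \<in> carrier T"
    show "a \<odot>\<^bsub>T\<^esub> x \<in> carrier T" using * by (simp add: T N.smult_closed)
    show "(a \<oplus>\<^bsub>weyl_algebra\<^esub> b) \<odot>\<^bsub>T\<^esub> x = a \<odot>\<^bsub>T\<^esub> x \<oplus>\<^bsub>T\<^esub> b \<odot>\<^bsub>T\<^esub> x"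
      using * H by (intro inj) (simp_all add: T add N.smult_closed N.smult_l_distr)
    show "a \<odot>\<^bsub>T\<^esub> (x \<oplus>\<^bsub>T\<^esub> y) = a \<odot>\<^bsub>T\<^esub> x \<oplus>\<^bsub>T\<^esub> a \<odot>\<^bsub>T\<^esub> y"
      using * H by (intro inj) (simp_all add: T add N.smult_closed N.smult_r_distr)
    show "(a \<otimes>\<^bsub>weyl_algebra\<^esub> b) \<odot>\<^bsub>T\<^esub> x = a \<odot>\<^bsub>T\<^esub> (b \<odot>\<^bsub>T\<^esub> x)"
      using * by (simp add: T N.smult_closed N.smult_assoc)
  next
    fix x assume "x \<in> carrier T"
    then show "\<one>\<^bsub>weyl_algebra\<^esub> \<odot>\<^bsub>T\<^esub> x = x" by (simp add: T N.smult_one)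
  qed
  have gH_eq: "gH u = \<psi> ` gN u" for u
    using gH[of u] by (auto simp: deg[symmetric] image_image subset_iff intro!: rev_image_eqI)
  have component: "additive_subgroup (gH u) T" for u
    unfolding gH_eq
    using group_hom.subgroup_img_is_subgroup[OF \<psi>.a_group_hom] N.component_subgroup
    by (simp add: additive_subgroup_def)
  have "carrier T \<subseteq> homogeneous_span T gH"
  proof
    fix x assume x: "x \<in> carrier T"
    then have "\<psi> (\<phi> x) \<in> homogeneous_span T gH"
      using N.spanned by (intro span_image[OF \<psi>.is_abelian_group_hom N.subgroup_family_axioms]) (auto simp: gH_eq T)
    then show "x \<in> homogeneous_span T gH" using x by (simp add: T)
  qed
  moreover have "independent_components T gH"
    unfolding independent_components_def
  proof (intro allI impI ballI)
    fix F f u assume F: "finite F" "\<forall>u\<in>F. f u \<in> gH u" "finsum T f F = \<zero>\<^bsub>T\<^esub>" "u \<in> F"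
    have fT: "f \<in> F \<rightarrow> carrier T" using F(2) gH by (auto simp: T)
    have "finsum N (\<lambda>u. \<phi> (f u)) F = \<zero>\<^bsub>N\<^esub>"
      using \<phi>.hom_finsum[OF fT] F(3) by simp
    then have "\<phi> (f u) = \<zero>\<^bsub>N\<^esub>"
      using F deg by (intro independent_componentsD[OF N.independent F(1), of "\<lambda>u. \<phi> (f u)"]) auto
    then show "f u = \<zero>\<^bsub>T\<^esub>"
      using fT F(4) H(1) \<phi>0 by (intro inj) (auto simp: T)
  qed
  moreover have "r \<odot>\<^bsub>T\<^esub> y \<in> gH (u + v)" if "r \<in> weyl_grading u" "y \<in> gH v" for r u y v
    using N.smult_degree[OF that(1), of "\<phi> y" v] that(2) deg by (auto simp: T gH_eq[of "u + v"])
  ultimately have "graded weyl_algebra weyl_grading T gH"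
    by (intro gradedI T_module component) auto
  moreover have "\<exists>a>0. weyl_class (euler_shift u ^ a) \<odot>\<^bsub>T\<^esub> y = \<zero>\<^bsub>T\<^esub>" if "y \<in> gH u" for u y
  proof -
    have "\<phi> y \<in> gN u" using that deg by blast
    then show ?thesis using N \<psi>0 unfolding generalized_eulerian_iff T(4) by metis
  qed
  ultimately show ?thesis unfolding generalized_eulerian_iff T_def by blast
qed

theorem theorem10p9:
  fixes K :: "'a::comm_ring_1 set"
    and I J :: "('n::{finite,linorder}, 'a) mpoly set"
    and L :: "(('n, 'a) weyl, 'l) module"
    and gL :: "int \<Rightarrow> 'l set"
    and b :: "('n, 'a) mpoly list"
    and i :: nat
  assumes "noetherian_ring (ring_of_type_algebra :: 'a ring)"
    and "subfield K (ring_of_type_algebra :: 'a ring)"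
    and "\<forall>k::nat. k > 0 \<longrightarrow> (of_nat k :: 'a) \<noteq> 0"
    and "homogeneous_ideal mpoly_ring poly_grading I"
    and "homogeneous_ideal mpoly_ring poly_grading J"
    and "generalized_eulerian L gL"
    and "set b \<subseteq> (\<Union>u. poly_grading u)"
    and "I = genideal mpoly_ring (set b)"
  shows "generalized_eulerian (cech_cohomology b J L i) (cech_cohomology_grading b J L gL i) \<and>
    (\<forall>(E :: nat \<Rightarrow> (('n, 'a) mpoly, 'e) module) gE d \<epsilon> \<phi>.
      graded_injective_resolution mpoly_ring poly_grading (underlying_module L) gL E gE d \<epsilon> \<longrightarrow>
      graded_iso mpoly_ring
        (local_cohomology mpoly_ring I J E d i)
        (local_cohomology_grading mpoly_ring I J E gE d i)
        (underlying_module (cech_cohomology b J L i))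
        (cech_cohomology_grading b J L gL i) \<phi> \<longrightarrow>
      generalized_eulerian
        (transport_action (local_cohomology mpoly_ring I J E d i) (cech_cohomology b J L i) \<phi>)
        (local_cohomology_grading mpoly_ring I J E gE d i))"
proof (intro conjI allI impI)
  have I: "ideal I mpoly_ring" and J: "ideal J mpoly_ring"
    using assms(4,5) by (auto intro: homogeneous_ideal_ideal)
  show cech: "generalized_eulerian (cech_cohomology b J L i) (cech_cohomology_grading b J L gL i)"
    using assms(6) J assms(7) by (rule cech_cohomology_eulerian)
  fix E :: "nat \<Rightarrow> (('n, 'a) mpoly, 'e) module" and gE d \<epsilon> \<phi>
  assume res: "graded_injective_resolution mpoly_ring poly_grading (underlying_module L) gL E gE d \<epsilon>"
    and iso: "graded_iso mpoly_ring (local_cohomology mpoly_ring I J E d i)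
        (local_cohomology_grading mpoly_ring I J E gE d i)
        (underlying_module (cech_cohomology b J L i)) (cech_cohomology_grading b J L gL i) \<phi>"
  have E: "graded mpoly_ring poly_grading (E k) (gE k)" for k
    using res unfolding graded_injective_resolution_def graded_injective_def graded_module_iff_graded by blast
  have d: "abelian_group_hom (E k) (E (Suc k)) (d k)" for k
  proof -
    have "graded_hom mpoly_ring (E k) (gE k) (E (Suc k)) (gE (Suc k)) (d k)"
      using res unfolding graded_injective_resolution_def by blast
    then show ?thesis unfolding graded_hom_iff[OF E E] by blast
  qed
  note closed = local_cohomology_closed[where E = E and d = d and i = i, OF I J graded.axioms(1)[OF E] d]
  show "generalized_eulerian
        (transport_action (local_cohomology mpoly_ring I J E d i) (cech_cohomology b J L i) \<phi>)
        (local_cohomology_grading mpoly_ring I J E gE d i)"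
    using iso unfolding graded_iso_def graded_hom_def
    by (intro transport_eulerian[OF cech closed]) (simp_all add: restrict_scalars_simps)
qed

end
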